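(* Let $n,m,k\ge 1$ be integers, let $\Omega=\{\omega_1,\dots,\omega_k\}$ be a set of basis input functions of the form described in the context, with $\ell_{\max}=\max\{\ell_1,\dots,\ell_k\}$, and let $\mathcal{C}_{m,1}$ be the associated sign system concept class with scalar observations ($p=1$). Then, for identifiers that agree with the observed sample, the sample complexity $s(\epsilon,\delta)$ for learning $\mathcal{C}_{m,1}$ (with $\epsilon>0$, $\delta>0$) satisfies $$s(\epsilon,\delta)\le \max\left\{\frac{8\,\mathrm{VC}(\mathcal{C}_{m,1})}{\epsilon}\log_2\left(\frac{8e}{\epsilon}\right),\ \frac{4}{\epsilon}\log_2\left(\frac{2}{\delta}\right)\right\},$$ where $$\mathrm{VC}(\mathcal{C}_{m,1})\le 2(2mn^2+4n+1)\log_2\Big[8e\big(8mn^2k(n+\ell_{\max})+1\big)\big(2nk+2(1+2k)^n\big)\Big].$$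
   Context: Basis input functions: $\omega_1,\dots,\omega_k:[0,1]\to\mathbb{R}$ are linearly independent, and for each $j$ either $\omega_j(t)=t^{\ell_j}e^{\alpha_j t}\sin(\beta_j t)$ or $\omega_j(t)=t^{\ell_j}e^{\alpha_j t}\cos(\beta_j t)$ with $\ell_j\in\{0,1,2,\dots\}$ and $\alpha_j,\beta_j\in\mathbb{R}$. Put $\omega=(\omega_1,\dots,\omega_k)^T$. Systems: a linear system $\Sigma=(A,B,C,x^0)$ of dimension $n$ with $m$ inputs and $p$ outputs is $\dot x=Ax+Bu$, $x(0)=x^0$, $y=Cx$ on $[0,1]$, with $A,B,C$ real matrices of sizes $n\times n$, $n\times m$, $p\times n$ and $x^0\in\mathbb{R}^n$. Let $X_\Omega=\{G\omega:[0,1]\to\mathbb{R}^m : G\in\mathbb{R}^{m\times k}\}$ (identified with $\mathbb{R}^{mk}$). Let $\Phi_\Sigma:X_\Omega\to\mathbb{R}^p$ be $\Phi_\Sigma(G\omega)=y(1)$, the final output of $\Sigma$ under control $u=G\omega$, and $S_\Sigma=\mathrm{sign}\circ\Phi_\Sigma:X_\Omega\to\{0,1\}^p$, where sign is applied componentwise with $\mathrm{sign}\,z=1$ if $z>0$ and $\mathrm{sign}\,z=0$ if $z\le 0$. The sign system concept class is $\mathcal{C}_{m,p}=\{S_\Sigma:\Sigma\text{ a linear system of dimension }n\}$. VC-dimension: for a class $\mathcal{C}$ of maps $X\to\{0,1\}$, a set $D\subseteq X$ is shattered if every map $D\to\{0,1\}$ is the restriction to $D$ of some element of $\mathcal{C}$;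 $\mathrm{VC}(\mathcal{C})$ is the largest cardinality of a shattered set. Learning: let $X=X_\Omega$ and $\mathcal{C}=\mathcal{C}_{m,1}$. Let $W$ be the set of all sequences $w=(u_1,\phi(u_1)),\dots,(u_s,\phi(u_s))$ with $s\ge 1$, $u_i\in X$, $\phi\in\mathcal{C}$. An identifier is a map $\psi:W\to\mathcal{C}$, $w\mapsto\psi_w$; it agrees with the observed sample if $\psi_w(u_i)=\phi(u_i)$ for all $i$. For a probability measure $P$ on $X$, $\mathrm{Err}(P,\phi,u_1,\dots,u_s)=P\{u\in X:\psi_w(u)\ne\phi(u)\}$. The sample complexity $s(\epsilon,\delta)$ is the smallest $s$ such that for every probability measure $P$ on $X$ and every $\phi\in\mathcal{C}$, $P^s\{(u_1,\dots,u_s)\in X^s:\mathrm{Err}(P,\phi,u_1,\dots,u_s)>\epsilon\}<\delta$, where $P^s$ is the $s$-fold product measure. All sets appearing are assumed measurable (standing assumption).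
   Formalization: The bound on s(ε,δ) is stated as written for 0<ε≤1; for ε>1 the right-hand side is replaced by its maximum with 1, since for large ε and δ (e.g. ε=100, δ=3) the original right-hand side is negative while s≥1. *)

theory Defs
  imports "HOL-Probability.Probability" "HOL-Library.Extended_Nat"
begin

text \<open>A finite type \<open>'k\<close> indexes the basis inputs, and only their values on \<open>[0,1]\<close> matter.\<close>

definition basis_inputs ::
  "('k::finite \<Rightarrow> nat) \<Rightarrow> ('k \<Rightarrow> real) \<Rightarrow> ('k \<Rightarrow> real) \<Rightarrow> ('k \<Rightarrow> real \<Rightarrow> real) \<Rightarrow> bool" where
  "basis_inputs l \<alpha> \<beta> \<omega> \<longleftrightarrow>
     (\<forall>j. (\<forall>t\<in>{0..1}. \<omega> j t = t ^ l j * exp (\<alpha> j * t) * sin (\<beta> j * t)) \<or>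
          (\<forall>t\<in>{0..1}. \<omega> j t = t ^ l j * exp (\<alpha> j * t) * cos (\<beta> j * t))) \<and>
     (\<forall>c :: 'k \<Rightarrow> real. (\<forall>t\<in>{0..1}. (\<Sum>j\<in>UNIV. c j * \<omega> j t) = 0) \<longrightarrow> (\<forall>j. c j = 0))"

text \<open>The control \<open>G \<omega>\<close>.  By linear independence \<open>G\<close> is determined by the control, so the input
  space is identified with the space of matrices \<open>G\<close>.\<close>

definition control :: "('k::finite \<Rightarrow> real \<Rightarrow> real) \<Rightarrow> real^'k^'m \<Rightarrow> real \<Rightarrow> real^'m::finite" where
  "control \<omega> G t = G *v (\<chi> j. \<omega> j t)"

definition is_trajectory ::
  "real^'n^'n \<Rightarrow> real^'m^'n \<Rightarrow> real^'n \<Rightarrow> (real \<Rightarrow> real^'m::finite) \<Rightarrow> (real \<Rightarrow> real^'n::finite) \<Rightarrow> bool" where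
  "is_trajectory A B x0 u x \<longleftrightarrow>
     x 0 = x0 \<and>
     (\<forall>t\<in>{0..1}. (x has_vector_derivative (A *v x t + B *v u t)) (at t within {0..1}))"

text \<open>The output \<open>y(1)\<close>.  For continuous \<open>u\<close> the trajectory on \<open>[0,1]\<close> exists and is unique.\<close>

definition final_output ::
  "real^'n^'n \<Rightarrow> real^'m^'n \<Rightarrow> real^'n^'p \<Rightarrow> real^'n::finite \<Rightarrow> (real \<Rightarrow> real^'m::finite) \<Rightarrow> real^'p::finite" where
  "final_output A B C x0 u = (THE y. \<exists>x. is_trajectory A B x0 u x \<and> y = C *v x 1)"

text \<open>\<open>True\<close> and \<open>False\<close> stand for the sign values 1 and 0.\<close>

definition sign_system ::
  "('k::finite \<Rightarrow> real \<Rightarrow> real) \<Rightarrow> real^'n^'n \<Rightarrow> real^'m^'n \<Rightarrow> real^'n^'p \<Rightarrow> real^'n::finite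
    \<Rightarrow> real^'k^'m::finite \<Rightarrow> bool^'p::finite" where
  "sign_system \<omega> A B C x0 G = (\<chi> i. final_output A B C x0 (control \<omega> G) $ i > 0)"

text \<open>The type argument fixes the state dimension \<open>CARD('n)\<close>.\<close>

definition sign_class ::
  "'n::finite itself \<Rightarrow> ('k::finite \<Rightarrow> real \<Rightarrow> real) \<Rightarrow> (real^'k^'m::finite \<Rightarrow> bool^'p::finite) set" where
  "sign_class _ \<omega> =
     {S. \<exists>(A :: real^'n^'n) B C x0. S = sign_system \<omega> A B C x0}"

definition scalar_sign_class ::
  "'n::finite itself \<Rightarrow> ('k::finite \<Rightarrow> real \<Rightarrow> real) \<Rightarrow> (real^'k^'m::finite \<Rightarrow> bool) set" where
  "scalar_sign_class N \<omega> =
     (\<lambda>(S :: real^'k^'m \<Rightarrow> bool^1) G. S G $ 1) ` sign_class N \<omega>"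

definition shattered :: "('x \<Rightarrow> bool) set \<Rightarrow> 'x set \<Rightarrow> bool" where
  "shattered \<C> D \<longleftrightarrow> (\<forall>f :: 'x \<Rightarrow> bool. \<exists>h\<in>\<C>. \<forall>x\<in>D. h x = f x)"

text \<open>Subsets of shattered sets are shattered, so restricting to finite sets loses nothing: the
  value is \<open>\<infinity>\<close> exactly if there are arbitrarily large shattered sets.\<close>

definition vc_dim :: "('x \<Rightarrow> bool) set \<Rightarrow> enat" where
  "vc_dim \<C> = (SUP D\<in>{D. finite D \<and> shattered \<C> D}. enat (card D))"

definition labelled :: "('x \<Rightarrow> bool) \<Rightarrow> 'x list \<Rightarrow> ('x \<times> bool) list" where
  "labelled \<phi> us = map (\<lambda>u. (u, \<phi> u)) us"

definition samples :: "('x \<Rightarrow> bool) set \<Rightarrow> ('x \<times> bool) list set" where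
  "samples \<C> = {labelled \<phi> us | \<phi> us. \<phi> \<in> \<C> \<and> us \<noteq> []}"

definition is_identifier :: "('x \<Rightarrow> bool) set \<Rightarrow> (('x \<times> bool) list \<Rightarrow> 'x \<Rightarrow> bool) \<Rightarrow> bool" where
  "is_identifier \<C> \<psi> \<longleftrightarrow> (\<forall>w\<in>samples \<C>. \<psi> w \<in> \<C>)"

definition agrees_with_sample ::
  "('x \<Rightarrow> bool) set \<Rightarrow> (('x \<times> bool) list \<Rightarrow> 'x \<Rightarrow> bool) \<Rightarrow> bool" where
  "agrees_with_sample \<C> \<psi> \<longleftrightarrow> (\<forall>w\<in>samples \<C>. \<forall>(u, b)\<in>set w. \<psi> w u = b)"

definition err ::
  "(('x \<times> bool) list \<Rightarrow> 'x \<Rightarrow> bool) \<Rightarrow> 'x measure \<Rightarrow> ('x \<Rightarrow> bool) \<Rightarrow> 'x list \<Rightarrow> real" where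
  "err \<psi> P \<phi> us = measure P {u \<in> space P. \<psi> (labelled \<phi> us) u \<noteq> \<phi> u}"

definition prob_measure :: "'x::topological_space measure \<Rightarrow> bool" where
  "prob_measure P \<longleftrightarrow> prob_space P \<and> sets P = sets borel"

text \<open>A point of the \<open>s\<close>-fold product is a function on \<open>{..<s}\<close>.\<close>

definition bad_samples ::
  "(('x \<times> bool) list \<Rightarrow> 'x \<Rightarrow> bool) \<Rightarrow> 'x measure \<Rightarrow> ('x \<Rightarrow> bool) \<Rightarrow> nat \<Rightarrow> real \<Rightarrow> (nat \<Rightarrow> 'x) set" where
  "bad_samples \<psi> P \<phi> s \<epsilon> =
     {x \<in> space (PiM {..<s} (\<lambda>_. P)). err \<psi> P \<phi> (map x [0..<s]) > \<epsilon>}"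

text \<open>The standing measurability assumption.  It is explicit because \<open>measure\<close> is \<open>0\<close> on
  nonmeasurable sets.\<close>

definition measurable_errors ::
  "('x::topological_space \<Rightarrow> bool) set \<Rightarrow> (('x \<times> bool) list \<Rightarrow> 'x \<Rightarrow> bool) \<Rightarrow> real \<Rightarrow> bool" where
  "measurable_errors \<C> \<psi> \<epsilon> \<longleftrightarrow>
     (\<forall>P. prob_measure P \<longrightarrow> (\<forall>\<phi>\<in>\<C>. \<forall>s\<ge>1.
        (\<forall>us. length us = s \<longrightarrow> {u \<in> space P. \<psi> (labelled \<phi> us) u \<noteq> \<phi> u} \<in> sets P) \<and>
        bad_samples \<psi> P \<phi> s \<epsilon> \<in> sets (PiM {..<s} (\<lambda>_. P))))"

text \<open>The value is \<open>\<infinity>\<close> if no sample size works.\<close>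

definition sample_complexity ::
  "('x::topological_space \<Rightarrow> bool) set \<Rightarrow> (('x \<times> bool) list \<Rightarrow> 'x \<Rightarrow> bool) \<Rightarrow> real \<Rightarrow> real \<Rightarrow> enat" where
  "sample_complexity \<C> \<psi> \<epsilon> \<delta> =
     Inf {enat s | s. s \<ge> 1 \<and>
       (\<forall>P. prob_measure P \<longrightarrow>
         (\<forall>\<phi>\<in>\<C>. measure (PiM {..<s} (\<lambda>_. P)) (bad_samples \<psi> P \<phi> s \<epsilon>) < \<delta>))}"

end

theory Submission imports Defs begin

text \<open>The final output of a system is affine in the matrix \<open>G\<close> of the control: it equals
\<open>G \<bullet> w + c\<close>, where the constant \<open>c\<close> comes from the initial state and can be
chosen freely, and where the response \<open>w\<close> consists of the integrals over \<open>[0,1]\<close> of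
the impulse response against the basis inputs.  So the concept class is a class
\<open>affine_signs W\<close> of open half-spaces whose normal vectors range over the set \<open>W\<close> of
responses (\<open>scalar_sign_class_eq\<close>).

VC dimension.  Let \<open>\<rho> t = v exp (A (1 - t))\<close> be the costate, \<open>v\<close> being the output row.
Integration by parts shows that the moments of \<open>\<rho>\<close> against \<open>t ^ l exp (\<alpha> t) cos (\<beta> t)\<close> and
\<open>t ^ l exp (\<alpha> t) sin (\<beta> t)\<close> solve linear systems with matrix
\<open>Q = (\<alpha> I - A)\<^sup>2 + \<beta>\<^sup>2 I\<close>.  By Cramer's rule they are rational functions of \<open>A\<close>, \<open>v\<close> and
\<open>\<rho> 0\<close>, with denominators powers of \<open>det Q\<close>.  The transcendental dependence of the output on
\<open>A\<close> thus disappears when the \<open>n\<close> entries of \<open>\<rho> 0\<close> are treated as independent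
parameters.  Resonances \<open>det Q = 0\<close> cause no trouble: on a finite set of controls, all signs can
be made strict by lowering \<open>c\<close>, and strict signs survive a small shift \<open>A + \<eta> I\<close>, which
removes all resonances.  After multiplication by the squared denominators, each control yields one
polynomial of degree at most \<open>4nk(lmax + 1) + 1\<close> in \<open>n\<^sup>2 + 2n + nm + 1\<close> real parameters, whose sign is the
sign of the output.

It remains to bound the number of sign patterns of \<open>N\<close> polynomials of degree \<open>d\<close> in \<open>\<nu>\<close>
variables.  By \<open>strict_sign_patterns_card\<close> it is at most \<open>(2Nd + 1) ^ \<nu>\<close>: with \<open>g\<close> the
product of the squares of the polynomials and \<open>D = 2Nd + 2\<close>, the function
\<open>g - \<epsilon> (\<Sum>b. x\<^sub>b ^ D)\<close> has a local maximum in every sign cell once \<open>\<epsilon> > 0\<close> is small.  Its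
critical points satisfy \<open>x\<^sub>b ^ (D - 1) = q\<^sub>b x\<close> with \<open>q\<^sub>b\<close> of degree below \<open>D - 1\<close>, and such a
system has at most \<open>(D - 1) ^ \<nu>\<close> solutions, since modulo the equations every polynomial reduces to
monomials with exponents below \<open>D - 1\<close> (\<open>pure_power_system_card\<close>).  A shattered set of \<open>N\<close> controls
therefore satisfies \<open>2 ^ N \<le> (2Nd + 1) ^ \<nu>\<close>, which implies the stated bound.

Sample complexity.  This is the double-sample argument (\<open>double_sample_bound\<close>): if the hypothesis has
error above \<open>\<epsilon>\<close> after a first sample of size \<open>s \<ge> 8 / \<epsilon>\<close>, then with probability at least \<open>1/2\<close> it errs on at least
\<open>\<epsilon> s / 2\<close> points of a second one; exchanging corresponding points of the two samples at random,
and counting labellings by the Sauer-Shelah lemma, shows that this is improbable.  The event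
considered for the double sample is measurable because finitely many labels of any half-space of the
class are also realised in a fixed countable subclass (\<open>affine_signs_countable_approx\<close>).  The
constants leave enough room for the bound to hold for the sample size rounded down to an integer.\<close>

section \<open>Sign patterns of real polynomials\<close>

lemma underdetermined_system:
  fixes M :: "'k \<Rightarrow> 'z \<Rightarrow> real"
  assumes "finite K" "finite Z" "card K < card Z"
  shows "\<exists>c. (\<exists>z\<in>Z. c z \<noteq> 0) \<and> (\<forall>k\<in>K. (\<Sum>z\<in>Z. c z * M k z) = 0)"
  using assms
proof (induction K arbitrary: Z M rule: finite_induct)
  case empty
  then obtain z where "z \<in> Z" by fastforce
  then show ?case by (intro exI[of _ "\<lambda>_. 1"]) auto
next
  case (insert k0 K)
  show ?case
  proof (cases "\<forall>z\<in>Z. M k0 z = 0")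
    case True
    have "card K < card Z" using insert by simp
    then obtain c where c: "\<exists>z\<in>Z. c z \<noteq> 0" "\<forall>k\<in>K. (\<Sum>z\<in>Z. c z * M k z) = 0"
      using insert.IH[of Z M] insert.prems by blast
    moreover have "(\<Sum>z\<in>Z. c z * M k0 z) = 0" using True by simp
    ultimately show ?thesis by auto
  next
    case False
    then obtain z0 where z0: "z0 \<in> Z" "M k0 z0 \<noteq> 0" by blast
    let ?Z = "Z - {z0}"
    let ?M = "\<lambda>k z. M k z - M k z0 * M k0 z / M k0 z0"
    have "card K < card ?Z" using insert z0 by simp
    then obtain c where c: "\<exists>z\<in>?Z. c z \<noteq> 0" "\<forall>k\<in>K. (\<Sum>z\<in>?Z. c z * ?M k z) = 0"
      using insert.IH[of ?Z ?M] insert.prems by blast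
    define c0 where "c0 = - (\<Sum>z\<in>?Z. c z * M k0 z) / M k0 z0"
    define c' where "c' = c(z0 := c0)"
    have split: "(\<Sum>z\<in>Z. c' z * M k z) = c0 * M k z0 + (\<Sum>z\<in>?Z. c z * M k z)" for k
    proof -
      have "(\<Sum>z\<in>Z. c' z * M k z) = c' z0 * M k z0 + (\<Sum>z\<in>?Z. c' z * M k z)"
        using insert.prems z0 by (simp add: sum.remove)
      also have "(\<Sum>z\<in>?Z. c' z * M k z) = (\<Sum>z\<in>?Z. c z * M k z)"
        by (intro sum.cong) (auto simp: c'_def)
      finally show ?thesis by (simp add: c'_def)
    qed
    have "(\<Sum>z\<in>Z. c' z * M k0 z) = 0" using z0 by (simp add: split c0_def)
    moreover have "(\<Sum>z\<in>Z. c' z * M k z) = 0" if "k \<in> K" for k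
    proof -
      have "0 = (\<Sum>z\<in>?Z. c z * ?M k z)" using c(2) that by simp
      also have "\<dots> = (\<Sum>z\<in>?Z. c z * M k z) - (\<Sum>z\<in>?Z. c z * M k0 z * (M k z0 / M k0 z0))"
        by (simp add: algebra_simps sum_subtractf)
      also have "(\<Sum>z\<in>?Z. c z * M k0 z * (M k z0 / M k0 z0)) = - c0 * M k z0"
        unfolding c0_def sum_distrib_right[symmetric] by simp
      finally show ?thesis by (simp add: split)
    qed
    moreover have "\<exists>z\<in>Z. c' z \<noteq> 0" using c(1) by (auto simp: c'_def)
    ultimately show ?thesis by (intro exI[of _ c']) auto
  qed
qed

text \<open>Monomials are represented by lists of basis vectors, so that the degree is the length and the product
is concatenation.\<close>

definition monom_fun :: "'a::euclidean_space list \<Rightarrow> 'a \<Rightarrow> real" where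
  "monom_fun bs x = (\<Prod>b\<leftarrow>bs. x \<bullet> b)"

text \<open>Polynomial functions of degree at most \<open>d\<close> on a Euclidean space.\<close>

inductive polydeg :: "nat \<Rightarrow> ('a::euclidean_space \<Rightarrow> real) \<Rightarrow> bool" for d where
  monom: "set bs \<subseteq> Basis \<Longrightarrow> length bs \<le> d \<Longrightarrow> polydeg d (\<lambda>x. c * monom_fun bs x)"
| add: "polydeg d f \<Longrightarrow> polydeg d g \<Longrightarrow> polydeg d (\<lambda>x. f x + g x)"

lemma monom_fun_simps [simp]:
  "monom_fun [] x = 1" "monom_fun (b # bs) x = (x \<bullet> b) * monom_fun bs x"
  "monom_fun (bs @ cs) x = monom_fun bs x * monom_fun cs x"
  by (auto simp: monom_fun_def)

lemma polydeg_mono: "polydeg d f \<Longrightarrow> d \<le> e \<Longrightarrow> polydeg e f"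
  by (induction rule: polydeg.induct) (auto intro: polydeg.intros)

lemma polydeg_const: "polydeg d (\<lambda>_. c)"
  using polydeg.monom[of "[]" d c] by simp

lemma polydeg_coord: "b \<in> Basis \<Longrightarrow> polydeg 1 (\<lambda>x. x \<bullet> b)"
  using polydeg.monom[of "[b]" 1 1] by simp

lemma polydeg_mult:
  assumes "polydeg d f" "polydeg e g"
  shows "polydeg (d + e) (\<lambda>x. f x * g x)"
  using assms(1)
proof (induction rule: polydeg.induct)
  case (monom bs c)
  show ?case using assms(2)
  proof (induction rule: polydeg.induct)
    case (monom cs c')
    then show ?case
      using polydeg.monom[of "bs @ cs" "d + e" "c * c'"] \<open>set bs \<subseteq> Basis\<close> \<open>length bs \<le> d\<close>
      by (simp add: mult_ac)
  next
    case (add f g)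
    then show ?case using polydeg.add by (simp add: distrib_left)
  qed
next
  case (add f g)
  then show ?case using polydeg.add by (simp add: distrib_right)
qed

lemma polydeg_cmult: "polydeg d f \<Longrightarrow> polydeg d (\<lambda>x. c * f x)"
  using polydeg_mult[OF polydeg_const[of 0 c]] by simp

lemma polydeg_diff: "polydeg d f \<Longrightarrow> polydeg d g \<Longrightarrow> polydeg d (\<lambda>x. f x - g x)"
  using polydeg.add[OF _ polydeg_cmult[of d g "-1"]] by simp

lemma polydeg_sum: "(\<And>i. i \<in> I \<Longrightarrow> polydeg d (f i)) \<Longrightarrow> polydeg d (\<lambda>x. \<Sum>i\<in>I. f i x)"
  by (induction I rule: infinite_finite_induct) (auto intro: polydeg_const polydeg.add)

lemma polydeg_prod:
  "(\<And>i. i \<in> I \<Longrightarrow> polydeg (d i) (f i)) \<Longrightarrow> polydeg (\<Sum>i\<in>I. d i) (\<lambda>x. \<Prod>i\<in>I. f i x)"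
  by (induction I rule: infinite_finite_induct) (auto intro: polydeg_const polydeg_mult)

lemma polydeg_power: "polydeg d f \<Longrightarrow> polydeg (n * d) (\<lambda>x. f x ^ n)"
  by (induction n) (auto intro: polydeg_const polydeg_mult)

lemma polydeg_linear:
  fixes f :: "'a::euclidean_space \<Rightarrow> real"
  assumes "linear f"
  shows "polydeg 1 f"
proof -
  have "f x = (\<Sum>b\<in>Basis. f b * (x \<bullet> b))" for x
  proof -
    have "f x = f (\<Sum>b\<in>Basis. (x \<bullet> b) *\<^sub>R b)" by (simp add: euclidean_representation)
    then show ?thesis using assms by (simp add: linear_sum linear_cmul mult.commute)
  qed
  then have "f = (\<lambda>x. \<Sum>b\<in>Basis. f b * (x \<bullet> b))" by blast
  moreover have "polydeg 1 (\<lambda>x. \<Sum>b\<in>Basis. f b * (x \<bullet> b))"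
    by (intro polydeg_sum polydeg_cmult polydeg_coord)
  ultimately show ?thesis by simp
qed

text \<open>If the entries in column \<open>j\<close> have degree \<open>d j\<close>, every term of the Leibniz formula has degree
\<open>\<Sum>j. d j\<close>.\<close>

lemma polydeg_det:
  fixes M :: "'a::euclidean_space \<Rightarrow> real^'n^'n"
  assumes "\<And>i j. polydeg (d j) (\<lambda>x. M x $ i $ j)"
  shows "polydeg (\<Sum>j\<in>UNIV. d j) (\<lambda>x. det (M x))"
  unfolding det_def
proof (intro polydeg_sum polydeg_cmult)
  fix p :: "'n \<Rightarrow> 'n" assume "p \<in> {p. p permutes UNIV}"
  then have "(\<Sum>i\<in>UNIV. d (p i)) = (\<Sum>j\<in>UNIV. d j)"
    using sum.permute[of p UNIV d] by (simp add: o_def)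
  moreover have "polydeg (\<Sum>i\<in>UNIV. d (p i)) (\<lambda>x. \<Prod>i\<in>UNIV. M x $ i $ p i)"
    by (intro polydeg_prod assms)
  ultimately show "polydeg (\<Sum>j\<in>UNIV. d j) (\<lambda>x. \<Prod>i\<in>UNIV. M x $ i $ p i)" by simp
qed

lemma polydeg_growth:
  assumes "polydeg d f"
  shows "\<exists>K\<ge>0. \<forall>x. \<bar>f x\<bar> \<le> K * (1 + norm x) ^ d"
  using assms
proof (induction rule: polydeg.induct)
  case (monom bs c)
  have "\<bar>monom_fun bs x\<bar> \<le> (1 + norm x) ^ length bs" for x
    using monom(1)
  proof (induction bs)
    case (Cons b bs)
    have "\<bar>x \<bullet> b\<bar> \<le> 1 + norm x" using Cons Basis_le_norm[of b x] by auto
    then show ?case using Cons by (auto simp: abs_mult intro!: mult_mono)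
  qed simp
  moreover have "(1 + norm x) ^ length bs \<le> (1 + norm x) ^ d" for x :: 'a
    using monom by (intro power_increasing) auto
  ultimately have "\<bar>monom_fun bs x\<bar> \<le> (1 + norm x) ^ d" for x by (meson order_trans)
  then show ?case by (intro exI[of _ "\<bar>c\<bar>"]) (auto simp: abs_mult intro!: mult_left_mono)
next
  case (add f g)
  then obtain K K' where "K \<ge> 0" "K' \<ge> 0" "\<And>x. \<bar>f x\<bar> \<le> K * (1 + norm x) ^ d"
     "\<And>x. \<bar>g x\<bar> \<le> K' * (1 + norm x) ^ d" by blast
  then have "\<bar>f x + g x\<bar> \<le> (K + K') * (1 + norm x) ^ d" for x
    by (smt (verit) distrib_right)
  then show ?case using \<open>K \<ge> 0\<close> \<open>K' \<ge> 0\<close> by (intro exI[of _ "K + K'"]) auto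
qed

lemma polydeg_derivative:
  assumes "polydeg d f"
  shows "\<exists>f'. (\<forall>x. (f has_derivative f' x) (at x)) \<and> (\<forall>v. polydeg (d - 1) (\<lambda>x. f' x v))"
  using assms
proof (induction rule: polydeg.induct)
  case (monom bs c)
  have "\<exists>f'. (\<forall>x. (monom_fun bs has_derivative f' x) (at x)) \<and> 
      (\<forall>v. polydeg (length bs - 1) (\<lambda>x. f' x v))"
    using monom(1)
  proof (induction bs)
    case Nil
    have "(monom_fun [] has_derivative (\<lambda>_. 0)) (at x)" for x :: 'a
      by (simp add: monom_fun_def[abs_def])
    then show ?case using polydeg_const by (intro exI[of _ "\<lambda>_ _. 0"]) auto
  next
    case (Cons b bs)
    then obtain f' where f': "\<And>x. (monom_fun bs has_derivative f' x) (at x)"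
      "\<And>v. polydeg (length bs - 1) (\<lambda>x. f' x v)" by auto
    let ?g = "\<lambda>x v. (x \<bullet> b) * f' x v + (v \<bullet> b) * monom_fun bs x"
    have fun_eq: "monom_fun (b # bs) = (\<lambda>x. (x \<bullet> b) * monom_fun bs x)" by auto
    have "(monom_fun (b # bs) has_derivative ?g x) (at x)" for x
      unfolding fun_eq by (rule derivative_eq_intros f' refl)+ (auto simp: fun_eq_iff)
    moreover have "polydeg (length bs) (\<lambda>x. ?g x v)" for v
    proof (intro polydeg.add)
      show "polydeg (length bs) (\<lambda>x. v \<bullet> b * monom_fun bs x)"
        using Cons by (intro polydeg.monom) auto
      show "polydeg (length bs) (\<lambda>x. x \<bullet> b * f' x v)"
      proof (cases bs)
        case Nil
        \<comment> \<open>the empty monomial is constant, so its derivative vanishes\<close>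
        have "(monom_fun bs has_derivative (\<lambda>_. 0)) (at x)" for x
          by (simp add: Nil monom_fun_def[abs_def])
        then have "f' x = (\<lambda>_. 0)" for x using f'(1) has_derivative_unique by blast
        then show ?thesis using polydeg_const by simp
      next
        case (Cons c cs)
        then show ?thesis
          using polydeg_mult[OF polydeg_coord f'(2)[of v], of b] Cons.prems by simp
      qed
    qed
    ultimately show ?case by (intro exI[of _ ?g]) (auto simp del: monom_fun_simps)
  qed
  then obtain f' where f': "\<And>x. (monom_fun bs has_derivative f' x) (at x)"
      "\<And>v. polydeg (length bs - 1) (\<lambda>x. f' x v)" by auto
  have "polydeg (d - 1) (\<lambda>x. c * f' x v)" for v
    by (rule polydeg_mono[OF polydeg_cmult[OF f'(2)]]) (use monom in auto)
  moreover have "((\<lambda>x. c * monom_fun bs x) has_derivative (\<lambda>v. c * f' x v)) (at x)" for x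
    by (intro has_derivative_mult_right f')
  ultimately show ?case by (intro exI[of _ "\<lambda>x v. c * f' x v"]) auto
next
  case (add f g)
  then obtain f' g' where "\<And>x. (f has_derivative f' x) (at x)" "\<And>v. polydeg (d-1) (\<lambda>x. f' x v)"
    "\<And>x. (g has_derivative g' x) (at x)" "\<And>v. polydeg (d-1) (\<lambda>x. g' x v)" by blast
  then show ?case 
    by (intro exI[of _ "\<lambda>x v. f' x v + g' x v"]) (auto intro: polydeg.add has_derivative_add)
qed

lemma polydeg_continuous: "polydeg d f \<Longrightarrow> continuous_on S f"
  using polydeg_derivative has_derivative_continuous_on has_derivative_at_withinI by metis

lemma monom_fun_count:
  "set bs \<subseteq> Basis \<Longrightarrow> monom_fun bs x = (\<Prod>b\<in>Basis. (x \<bullet> b) ^ count_list bs b)"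
proof (induction bs)
  case (Cons c bs)
  then have c: "c \<in> Basis" by simp
  have "(\<Prod>b\<in>Basis. (x \<bullet> b) ^ count_list (c # bs) b) =
      (\<Prod>b\<in>Basis. (if b = c then x \<bullet> b else 1) * (x \<bullet> b) ^ count_list bs b)"
    by (intro prod.cong) auto
  also have "\<dots> = (x \<bullet> c) * monom_fun bs x"
    using Cons c by (simp add: prod.distrib prod.delta)
  finally show ?case by simp
qed simp

text \<open>A special case of Bezout's bound that needs only linear algebra.  If \<open>Z\<close> had more than
\<open>M ^ DIM('a)\<close> points, some nonzero weight on \<open>Z\<close> would annihilate all monomials with
exponents below \<open>M\<close>, hence, by reducing modulo the equations, all polynomials.  But polynomials
separate the points of a finite set.\<close>

lemma pure_power_system_card:
  fixes Z :: "'a::euclidean_space set"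
  assumes "finite Z"
    and q: "\<And>b. b \<in> Basis \<Longrightarrow> polydeg e (q b)" and "e < M"
    and Z: "\<And>z b. z \<in> Z \<Longrightarrow> b \<in> Basis \<Longrightarrow> (z \<bullet> b) ^ M = q b z"
  shows "card Z \<le> M ^ DIM('a)"
proof (rule ccontr)
  define K :: "('a \<Rightarrow> nat) set" where "K = (Basis \<rightarrow>\<^sub>E {..<M})"
  assume "\<not> ?thesis"
  moreover have "card K = M ^ DIM('a)" by (simp add: K_def card_PiE)
  moreover have "finite K" by (simp add: K_def finite_PiE)
  ultimately obtain c where c: "\<exists>z\<in>Z. c z \<noteq> 0"
    "\<And>k. k \<in> K \<Longrightarrow> (\<Sum>z\<in>Z. c z * (\<Prod>b\<in>Basis. (z \<bullet> b) ^ k b)) = 0"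
    using underdetermined_system[of K Z "\<lambda>k z. \<Prod>b\<in>Basis. (z \<bullet> b) ^ k b"] assms(1) by auto
  have mon0: "(\<Sum>z\<in>Z. c z * monom_fun bs z) = 0" if "set bs \<subseteq> Basis" for bs
    using that
  proof (induction "length bs" arbitrary: bs rule: less_induct)
    case less
    have poly0: "(\<Sum>z\<in>Z. c z * f z) = 0" if "polydeg d f" "d < length bs" for d f
      using that
    proof (induction rule: polydeg.induct)
      case (monom cs a)
      have "(\<Sum>z\<in>Z. c z * (a * monom_fun cs z)) = a * (\<Sum>z\<in>Z. c z * monom_fun cs z)"
        by (simp add: sum_distrib_left mult_ac)
      then show ?case using less(1)[of cs] monom by simp
    qed (simp add: distrib_left sum.distrib)
    show ?case
    proof (cases "\<forall>b\<in>Basis. count_list bs b < M")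
      case True
      then have "restrict (count_list bs) Basis \<in> K" by (auto simp: K_def)
      from c(2)[OF this] show ?thesis using less(2) by (simp add: monom_fun_count)
    next
      case False
      then obtain b where b: "b \<in> Basis" "M \<le> count_list bs b" by auto
      \<comment> \<open>one factor \<open>(x \<bullet> b) ^ M\<close> is split off, to be replaced by \<open>q b\<close>, which lowers the degree\<close>
      define cs where "cs = filter (\<lambda>x. x \<noteq> b) bs @ replicate (count_list bs b - M) b"
      have len: "length bs = length cs + M"
      proof -
        have "length bs = length (filter (\<lambda>x. x \<noteq> b) bs) + count_list bs b"
          by (induction bs) auto
        then show ?thesis using b by (simp add: cs_def)
      qed
      have cs: "set cs \<subseteq> Basis" using less(2) b by (auto simp: cs_def)
      have "count_list bs x = count_list (cs @ replicate M b) x" for x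
      proof -
        have "count_list (filter (\<lambda>x. x \<noteq> b) bs) x = (if x = b then 0 else count_list bs x)"
          by (induction bs) auto
        moreover have "count_list (replicate r b) x = (if x = b then r else 0)" for r
          by (induction r) auto
        ultimately show ?thesis using b by (simp add: cs_def)
      qed
      then have "monom_fun bs z = monom_fun (cs @ replicate M b) z" for z
        using less(2) cs b by (subst (1 2) monom_fun_count) auto
      moreover have "monom_fun (replicate M b) z = (z \<bullet> b) ^ M" for z
        by (induction M) auto
      ultimately have "(\<Sum>z\<in>Z. c z * monom_fun bs z) = (\<Sum>z\<in>Z. c z * (1 * monom_fun cs z * q b z))"
        using Z b by (intro sum.cong) auto
      also have "\<dots> = 0"
      proof (rule poly0)
        show "polydeg (length cs + e) (\<lambda>z. 1 * monom_fun cs z * q b z)"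
          by (intro polydeg_mult polydeg.monom q b cs) simp
        show "length cs + e < length bs" using len \<open>e < M\<close> by simp
      qed
      finally show ?thesis .
    qed
  qed
  have poly0: "(\<Sum>z\<in>Z. c z * f z) = 0" if "polydeg d f" for d f
    using that
  proof (induction rule: polydeg.induct)
    case (monom cs a)
    have "(\<Sum>z\<in>Z. c z * (a * monom_fun cs z)) = a * (\<Sum>z\<in>Z. c z * monom_fun cs z)"
      by (simp add: sum_distrib_left mult_ac)
    then show ?case using mon0[of cs] monom by simp
  qed (simp add: distrib_left sum.distrib)
  obtain z0 where z0: "z0 \<in> Z" "c z0 \<noteq> 0" using c by blast
  \<comment> \<open>a polynomial vanishing on \<open>Z\<close> except at \<open>z0\<close>\<close>
  define f where "f = (\<lambda>x. \<Prod>z\<in>Z - {z0}. \<Sum>b\<in>Basis. (x \<bullet> b - z \<bullet> b)^2)"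
  have "polydeg (\<Sum>z\<in>Z-{z0}. 2 * 1) f"
    unfolding f_def
    by (intro polydeg_prod polydeg_sum polydeg_power polydeg_diff polydeg_coord polydeg_const)
  then have "(\<Sum>z\<in>Z. c z * f z) = 0" by (rule poly0)
  moreover have "(\<Sum>z\<in>Z. c z * f z) = c z0 * f z0"
  proof -
    have "f z = 0" if "z \<in> Z - {z0}" for z
      using that assms(1) unfolding f_def by (intro prod_zero bexI[of _ z]) auto
    then have "(\<Sum>z\<in>Z - {z0}. c z * f z) = 0" by simp
    then show ?thesis using z0 assms(1) by (simp add: sum.remove)
  qed
  moreover have "f z0 \<noteq> 0"
  proof -
    have "(\<Sum>b\<in>Basis. (z0 \<bullet> b - z \<bullet> b)^2) \<noteq> 0" if "z \<in> Z - {z0}" for z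
    proof
      assume "(\<Sum>b\<in>Basis. (z0 \<bullet> b - z \<bullet> b)^2) = 0"
      then have "z0 \<bullet> b = z \<bullet> b" if "b \<in> Basis" for b
        using that by (subst (asm) sum_nonneg_eq_0_iff) auto
      then show False using that euclidean_eqI[of z0 z] by blast
    qed
    then show ?thesis using assms(1) by (simp add: f_def)
  qed
  ultimately show False using z0 by simp
qed

text \<open>An elementary bound in the manner of Warren and Milnor-Thom.  A sign pattern is represented by the set
of indices where the polynomial is positive.\<close>

lemma strict_sign_patterns_card:
  fixes p :: "'i \<Rightarrow> 'a::euclidean_space \<Rightarrow> real"
  assumes "finite I" and p: "\<And>i. i \<in> I \<Longrightarrow> polydeg d (p i)"
    and T: "\<And>\<sigma>. \<sigma> \<in> T \<Longrightarrow> \<sigma> \<subseteq> I \<and> (\<exists>x. (\<forall>i\<in>\<sigma>. p i x > 0) \<and> (\<forall>i\<in>I-\<sigma>. p i x < 0))"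
  shows "card T \<le> (2 * card I * d + 1) ^ DIM('a)"
proof -
  define D where "D = 2 * card I * d + 2"
  define g where "g = (\<lambda>x. \<Prod>i\<in>I. (p i x)\<^sup>2)"
  have "finite T" using T assms(1) by (intro finite_subset[of T "Pow I"]) auto
  have g: "polydeg (D - 2) g"
    using polydeg_prod[of I "\<lambda>_. 2 * d" "\<lambda>i x. (p i x)\<^sup>2"] polydeg_power[OF p, of _ 2]
    unfolding g_def D_def by (simp add: mult_ac)
  have g_nonneg: "g x \<ge> 0" for x by (simp add: g_def prod_nonneg)
  define h where "h = (\<lambda>x::'a. \<Sum>b\<in>Basis. (x \<bullet> b) ^ D)"
  have evD: "even D" by (simp add: D_def)
  have h_nonneg: "h x \<ge> 0" for x unfolding h_def using evD by (intro sum_nonneg) (simp add: zero_le_even_power)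
  define cell where "cell = (\<lambda>\<sigma>. {x. (\<forall>i\<in>\<sigma>. p i x > 0) \<and> (\<forall>i\<in>I-\<sigma>. p i x < 0)})"
  obtain z where z: "\<And>\<sigma>. \<sigma> \<in> T \<Longrightarrow> z \<sigma> \<in> cell \<sigma>" 
    using T unfolding cell_def mem_Collect_eq by metis
  have gz: "g (z \<sigma>) > 0" if "\<sigma> \<in> T" for \<sigma>
    unfolding g_def using z[OF that] T[OF that] by (intro prod_pos) (force simp: cell_def)
  obtain \<epsilon> where "\<epsilon> > 0" and \<epsilon>: "\<And>\<sigma>. \<sigma> \<in> T \<Longrightarrow> \<epsilon> * h (z \<sigma>) < g (z \<sigma>)"
  proof -
    have "\<forall>\<^sub>F \<epsilon> in at_right 0. \<epsilon> * h (z \<sigma>) < g (z \<sigma>)" if "\<sigma> \<in> T" for \<sigma>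
    proof (rule order_tendstoD)
      show "((\<lambda>\<epsilon>. \<epsilon> * h (z \<sigma>)) \<longlongrightarrow> 0 * h (z \<sigma>)) (at_right 0)" by (intro tendsto_intros)
    qed (use gz that in auto)
    then have "\<forall>\<^sub>F \<epsilon> in at_right 0. \<forall>\<sigma>\<in>T. \<epsilon> * h (z \<sigma>) < g (z \<sigma>)"
      using \<open>finite T\<close> by (simp add: eventually_ball_finite_distrib)
    moreover have "\<forall>\<^sub>F \<epsilon>::real in at_right 0. \<epsilon> > 0" by (rule eventually_at_right_less)
    ultimately have "\<forall>\<^sub>F \<epsilon>::real in at_right 0. \<epsilon> > 0 \<and> (\<forall>\<sigma>\<in>T. \<epsilon> * h (z \<sigma>) < g (z \<sigma>))"
      by eventually_elim auto
    from eventually_happens'[OF trivial_limit_at_right_real this] show ?thesis using that by blast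
  qed
  define F where "F = (\<lambda>x. g x - \<epsilon> * h x)"
  have contg: "continuous_on UNIV g" using g polydeg_continuous by blast
  have contF: "continuous_on UNIV F" unfolding F_def h_def by (intro continuous_intros contg)
  have contp: "continuous_on UNIV (p i)" if "i \<in> I" for i using p that polydeg_continuous by blast
  \<comment> \<open>the penalty has larger degree than \<open>g\<close>, so that \<open>F\<close> is negative far from the origin\<close>
  have bounded: "bounded {x. F x \<ge> 0}"
  proof -
    obtain K where K: "K \<ge> 0" "\<And>x. \<bar>g x\<bar> \<le> K * (1 + norm x) ^ (D - 2)"
      using polydeg_growth[OF g] by blast
    define B where "B = max 1 (K * 2 ^ (D-2) * real DIM('a) ^ D / \<epsilon>)"
    have "norm x \<le> B" if "F x \<ge> 0" for x
    proof (rule ccontr)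
      define r where "r = norm x"
      assume "\<not> norm x \<le> B"
      then have r: "r > 1" "r > K * 2 ^ (D-2) * real DIM('a) ^ D / \<epsilon>" by (auto simp: B_def r_def)
      obtain b where b: "b \<in> Basis" "r / real DIM('a) \<le> \<bar>x \<bullet> b\<bar>"
      proof (rule ccontr)
        assume "\<not> thesis"
        then have "\<And>b. b \<in> Basis \<Longrightarrow> \<bar>x \<bullet> b\<bar> < r / real DIM('a)" using that by force
        then have "(\<Sum>b\<in>Basis. \<bar>x \<bullet> b\<bar>) < (\<Sum>b\<in>(Basis::'a set). r / real DIM('a))"
          by (intro sum_strict_mono) auto
        then show False using norm_le_l1[of x] by (simp add: r_def)
      qed
      have "(r / real DIM('a)) ^ D \<le> \<bar>x \<bullet> b\<bar> ^ D" using b r by (intro power_mono) auto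
      also have "\<dots> = (x \<bullet> b) ^ D" using evD by (simp add: power_even_abs)
      also have "\<dots> \<le> h x" unfolding h_def using b evD
        by (intro member_le_sum) (auto simp: zero_le_even_power)
      finally have h_ge: "r ^ D / real DIM('a) ^ D \<le> h x" by (simp add: power_divide)
      have "\<epsilon> * (r ^ D / real DIM('a) ^ D) \<le> \<epsilon> * h x" using h_ge \<open>\<epsilon> > 0\<close> by (intro mult_left_mono) auto
      also have "\<dots> \<le> g x" using that by (simp add: F_def)
      also have "\<dots> \<le> K * (1 + r) ^ (D - 2)" using K(2)[of x] by (simp add: r_def)
      also have "\<dots> \<le> K * (2 * r) ^ (D - 2)" using K r by (intro mult_left_mono power_mono) auto
      finally have "\<epsilon> * r ^ D \<le> K * (2 * r) ^ (D - 2) * real DIM('a) ^ D" by (simp add: field_simps)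
      moreover have "r ^ D = r ^ (D - 2) * r\<^sup>2" by (simp add: D_def power_add power2_eq_square)
      ultimately have "r ^ (D - 2) * (\<epsilon> * r\<^sup>2) \<le> r ^ (D - 2) * (K * 2 ^ (D - 2) * real DIM('a) ^ D)"
        by (simp add: power_mult_distrib mult_ac)
      then have "\<epsilon> * r\<^sup>2 \<le> K * 2 ^ (D - 2) * real DIM('a) ^ D" using r by simp
      moreover have "K * 2 ^ (D - 2) * real DIM('a) ^ D < \<epsilon> * r" using r \<open>\<epsilon> > 0\<close> by (simp add: field_simps)
      moreover have "\<epsilon> * r \<le> \<epsilon> * r\<^sup>2" using r \<open>\<epsilon> > 0\<close> by (simp add: power2_eq_square)
      ultimately show False by linarith
    qed
    then show ?thesis by (auto simp: bounded_iff)
  qed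
  have "\<exists>x\<in>cell \<sigma>. \<forall>y\<in>cell \<sigma>. F y \<le> F x" if \<sigma>: "\<sigma> \<in> T" for \<sigma>
  proof -
    define S where "S = {x. F x \<ge> F (z \<sigma>)} \<inter> ((\<Inter>i\<in>\<sigma>. {x. p i x \<ge> 0}) \<inter> (\<Inter>i\<in>I-\<sigma>. {x. p i x \<le> 0}))"
    have "\<sigma> \<subseteq> I" using T \<sigma> by blast
    have Fz: "F (z \<sigma>) > 0" using \<epsilon>[OF \<sigma>] by (simp add: F_def)
    have "closed S" unfolding S_def using \<open>\<sigma> \<subseteq> I\<close>
      by (intro closed_Int closed_INT ballI closed_Collect_le contF contp continuous_on_const) auto
    moreover have "bounded S" by (rule bounded_subset[OF bounded]) (use Fz in \<open>auto simp: S_def\<close>)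
    ultimately have "compact S" by (simp add: compact_eq_bounded_closed)
    moreover have "z \<sigma> \<in> S" using z[OF \<sigma>] by (auto simp: S_def cell_def less_imp_le)
    ultimately obtain x where x: "x \<in> S" "\<And>y. y \<in> S \<Longrightarrow> F y \<le> F x"
      using continuous_attains_sup[of S F] continuous_on_subset[OF contF] by blast
    \<comment> \<open>\<open>g\<close> vanishes on the boundary of the cell, so the maximum is attained inside\<close>
    have "F x > 0" using x(1) Fz by (auto simp: S_def)
    then have "g x > 0" using h_nonneg[of x] \<open>\<epsilon> > 0\<close> unfolding F_def
      by (smt (verit) mult_nonneg_nonneg)
    have nz: "p i x \<noteq> 0" if "i \<in> I" for i
    proof
      assume "p i x = 0"
      then have "g x = 0" unfolding g_def using that assms(1) by (intro prod_zero bexI[of _ i]) auto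
      then show False using \<open>g x > 0\<close> by simp
    qed
    have "x \<in> cell \<sigma>" using x(1) nz \<open>\<sigma> \<subseteq> I\<close> by (force simp: S_def cell_def less_le)
    moreover have "F y \<le> F x" if "y \<in> cell \<sigma>" for y
    proof (cases "F y \<ge> F (z \<sigma>)")
      case True
      then show ?thesis using that by (intro x) (auto simp: S_def cell_def less_imp_le)
    next
      case False
      then show ?thesis using x(1) by (auto simp: S_def)
    qed
    ultimately show ?thesis by blast
  qed
  then have "\<exists>x. \<forall>\<sigma>\<in>T. x \<sigma> \<in> cell \<sigma> \<and> (\<forall>y\<in>cell \<sigma>. F y \<le> F (x \<sigma>))"
    by (intro bchoice ballI) blast
  then obtain x where *: "\<forall>\<sigma>\<in>T. x \<sigma> \<in> cell \<sigma> \<and> (\<forall>y\<in>cell \<sigma>. F y \<le> F (x \<sigma>))"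
    by (rule exE)
  have x: "x \<sigma> \<in> cell \<sigma>" "\<And>y. y \<in> cell \<sigma> \<Longrightarrow> F y \<le> F (x \<sigma>)" if "\<sigma> \<in> T" for \<sigma>
    using bspec[OF * that] by simp_all
  have inj: "inj_on x T"
  proof (rule inj_onI)
    fix \<sigma> \<tau> assume *: "\<sigma> \<in> T" "\<tau> \<in> T" "x \<sigma> = x \<tau>"
    have "\<sigma> = {i\<in>I. p i (x \<sigma>) > 0}" if "\<sigma> \<in> T" for \<sigma>
    proof -
      have "i \<in> \<sigma>" if "i \<in> I" "p i (x \<sigma>) > 0" for i
      proof (rule ccontr)
        assume "i \<notin> \<sigma>"
        then have "p i (x \<sigma>) < 0" using x(1)[OF \<open>\<sigma> \<in> T\<close>] that by (simp add: cell_def)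
        then show False using that by simp
      qed
      then show ?thesis using x(1)[OF that] T[OF that] by (auto simp: cell_def)
    qed
    then show "\<sigma> = \<tau>" using * by metis
  qed
  obtain g' where g': "\<And>x. (g has_derivative g' x) (at x)" "\<And>v. polydeg (D - 2 - 1) (\<lambda>x. g' x v)"
    using polydeg_derivative[OF g] by blast
  have "card (x ` T) \<le> (D - 1) ^ DIM('a)"
  proof (rule pure_power_system_card)
    show "finite (x ` T)" using \<open>finite T\<close> by simp
    show "polydeg (D - 2 - 1) (\<lambda>x. inverse (\<epsilon> * D) * g' x b)" for b by (intro polydeg_cmult g')
    show "D - 2 - 1 < D - 1" by (simp add: D_def)
    fix y b :: 'a assume "y \<in> x ` T" "b \<in> Basis"
    then obtain \<sigma> where \<sigma>: "\<sigma> \<in> T" "y = x \<sigma>" by auto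
    have "\<sigma> \<subseteq> I" using T \<sigma> by blast
    have "open (cell \<sigma>)"
    proof -
      have eq: "cell \<sigma> = (\<Inter>i\<in>\<sigma>. {x. p i x > 0}) \<inter> (\<Inter>i\<in>I-\<sigma>. {x. p i x < 0})" by (auto simp: cell_def)
      show ?thesis unfolding eq using \<open>\<sigma> \<subseteq> I\<close> assms(1)
        by (intro open_Int open_INT ballI open_Collect_less contp continuous_on_const)
          (auto intro: finite_subset)
    qed
    moreover have "(F has_derivative (\<lambda>v. g' y v - \<epsilon> * (\<Sum>b\<in>Basis. of_nat D * (v \<bullet> b) * (y \<bullet> b) ^ (D - 1)))) (at y)"
      unfolding F_def h_def by (rule derivative_eq_intros g' refl)+ (auto simp: mult_ac)
    ultimately have "(\<lambda>v. g' y v - \<epsilon> * (\<Sum>b\<in>Basis. of_nat D * (v \<bullet> b) * (y \<bullet> b) ^ (D - 1))) = (\<lambda>v. 0)"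
      using differential_zero_maxmin[of y "cell \<sigma>" F] x \<sigma> by blast
    then have "g' y b = \<epsilon> * (\<Sum>b'\<in>Basis. of_nat D * (b \<bullet> b') * (y \<bullet> b') ^ (D - 1))"
      by (simp add: fun_eq_iff)
    also have "(\<Sum>b'\<in>Basis. of_nat D * (b \<bullet> b') * (y \<bullet> b') ^ (D - 1)) =
        (\<Sum>b'\<in>Basis. if b' = b then of_nat D * (y \<bullet> b') ^ (D - 1) else 0)"
      using \<open>b \<in> Basis\<close> by (intro sum.cong) (auto simp: inner_Basis)
    also have "\<dots> = of_nat D * (y \<bullet> b) ^ (D - 1)" using \<open>b \<in> Basis\<close> by (simp add: sum.delta)
    finally have "g' y b = \<epsilon> * D * (y \<bullet> b) ^ (D - 1)" by simp
    moreover have "\<epsilon> * D \<noteq> 0"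
    proof -
      have "D > 0" by (simp add: D_def)
      then show ?thesis using \<open>\<epsilon> > 0\<close> by simp
    qed
    ultimately show "(y \<bullet> b) ^ (D - 1) = inverse (\<epsilon> * D) * g' y b"
      by (metis left_inverse mult.assoc mult_1)
  qed
  then show ?thesis using inj by (simp add: card_image D_def)
qed

section \<open>The final output as an affine function of the control\<close>

lemma has_vector_derivative_vec:
  fixes f :: "real \<Rightarrow> 'a::real_normed_vector^'n"
  assumes "\<And>i. ((\<lambda>t. f t $ i) has_vector_derivative f' $ i) (at t within S)"
  shows "(f has_vector_derivative f') (at t within S)"
  unfolding has_vector_derivative_def has_derivative_within
proof (intro conjI vec_tendstoI bounded_linear_scaleR_left)
  fix i
  show "((\<lambda>y. ((1 / norm (y - t)) *\<^sub>R (f y - (f t + (y - t) *\<^sub>R f'))) $ i) \<longlongrightarrow> 0 $ i) (at t within S)"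
    using assms[of i] by (simp add: has_vector_derivative_def has_derivative_within)
qed

lemma bounded_bilinear_matrix_matrix_mult:
  "bounded_bilinear ((**) :: real^'n^'m \<Rightarrow> real^'p^'n \<Rightarrow> real^'p^'m)"
  unfolding bilinear_conv_bounded_bilinear[symmetric] bilinear_def
  by (auto intro!: linearI simp: vec_eq_iff matrix_matrix_mult_def sum.distrib algebra_simps sum_distrib_left)

lemma bounded_bilinear_matrix_vector_mult:
  "bounded_bilinear ((*v) :: real^'n^'m \<Rightarrow> real^'n \<Rightarrow> real^'m)"
  unfolding bilinear_conv_bounded_bilinear[symmetric] bilinear_def
  by (auto intro!: linearI simp: vec_eq_iff matrix_vector_mult_def sum.distrib algebra_simps sum_distrib_left)

lemma bounded_bilinear_vector_matrix_mult:
  "bounded_bilinear ((v*) :: real^'m \<Rightarrow> real^'n^'m \<Rightarrow> real^'n)"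
  unfolding bilinear_conv_bounded_bilinear[symmetric] bilinear_def
  by (auto intro!: linearI simp: vec_eq_iff vector_matrix_mult_def sum.distrib algebra_simps sum_distrib_left)

primrec matrix_power :: "real^'n^'n \<Rightarrow> nat \<Rightarrow> real^'n^'n" where
  "matrix_power A 0 = mat 1"
| "matrix_power A (Suc k) = A ** matrix_power A k"

lemma matrix_power_bound: "\<exists>K\<ge>0. \<forall>k i j. \<bar>matrix_power A k $ i $ j\<bar> \<le> K ^ k"
proof -
  define K where "K = 1 + (\<Sum>i\<in>UNIV. \<Sum>j\<in>UNIV. \<bar>A $ i $ j\<bar>)"
  have K: "K \<ge> 1" by (simp add: K_def sum_nonneg)
  have "\<bar>matrix_power A k $ i $ j\<bar> \<le> K ^ k" for k i j
  proof (induction k arbitrary: i j)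
    case 0
    then show ?case by (simp add: mat_def)
  next
    case (Suc k)
    have row: "(\<Sum>l\<in>UNIV. \<bar>A $ i $ l\<bar>) \<le> K"
      using member_le_sum[of i UNIV "\<lambda>i. \<Sum>l\<in>UNIV. \<bar>A $ i $ l\<bar>"] by (simp add: K_def sum_nonneg)
    have "\<bar>matrix_power A (Suc k) $ i $ j\<bar> \<le> (\<Sum>l\<in>UNIV. \<bar>A $ i $ l * matrix_power A k $ l $ j\<bar>)"
      by (simp add: matrix_matrix_mult_def sum_abs)
    also have "\<dots> \<le> (\<Sum>l\<in>UNIV. \<bar>A $ i $ l\<bar> * K ^ k)"
      by (intro sum_mono) (simp add: abs_mult mult_left_mono Suc)
    also have "\<dots> = (\<Sum>l\<in>UNIV. \<bar>A $ i $ l\<bar>) * K ^ k" by (simp add: sum_distrib_right)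
    also have "\<dots> \<le> K * K ^ k" using row K by (intro mult_right_mono) auto
    finally show ?case by simp
  qed
  then show ?thesis using K by (intro exI[of _ K]) auto
qed

lemma matrix_exponential:
  fixes A :: "real^'n^'n"
  obtains E where "E 0 = mat 1" "\<And>t. (E has_vector_derivative A ** E t) (at t)"
proof -
  obtain K where K: "K \<ge> 0" "\<And>k i j. \<bar>matrix_power A k $ i $ j\<bar> \<le> K ^ k"
    using matrix_power_bound[of A] by blast
  define c where "c = (\<lambda>i j k. matrix_power A k $ i $ j / fact k)"
  define E :: "real \<Rightarrow> real^'n^'n" where "E = (\<lambda>t. \<chi> i j. \<Sum>k. c i j k * t ^ k)"
  have summable: "summable (\<lambda>k. c i j k * t ^ k)" for i j and t :: real
  proof (rule summable_comparison_test')
    show "summable (\<lambda>k. inverse (fact k) * (K * \<bar>t\<bar>) ^ k)" by (rule summable_exp)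
    show "norm (c i j k * t ^ k) \<le> inverse (fact k) * (K * \<bar>t\<bar>) ^ k" for k
      using mult_right_mono[OF K(2)[of k i j], of "\<bar>t\<bar>^k"]
      by (simp add: c_def abs_mult power_abs divide_simps power_mult_distrib)
  qed
  have "(E has_vector_derivative A ** E t) (at t)" for t
  proof (intro has_vector_derivative_vec)
    fix i j
    have diffs: "diffs (c i j) k * t ^ k = (\<Sum>l\<in>UNIV. A $ i $ l * (c l j k * t ^ k))" for k
    proof -
      have "diffs (c i j) k = (\<Sum>l\<in>UNIV. A $ i $ l * matrix_power A k $ l $ j) / fact k"
        unfolding diffs_def c_def by (simp add: matrix_matrix_mult_def)
      then show ?thesis by (simp add: c_def sum_divide_distrib sum_distrib_right mult.assoc)
    qed
    have "((\<lambda>t. E t $ i $ j) has_field_derivative (\<Sum>k. diffs (c i j) k * t ^ k)) (at t)"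
      unfolding E_def by (simp, rule termdiffs_strong_converges_everywhere[OF summable])
    also have "(\<Sum>k. diffs (c i j) k * t ^ k) = (\<Sum>l\<in>UNIV. \<Sum>k. A $ i $ l * (c l j k * t ^ k))"
      unfolding diffs by (intro suminf_sum summable_mult summable)
    also have "\<dots> = (A ** E t) $ i $ j"
      by (simp add: matrix_matrix_mult_def E_def suminf_mult[OF summable])
    finally show "((\<lambda>t. E t $ i $ j) has_vector_derivative (A ** E t) $ i $ j) (at t)"
      by (simp add: has_real_derivative_iff_has_vector_derivative)
  qed
  moreover have "E 0 = mat 1"
  proof -
    have "(\<Sum>k. c i j k * 0 ^ k) = c i j 0" for i j
      using powser_zero[of "c i j"] by simp
    then show ?thesis by (simp add: E_def c_def vec_eq_iff)
  qed
  ultimately show ?thesis by (intro that)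
qed

lemma fundamental_matrices:
  fixes A :: "real^'n^'n"
  obtains E F where "E 0 = mat 1" "\<And>t. (E has_vector_derivative A ** E t) (at t)"
    "\<And>t. (F has_vector_derivative - (F t ** A)) (at t)"
    "\<And>t. F t ** E t = mat 1" "\<And>t. E t ** F t = mat 1"
proof -
  obtain E where E: "E 0 = mat 1" "\<And>t. (E has_vector_derivative A ** E t) (at t)"
    using matrix_exponential[of A] by blast
  obtain E' where E': "E' 0 = mat 1" 
    "\<And>t. (E' has_vector_derivative (- transpose A) ** E' t) (at t)"
    using matrix_exponential[of "- transpose A"] by blast
  define F where "F = (\<lambda>t. transpose (E' t))"
  have "linear (transpose :: real^'n^'n \<Rightarrow> real^'n^'n)"
    by (intro linearI) (auto simp: transpose_def vec_eq_iff)
  then have bl: "bounded_linear (transpose :: real^'n^'n \<Rightarrow> real^'n^'n)"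
    by (simp add: linear_conv_bounded_linear)
  have F: "(F has_vector_derivative - (F t ** A)) (at t)" for t
  proof -
    have "(F has_vector_derivative transpose ((- transpose A) ** E' t)) (at t)"
      unfolding F_def by (rule bounded_linear.has_vector_derivative[OF bl E'(2)])
    moreover have "transpose ((- transpose A) ** E' t) = - (F t ** A)"
      by (simp add: F_def matrix_transpose_mul transpose_def[of "- _"] vec_eq_iff 
          matrix_matrix_mult_def transpose_def sum_negf mult.commute)
    ultimately show ?thesis by simp
  qed
  interpret mm: bounded_bilinear "(**) :: real^'n^'n \<Rightarrow> real^'n^'n \<Rightarrow> real^'n^'n"
    by (rule bounded_bilinear_matrix_matrix_mult)
  have "((\<lambda>t. F t ** E t) has_vector_derivative 0) (at t within UNIV)" for t
  proof -
    have "((\<lambda>t. F t ** E t) has_vector_derivative (F t ** (A ** E t) + (- (F t ** A)) ** E t)) (at t)"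
      by (rule mm.has_vector_derivative[OF F E(2)])
    also have "F t ** (A ** E t) + (- (F t ** A)) ** E t = 0"
      by (simp add: mm.minus_left matrix_mul_assoc)
    finally show ?thesis by simp
  qed
  then obtain c where c: "\<And>t. F t ** E t = c"
    using has_vector_derivative_zero_constant[of UNIV "\<lambda>t. F t ** E t"] by auto
  have "F 0 = mat 1" by (simp add: F_def E')
  then have "F t ** E t = mat 1" for t using c[of t] c[of 0] E by simp
  then show ?thesis using that E F matrix_left_right_inverse by metis
qed

text \<open>The costate is the row vector \<open>v exp (A (1 - t))\<close>, here characterised by its differential
equation and its value at time 1.\<close>

definition costate :: "real^'n^'n \<Rightarrow> real^'n \<Rightarrow> (real \<Rightarrow> real^'n) \<Rightarrow> bool" where
  "costate A v \<rho> \<longleftrightarrow> \<rho> 1 = v \<and> (\<forall>t. (\<rho> has_vector_derivative - (\<rho> t v* A)) (at t))"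

lemma costate_solution:
  fixes A :: "real^'n^'n"
  obtains \<Psi> where "\<And>t. invertible (\<Psi> t)" "\<And>v. costate A v (\<lambda>t. v v* \<Psi> t)"
    "\<And>v \<rho> t. costate A v \<rho> \<Longrightarrow> \<rho> t = v v* \<Psi> t"
proof -
  obtain E F where E: "E 0 = mat 1" "\<And>t. (E has_vector_derivative A ** E t) (at t)"
    and F: "\<And>t. (F has_vector_derivative - (F t ** A)) (at t)"
    and FE: "\<And>t. F t ** E t = mat 1" "\<And>t. E t ** F t = mat 1"
    using fundamental_matrices[of A] by blast
  define \<Psi> where "\<Psi> = (\<lambda>t. E 1 ** F t)"
  interpret vm: bounded_bilinear "(v*) :: real^'n \<Rightarrow> real^'n^'n \<Rightarrow> real^'n"
    by (rule bounded_bilinear_vector_matrix_mult)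
  show ?thesis
  proof
    have "E 1 ** F t ** (E t ** F 1) = mat 1" for t
      by (metis FE matrix_mul_assoc matrix_mul_lid)
    then show "invertible (\<Psi> t)" for t
      unfolding \<Psi>_def by (meson invertible_right_inverse)
    show "costate A v (\<lambda>t. v v* \<Psi> t)" for v
    proof -
      have "((\<lambda>t. v v* E 1 v* F t) has_vector_derivative v v* E 1 v* (- (F t ** A))) (at t)" for t
        by (rule bounded_linear.has_vector_derivative[OF vm.bounded_linear_right F])
      then show ?thesis
        by (simp add: costate_def \<Psi>_def FE vector_matrix_mul_assoc vm.minus_right matrix_mul_assoc)
    qed
    fix v \<rho> t assume \<rho>: "costate A v \<rho>"
    have "((\<lambda>t. \<rho> t v* E t) has_vector_derivative 0) (at t within UNIV)" for t
    proof -
      have "((\<lambda>t. \<rho> t v* E t) has_vector_derivative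
          (\<rho> t v* (A ** E t) + (- (\<rho> t v* A)) v* E t)) (at t)"
        using \<rho> by (intro vm.has_vector_derivative E) (auto simp: costate_def)
      then show ?thesis by (simp add: vm.minus_left vector_matrix_mul_assoc)
    qed
    then obtain c where c: "\<And>t. \<rho> t v* E t = c"
      using has_vector_derivative_zero_constant[of UNIV "\<lambda>t. \<rho> t v* E t"] by auto
    have "\<rho> t = \<rho> t v* E t v* F t" by (simp add: vector_matrix_mul_assoc FE)
    also have "\<dots> = v v* E 1 v* F t" using c[of t] c[of 1] \<rho> by (simp add: costate_def)
    finally show "\<rho> t = v v* \<Psi> t" by (simp add: \<Psi>_def vector_matrix_mul_assoc)
  qed
qed

lemma costate_exists: "\<exists>\<rho>. costate A v \<rho>"
  by (rule costate_solution[of A]) blast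

lemma costate_eq_0_iff:
  assumes "costate A v \<rho>"
  shows "\<rho> t = 0 \<longleftrightarrow> v = 0"
proof (rule costate_solution[of A])
  fix \<Psi> assume "\<And>t. invertible (\<Psi> t)" and \<Psi>: "\<And>v \<rho> t. costate A v \<rho> \<Longrightarrow> \<rho> t = v v* \<Psi> t"
  then obtain \<Psi>' where \<Psi>': "\<Psi> t ** \<Psi>' = mat 1" using invertible_right_inverse by blast
  have "\<rho> t v* \<Psi>' = v" by (simp add: \<Psi>[OF assms] vector_matrix_mul_assoc \<Psi>')
  then show ?thesis using \<Psi>[OF assms] by auto
qed

lemma trajectory_exists:
  fixes A :: "real^'n^'n" and B :: "real^'m^'n"
  assumes u: "continuous_on {0..1} u"
  shows "\<exists>x. is_trajectory A B x0 u x"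
proof -
  obtain E F where E: "E 0 = mat 1" "\<And>t. (E has_vector_derivative A ** E t) (at t)"
    and F: "\<And>t. (F has_vector_derivative - (F t ** A)) (at t)"
    and FE: "\<And>t. F t ** E t = mat 1" "\<And>t. E t ** F t = mat 1"
    using fundamental_matrices[of A] by blast
  interpret mv: bounded_bilinear "(*v) :: real^'n^'n \<Rightarrow> real^'n \<Rightarrow> real^'n"
    by (rule bounded_bilinear_matrix_vector_mult)
  interpret mvB: bounded_bilinear "(*v) :: real^'m^'n \<Rightarrow> real^'m \<Rightarrow> real^'n"
    by (rule bounded_bilinear_matrix_vector_mult)
  have contF: "continuous_on {0..1} F"
    by (meson F continuous_at_imp_continuous_on has_vector_derivative_continuous)
  define g where "g = (\<lambda>t. F t *v (B *v u t))"
  define x where "x = (\<lambda>t. E t *v (x0 + integral {0..t} g))"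
  have contg: "continuous_on {0..1} g" unfolding g_def
    by (intro mv.continuous_on mvB.continuous_on contF u continuous_on_const)
  have "(x has_vector_derivative A *v x t + B *v u t) (at t within {0..1})" if "t \<in> {0..1}" for t
  proof -
    have "((\<lambda>t. x0 + integral {0..t} g) has_vector_derivative g t) (at t within {0..1})"
      using has_vector_derivative_add[OF has_vector_derivative_const integral_has_vector_derivative[OF contg that]]
      by simp
    from mv.has_vector_derivative[OF has_vector_derivative_at_within[OF E(2)] this]
    have "(x has_vector_derivative E t *v g t + (A ** E t) *v (x0 + integral {0..t} g)) (at t within {0..1})"
      by (simp add: x_def)
    also have "E t *v g t = B *v u t"
      by (simp add: g_def matrix_vector_mul_assoc FE matrix_mul_assoc)
    also have "(A ** E t) *v (x0 + integral {0..t} g) = A *v x t"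
      by (simp add: x_def matrix_vector_mul_assoc)
    finally show ?thesis by (simp add: add.commute)
  qed
  moreover have "x 0 = x0" by (simp add: x_def E)
  ultimately show ?thesis by (auto simp: is_trajectory_def)
qed

text \<open>The derivative of \<open>\<rho> t \<bullet> x t\<close> is \<open>\<rho> t \<bullet> (B *v u t)\<close>.  In particular the output at time 1 does
not depend on the choice of the trajectory.\<close>

lemma output_formula:
  fixes A :: "real^'n^'n"
  assumes \<rho>: "costate A v \<rho>" and x: "is_trajectory A B x0 u x"
  shows "v \<bullet> x 1 = \<rho> 0 \<bullet> x0 + integral {0..1} (\<lambda>t. \<rho> t \<bullet> (B *v u t))"
proof -
  have "((\<lambda>t. \<rho> t \<bullet> x t) has_vector_derivative \<rho> t \<bullet> (B *v u t)) (at t within {0..1})"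
    if "t \<in> {0..1}" for t
  proof -
    have "((\<lambda>t. \<rho> t \<bullet> x t) has_vector_derivative
        \<rho> t \<bullet> (A *v x t + B *v u t) + (- (\<rho> t v* A)) \<bullet> x t) (at t within {0..1})"
      using \<rho> x that unfolding costate_def is_trajectory_def
      by (intro bounded_bilinear.has_vector_derivative[OF bounded_bilinear_inner])
         (auto intro: has_vector_derivative_at_within)
    then show ?thesis by (simp add: inner_add_right dot_lmul_matrix)
  qed
  then have "((\<lambda>t. \<rho> t \<bullet> (B *v u t)) has_integral (\<rho> 1 \<bullet> x 1 - \<rho> 0 \<bullet> x 0)) {0..1}"
    by (intro fundamental_theorem_of_calculus) auto
  then show ?thesis using \<rho> x by (simp add: integral_unique costate_def is_trajectory_def)
qed

text \<open>The integral of the costate against a scalar input on \<open>[0,1]\<close>.\<close>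

definition moment :: "(real \<Rightarrow> real) \<Rightarrow> (real \<Rightarrow> real^'n) \<Rightarrow> real^'n" where
  "moment f \<rho> = integral {0..1} (\<lambda>t. f t *\<^sub>R \<rho> t)"

text \<open>The coefficient matrix of the output as a function of the control matrix; its \<open>(i,j)\<close> entry is
the effect of feeding the basis input \<open>\<omega> j\<close> into channel \<open>i\<close>.\<close>

definition response :: 
  "('k \<Rightarrow> real \<Rightarrow> real) \<Rightarrow> real^'m^'n \<Rightarrow> (real \<Rightarrow> real^'n) \<Rightarrow> real^'k::finite^'m::finite" where
  "response \<omega> B \<rho> = (\<chi> i j. \<Sum>a\<in>UNIV. B $ a $ i * moment (\<omega> j) \<rho> $ a)"

lemma costate_continuous: "costate A v \<rho> \<Longrightarrow> continuous_on S \<rho>"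
  unfolding costate_def
  by (meson continuous_at_imp_continuous_on has_vector_derivative_continuous)

lemma integral_response:
  fixes \<omega> :: "'k::finite \<Rightarrow> real \<Rightarrow> real" and B :: "real^'m::finite^'n"
  assumes \<omega>: "\<And>j. continuous_on {0..1} (\<omega> j)" and \<rho>: "costate A v \<rho>"
  shows "integral {0..1} (\<lambda>t. \<rho> t \<bullet> (B *v control \<omega> G t)) = G \<bullet> response \<omega> B \<rho>"
proof -
  have int: "(\<lambda>t. \<omega> j t *\<^sub>R \<rho> t) integrable_on {0..1}" for j
    by (intro integrable_continuous_real continuous_intros \<omega> costate_continuous[OF \<rho>])
  then have int': "(\<lambda>t. \<omega> j t * \<rho> t $ a) integrable_on {0..1}" for j a
    using integrable_component[of "\<lambda>t. \<omega> j t *\<^sub>R \<rho> t" "{0..1}" "axis a 1"] by (simp add: inner_axis)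
  have "integral {0..1} (\<lambda>t. \<rho> t \<bullet> (B *v control \<omega> G t)) = 
     integral {0..1} (\<lambda>t. \<Sum>a\<in>UNIV. \<Sum>i\<in>UNIV. \<Sum>j\<in>UNIV. (G $ i $ j * B $ a $ i) * (\<omega> j t * \<rho> t $ a))"
    by (simp add: inner_vec_def control_def matrix_vector_mult_def sum_distrib_left sum_distrib_right mult_ac)
  also have "\<dots> = (\<Sum>a\<in>UNIV. \<Sum>i\<in>UNIV. \<Sum>j\<in>UNIV. (G $ i $ j * B $ a $ i) * integral {0..1} (\<lambda>t. \<omega> j t * \<rho> t $ a))"
    by (intro integral_unique has_integral_sum has_integral_mult_right integrable_integral int') auto
  also have "\<dots> = (\<Sum>a\<in>UNIV. \<Sum>i\<in>UNIV. \<Sum>j\<in>UNIV. (G $ i $ j * B $ a $ i) * moment (\<omega> j) \<rho> $ a)"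
    using int unfolding moment_def by (simp flip: integral_component_eq_cart)
  also have "\<dots> = (\<Sum>i\<in>UNIV. \<Sum>j\<in>UNIV. \<Sum>a\<in>UNIV. (G $ i $ j * B $ a $ i) * moment (\<omega> j) \<rho> $ a)"
    by (subst sum.swap, intro sum.cong refl, subst sum.swap, rule refl)
  also have "\<dots> = G \<bullet> response \<omega> B \<rho>"
    by (simp add: inner_vec_def response_def sum_distrib_left mult_ac)
  finally show ?thesis .
qed

lemma final_output_formula:
  fixes C :: "real^'n::finite^1"
  assumes \<omega>: "\<And>j. continuous_on {0..1} (\<omega> j)" and \<rho>: "costate A (C $ 1) \<rho>"
  shows "final_output A B C x0 (control \<omega> G) $ 1 = G \<bullet> response \<omega> B \<rho> + \<rho> 0 \<bullet> x0"
proof -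
  have "continuous_on {0..1} (control \<omega> G)"
    unfolding control_def matrix_vector_mult_def by (intro continuous_intros) (auto intro!: continuous_intros \<omega>)
  then obtain x where x: "is_trajectory A B x0 (control \<omega> G) x" using trajectory_exists by blast
  have eq: "(C *v x' 1) $ 1 = G \<bullet> response \<omega> B \<rho> + \<rho> 0 \<bullet> x0" 
    if "is_trajectory A B x0 (control \<omega> G) x'" for x'
    using output_formula[OF \<rho> that] integral_response[OF \<omega> \<rho>]
    by (simp add: matrix_vector_mul_component)
  have "final_output A B C x0 (control \<omega> G) = C *v x 1"
    unfolding final_output_def
  proof (rule the_equality)
    show "\<exists>x'. is_trajectory A B x0 (control \<omega> G) x' \<and> C *v x 1 = C *v x' 1" using x by blast
    fix y assume "\<exists>x. is_trajectory A B x0 (control \<omega> G) x \<and> y = C *v x 1"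
    then show "y = C *v x 1" using eq x by (auto simp: vec_eq_iff)
  qed
  then show ?thesis using eq[OF x] by simp
qed

text \<open>All responses of systems whose state dimension is that of the type argument.\<close>

definition responses :: "'n::finite itself \<Rightarrow> ('k::finite \<Rightarrow> real \<Rightarrow> real) \<Rightarrow> (real^'k^'m::finite) set" where
  "responses _ \<omega> = {response \<omega> B \<rho> | (A :: real^'n^'n) v \<rho> B. costate A v \<rho>}"

text \<open>Open half-spaces with normal vector in \<open>W\<close> and arbitrary offset.\<close>

definition affine_signs :: "'a::real_inner set \<Rightarrow> ('a \<Rightarrow> bool) set" where
  "affine_signs W = {\<lambda>G. G \<bullet> w + c > 0 | w c. w \<in> W}"

text \<open>For a nonzero output row every offset is attained by a suitable initial state.\<close>

lemma scalar_sign_class_eq: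
  assumes \<omega>: "\<And>j. continuous_on {0..1} (\<omega> j)"
  shows "scalar_sign_class TYPE('n::finite) \<omega> = affine_signs (responses TYPE('n) \<omega> :: (real^'k::finite^'m::finite) set)"
proof (intro equalityI subsetI)
  fix \<phi> :: "real^'k^'m \<Rightarrow> bool"
  assume "\<phi> \<in> scalar_sign_class TYPE('n) \<omega>"
  then obtain A :: "real^'n^'n" and B and C :: "real^'n^1" and x0
    where \<phi>: "\<phi> = (\<lambda>G. sign_system \<omega> A B C x0 G $ 1)"
    by (auto simp: scalar_sign_class_def sign_class_def)
  obtain \<rho> where \<rho>: "costate A (C $ 1) \<rho>" using costate_exists by blast
  have "\<phi> = (\<lambda>G. G \<bullet> response \<omega> B \<rho> + \<rho> 0 \<bullet> x0 > 0)"
    using final_output_formula[where \<omega>=\<omega>, OF \<omega> \<rho>, of B x0] by (simp add: \<phi> sign_system_def)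
  moreover have "response \<omega> B \<rho> \<in> responses TYPE('n) \<omega>" using \<rho> by (auto simp: responses_def)
  ultimately show "\<phi> \<in> affine_signs (responses TYPE('n) \<omega>)" by (auto simp: affine_signs_def)
next
  fix \<phi> :: "real^'k^'m \<Rightarrow> bool"
  assume "\<phi> \<in> affine_signs (responses TYPE('n) \<omega>)"
  then obtain c w where w: "w \<in> responses TYPE('n) \<omega>" and \<phi>: "\<phi> = (\<lambda>G. G \<bullet> w + c > 0)"
    by (auto simp: affine_signs_def)
  have "\<exists>(A::real^'n^'n) v \<rho> B. costate A v \<rho> \<and> v \<noteq> 0 \<and> w = response \<omega> B \<rho>"
  proof -
    obtain A :: "real^'n^'n" and v \<rho> B where *: "costate A v \<rho>" "w = response \<omega> B \<rho>"
      using w unfolding responses_def mem_Collect_eq by (elim exE conjE) (rule that)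
    show ?thesis
    proof (cases "v = 0")
      case True
      \<comment> \<open>the response is 0 as well; it is also that of a system with zero input matrix and nonzero output row\<close>
      have "\<rho> t = 0" for t using costate_eq_0_iff[OF *(1)] True by simp
      then have "moment f \<rho> = 0" for f by (simp add: moment_def)
      then have "w = 0" by (simp add: * response_def vec_eq_iff)
      moreover have "response \<omega> 0 (\<lambda>_. 1 :: real^'n) = (0 :: real^'k^'m)" by (simp add: response_def vec_eq_iff)
      moreover have "costate (0::real^'n^'n) 1 (\<lambda>_. 1)" by (simp add: costate_def)
      ultimately show ?thesis
        by (intro exI[of _ "0::real^'n^'n"] exI[of _ "1::real^'n"] exI[of _ "\<lambda>_. 1 :: real^'n"]
            exI[of _ "0::real^'m^'n"]) simp
    next
      case False
      then show ?thesis using * by (intro exI[of _ A] exI[of _ v] exI[of _ \<rho>] exI[of _ B]) simp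
    qed
  qed
  then obtain A :: "real^'n^'n" and v \<rho> B where *: "costate A v \<rho>" "v \<noteq> 0" "w = response \<omega> B \<rho>"
    by blast
  have "\<rho> 0 \<noteq> 0" using costate_eq_0_iff[OF *(1)] *(2) by simp
  define x0 where "x0 = (c / (\<rho> 0 \<bullet> \<rho> 0)) *\<^sub>R \<rho> 0"
  have "\<rho> 0 \<bullet> x0 = c" using \<open>\<rho> 0 \<noteq> 0\<close> by (simp add: x0_def)
  then have "\<phi> = (\<lambda>G. sign_system \<omega> A B (\<chi> i. v :: real^'n^1) x0 G $ 1)"
    using final_output_formula[where \<omega>=\<omega>, OF \<omega>, of A "\<chi> i. v" \<rho> B x0] * by (simp add: \<phi> sign_system_def)
  then show "\<phi> \<in> scalar_sign_class TYPE('n) \<omega>"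
    unfolding scalar_sign_class_def sign_class_def by (intro image_eqI) (assumption, blast)
qed

section \<open>Moments of the costate as rational functions\<close>

lemma moment_add:
  assumes "continuous_on {0..1} f" "continuous_on {0..1} g" "costate A v \<rho>"
  shows "moment (\<lambda>t. f t + g t) \<rho> = moment f \<rho> + moment g \<rho>"
  unfolding moment_def scaleR_left_distrib
  by (intro integral_add integrable_continuous_real continuous_intros assms costate_continuous[OF assms(3)])

lemma moment_cmult: "moment (\<lambda>t. c * f t) \<rho> = c *\<^sub>R moment f \<rho>"
  by (simp add: moment_def flip: scaleR_scaleR)

lemma moment_by_parts:
  fixes A :: "real^'n^'n"
  assumes \<rho>: "costate A v \<rho>" and h: "\<And>t. (h has_real_derivative h' t) (at t)"
    and h': "continuous_on {0..1} h'"
  shows "h 1 *\<^sub>R v - h 0 *\<^sub>R \<rho> 0 = moment h' \<rho> - moment h \<rho> v* A"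
proof -
  interpret vm: bounded_bilinear "(v*) :: real^'n \<Rightarrow> real^'n^'n \<Rightarrow> real^'n"
    by (rule bounded_bilinear_vector_matrix_mult)
  have cont: "continuous_on {0..1} h" using h by (meson DERIV_isCont continuous_at_imp_continuous_on)
  have int: "(\<lambda>t. h' t *\<^sub>R \<rho> t) integrable_on {0..1}" "(\<lambda>t. h t *\<^sub>R \<rho> t) integrable_on {0..1}"
    by (intro integrable_continuous_real continuous_intros cont h' costate_continuous[OF \<rho>])+
  have "((\<lambda>t. h t *\<^sub>R \<rho> t) has_vector_derivative h t *\<^sub>R (- (\<rho> t v* A)) + h' t *\<^sub>R \<rho> t) (at t within {0..1})" for t
    using \<rho> h by (intro has_vector_derivative_scaleR)
      (auto simp: costate_def has_field_derivative_at_within intro: has_vector_derivative_at_within)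
  then have "((\<lambda>t. h t *\<^sub>R (- (\<rho> t v* A)) + h' t *\<^sub>R \<rho> t) has_integral (h 1 *\<^sub>R \<rho> 1 - h 0 *\<^sub>R \<rho> 0)) {0..1}"
    by (intro fundamental_theorem_of_calculus) auto
  moreover have "((\<lambda>t. - ((h t *\<^sub>R \<rho> t) v* A) + h' t *\<^sub>R \<rho> t) has_integral (- (moment h \<rho> v* A) + moment h' \<rho>)) {0..1}"
    unfolding moment_def
    by (intro has_integral_add has_integral_neg integrable_integral int
         has_integral_linear[OF integrable_integral[OF int(2)] vm.bounded_linear_left, unfolded o_def])
  ultimately have "h 1 *\<^sub>R \<rho> 1 - h 0 *\<^sub>R \<rho> 0 = - (moment h \<rho> v* A) + moment h' \<rho>"
    by (intro has_integral_unique[of "\<lambda>t. h t *\<^sub>R (- (\<rho> t v* A)) + h' t *\<^sub>R \<rho> t"]) (simp_all add: vm.scaleR_left)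
  then show ?thesis using \<rho> by (simp add: costate_def)
qed

text \<open>The determinant of this matrix is the squared modulus of the characteristic
polynomial of \<open>A\<close> at \<open>\<alpha> + i \<beta>\<close>.  Working with the real quadratic avoids complex
resolvents.\<close>

definition resolvent_quad :: "real \<Rightarrow> real \<Rightarrow> real^'n^'n \<Rightarrow> real^'n^'n" where
  "resolvent_quad \<alpha> \<beta> A = (\<alpha> *\<^sub>R mat 1 - A) ** (\<alpha> *\<^sub>R mat 1 - A) + \<beta>\<^sup>2 *\<^sub>R mat 1"

text \<open>The numerator in Cramer's rule for the row-vector equation \<open>x v* Q = b\<close>.\<close>

definition cramer_numerator :: "real^'n^'n \<Rightarrow> real^'n \<Rightarrow> real^'n" where
  "cramer_numerator Q b = (\<chi> k. det (\<chi> i j. if j = k then b $ i else Q $ j $ i))"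

lemma cramer_numerator_eq: "cramer_numerator Q (x v* Q) = det Q *\<^sub>R x"
proof -
  have "det (\<chi> i j. if j = k then (x v* Q) $ i else Q $ j $ i) = x $ k * det Q" for k
  proof -
    have tr: "transpose Q $ i $ j = Q $ j $ i" for i j by (simp add: Finite_Cartesian_Product.transpose_def)
    show ?thesis
      using cramer_lemma[of k "transpose Q" x] unfolding det_transpose transpose_matrix_vector tr .
  qed
  then show ?thesis by (simp add: cramer_numerator_def vec_eq_iff mult.commute)
qed

text \<open>The pair of equations \<open>x v* N - \<beta> *\<^sub>R y = f\<close>, \<open>y v* N + \<beta> *\<^sub>R x = g\<close> with
\<open>N = \<alpha> *\<^sub>R mat 1 - A\<close> yields \<open>x v* Q = f v* N + \<beta> *\<^sub>R g\<close> and
\<open>y v* Q = g v* N - \<beta> *\<^sub>R f\<close> for \<open>Q = resolvent_quad \<alpha> \<beta> A\<close>.  The step solves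
these up to the factor \<open>det Q\<close>.\<close>

definition resolvent_step :: "real \<Rightarrow> real \<Rightarrow> real^'n^'n \<Rightarrow> (real^'n) \<times> (real^'n) \<Rightarrow> (real^'n) \<times> (real^'n)" where
  "resolvent_step \<alpha> \<beta> A = (\<lambda>(f, g).
     (cramer_numerator (resolvent_quad \<alpha> \<beta> A) (f v* (\<alpha> *\<^sub>R mat 1 - A) + \<beta> *\<^sub>R g),
      cramer_numerator (resolvent_quad \<alpha> \<beta> A) (g v* (\<alpha> *\<^sub>R mat 1 - A) - \<beta> *\<^sub>R f)))"

lemma resolvent_step_eq:
  fixes A :: "real^'n^'n" and \<alpha> :: real
  defines "N \<equiv> \<alpha> *\<^sub>R mat 1 - A"
  shows "resolvent_step \<alpha> \<beta> A (c *\<^sub>R (x v* N - \<beta> *\<^sub>R y), c *\<^sub>R (y v* N + \<beta> *\<^sub>R x)) =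
    ((c * det (resolvent_quad \<alpha> \<beta> A)) *\<^sub>R x, (c * det (resolvent_quad \<alpha> \<beta> A)) *\<^sub>R y)"
proof -
  interpret vm: bounded_bilinear "(v*) :: real^'n \<Rightarrow> real^'n^'n \<Rightarrow> real^'n"
    by (rule bounded_bilinear_vector_matrix_mult)
  have Q: "z v* resolvent_quad \<alpha> \<beta> A = z v* N v* N + \<beta>\<^sup>2 *\<^sub>R z" for z
    by (simp add: resolvent_quad_def N_def vm.add_right vm.scaleR_right vector_matrix_mul_assoc)
  have "(c *\<^sub>R (x v* N - \<beta> *\<^sub>R y)) v* N + \<beta> *\<^sub>R (c *\<^sub>R (y v* N + \<beta> *\<^sub>R x)) = (c *\<^sub>R x) v* resolvent_quad \<alpha> \<beta> A"
    by (simp add: Q vm.diff_left vm.scaleR_left algebra_simps power2_eq_square)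
  moreover have "(c *\<^sub>R (y v* N + \<beta> *\<^sub>R x)) v* N - \<beta> *\<^sub>R (c *\<^sub>R (x v* N - \<beta> *\<^sub>R y)) = (c *\<^sub>R y) v* resolvent_quad \<alpha> \<beta> A"
    by (simp add: Q vm.add_left vm.scaleR_left algebra_simps power2_eq_square)
  ultimately show ?thesis
    by (simp only: resolvent_step_def prod.case N_def[symmetric] cramer_numerator_eq) (simp add: mult.commute)
qed

text \<open>The moments against the cosine and the sine input, multiplied by \<open>det Q ^ Suc l\<close>.  The argument
\<open>r\<close> stands for \<open>\<rho> 0\<close>, which enters only for \<open>l = 0\<close>.\<close>

primrec moment_numerators ::
  "real \<Rightarrow> real \<Rightarrow> real^'n^'n \<Rightarrow> real^'n \<Rightarrow> real^'n \<Rightarrow> nat \<Rightarrow> (real^'n) \<times> (real^'n)" where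
  "moment_numerators \<alpha> \<beta> A r v 0 =
     resolvent_step \<alpha> \<beta> A ((exp \<alpha> * cos \<beta>) *\<^sub>R v - r, (exp \<alpha> * sin \<beta>) *\<^sub>R v)"
| "moment_numerators \<alpha> \<beta> A r v (Suc l) =
     resolvent_step \<alpha> \<beta> A
      (det (resolvent_quad \<alpha> \<beta> A) ^ Suc l *\<^sub>R (exp \<alpha> * cos \<beta>) *\<^sub>R v
         - real (Suc l) *\<^sub>R fst (moment_numerators \<alpha> \<beta> A r v l),
       det (resolvent_quad \<alpha> \<beta> A) ^ Suc l *\<^sub>R (exp \<alpha> * sin \<beta>) *\<^sub>R v
         - real (Suc l) *\<^sub>R snd (moment_numerators \<alpha> \<beta> A r v l))"

definition cos_input :: "nat \<Rightarrow> real \<Rightarrow> real \<Rightarrow> real \<Rightarrow> real" where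
  "cos_input l \<alpha> \<beta> t = t ^ l * exp (\<alpha> * t) * cos (\<beta> * t)"

definition sin_input :: "nat \<Rightarrow> real \<Rightarrow> real \<Rightarrow> real \<Rightarrow> real" where
  "sin_input l \<alpha> \<beta> t = t ^ l * exp (\<alpha> * t) * sin (\<beta> * t)"

lemma continuous_inputs:
  "continuous_on S (cos_input l \<alpha> \<beta>)" "continuous_on S (sin_input l \<alpha> \<beta>)"
  unfolding cos_input_def sin_input_def by (intro continuous_intros)+

text \<open>Integration by parts of the two inputs against the costate.\<close>

lemma moment_recurrence:
  fixes A :: "real^'n^'n" and \<alpha> :: real
  assumes \<rho>: "costate A v \<rho>"
  defines "N \<equiv> \<alpha> *\<^sub>R mat 1 - A"
  shows "moment (cos_input l \<alpha> \<beta>) \<rho> v* N - \<beta> *\<^sub>R moment (sin_input l \<alpha> \<beta>) \<rho> =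
      (exp \<alpha> * cos \<beta>) *\<^sub>R v - (if l = 0 then \<rho> 0 else real l *\<^sub>R moment (cos_input (l - 1) \<alpha> \<beta>) \<rho>)" (is ?c)
    and "moment (sin_input l \<alpha> \<beta>) \<rho> v* N + \<beta> *\<^sub>R moment (cos_input l \<alpha> \<beta>) \<rho> =
      (exp \<alpha> * sin \<beta>) *\<^sub>R v - (if l = 0 then 0 else real l *\<^sub>R moment (sin_input (l - 1) \<alpha> \<beta>) \<rho>)" (is ?s)
proof -
  interpret vm: bounded_bilinear "(v*) :: real^'n \<Rightarrow> real^'n^'n \<Rightarrow> real^'n"
    by (rule bounded_bilinear_vector_matrix_mult)
  note cont = continuous_inputs continuous_on_add continuous_on_mult continuous_on_const
  note lin = moment_add[OF _ _ \<rho>] moment_cmult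
  have N: "z v* N = \<alpha> *\<^sub>R z - z v* A" for z
    by (simp add: N_def vm.diff_right vm.scaleR_right)
  have "(cos_input l \<alpha> \<beta> has_real_derivative
      real l * cos_input (l - 1) \<alpha> \<beta> t + (\<alpha> * cos_input l \<alpha> \<beta> t + (- \<beta>) * sin_input l \<alpha> \<beta> t)) (at t)" for t
    unfolding cos_input_def sin_input_def
    by (rule derivative_eq_intros refl)+ (simp add: algebra_simps)
  from moment_by_parts[OF \<rho> this]
  have "cos_input l \<alpha> \<beta> 1 *\<^sub>R v - cos_input l \<alpha> \<beta> 0 *\<^sub>R \<rho> 0 =
     real l *\<^sub>R moment (cos_input (l - 1) \<alpha> \<beta>) \<rho> + (\<alpha> *\<^sub>R moment (cos_input l \<alpha> \<beta>) \<rho> 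
     + (- \<beta>) *\<^sub>R moment (sin_input l \<alpha> \<beta>) \<rho>) - moment (cos_input l \<alpha> \<beta>) \<rho> v* A"
    by (simp only: lin cont)
  then show ?c by (auto simp: N cos_input_def[of _ _ _ 0] cos_input_def[of _ _ _ 1] algebra_simps)
  have "(sin_input l \<alpha> \<beta> has_real_derivative
      real l * sin_input (l - 1) \<alpha> \<beta> t + (\<alpha> * sin_input l \<alpha> \<beta> t + \<beta> * cos_input l \<alpha> \<beta> t)) (at t)" for t
    unfolding cos_input_def sin_input_def
    by (rule derivative_eq_intros refl)+ (simp add: algebra_simps)
  from moment_by_parts[OF \<rho> this]
  have "sin_input l \<alpha> \<beta> 1 *\<^sub>R v - sin_input l \<alpha> \<beta> 0 *\<^sub>R \<rho> 0 =
     real l *\<^sub>R moment (sin_input (l - 1) \<alpha> \<beta>) \<rho> + (\<alpha> *\<^sub>R moment (sin_input l \<alpha> \<beta>) \<rho> 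
     + \<beta> *\<^sub>R moment (cos_input l \<alpha> \<beta>) \<rho>) - moment (sin_input l \<alpha> \<beta>) \<rho> v* A"
    by (simp only: lin cont)
  then show ?s by (auto simp: N sin_input_def[of _ _ _ 0] sin_input_def[of _ _ _ 1] algebra_simps)
qed

lemma moment_numerators_eq:
  assumes \<rho>: "costate A v \<rho>"
  shows "moment_numerators \<alpha> \<beta> A (\<rho> 0) v l =
    (det (resolvent_quad \<alpha> \<beta> A) ^ Suc l *\<^sub>R moment (cos_input l \<alpha> \<beta>) \<rho>,
     det (resolvent_quad \<alpha> \<beta> A) ^ Suc l *\<^sub>R moment (sin_input l \<alpha> \<beta>) \<rho>)"
proof (induction l)
  case 0
  show ?case
    using resolvent_step_eq[of \<alpha> \<beta> A 1 "moment (cos_input 0 \<alpha> \<beta>) \<rho>" "moment (sin_input 0 \<alpha> \<beta>) \<rho>"]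
    by (simp add: moment_recurrence[OF \<rho>])
next
  case (Suc l)
  let ?D = "det (resolvent_quad \<alpha> \<beta> A) ^ Suc l"
  show ?case
    using resolvent_step_eq[of \<alpha> \<beta> A ?D "moment (cos_input (Suc l) \<alpha> \<beta>) \<rho>" "moment (sin_input (Suc l) \<alpha> \<beta>) \<rho>"]
    by (simp add: moment_recurrence[OF \<rho>] Suc scaleR_right_diff_distrib mult_ac)
qed

context
  fixes A :: "'a::euclidean_space \<Rightarrow> real^'n^'n"
  assumes A: "\<And>i j. polydeg 1 (\<lambda>\<xi>. A \<xi> $ i $ j)"
begin

lemma polydeg_shift: "polydeg 1 (\<lambda>\<xi>. (\<alpha> *\<^sub>R mat 1 - A \<xi>) $ i $ j)"
  by (simp only: vector_minus_component vector_scaleR_component real_scaleR_def)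
     (intro polydeg_diff polydeg_const A)

lemma polydeg_quad: "polydeg 2 (\<lambda>\<xi>. resolvent_quad \<alpha> \<beta> (A \<xi>) $ i $ j)"
proof -
  have "polydeg (1 + 1) (\<lambda>\<xi>. (\<Sum>k\<in>UNIV. (\<alpha> *\<^sub>R mat 1 - A \<xi>) $ i $ k * (\<alpha> *\<^sub>R mat 1 - A \<xi>) $ k $ j)
     + \<beta>\<^sup>2 * mat 1 $ i $ j)"
    by (intro polydeg.add polydeg_sum polydeg_mult polydeg_shift polydeg_const)
  then show ?thesis by (simp add: resolvent_quad_def matrix_matrix_mult_def numeral_2_eq_2)
qed

lemma polydeg_det_quad: "polydeg (2 * CARD('n)) (\<lambda>\<xi>. det (resolvent_quad \<alpha> \<beta> (A \<xi>)))"
  using polydeg_det[of "\<lambda>_. 2" "\<lambda>\<xi>. resolvent_quad \<alpha> \<beta> (A \<xi>)"] polydeg_quad by (simp add: mult.commute)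

lemma polydeg_cramer:
  assumes "\<And>i. polydeg (Suc e) (\<lambda>\<xi>. b \<xi> $ i)"
  shows "polydeg (Suc e + 2 * (CARD('n) - 1)) (\<lambda>\<xi>. cramer_numerator (resolvent_quad \<alpha> \<beta> (A \<xi>)) (b \<xi>) $ k)"
proof -
  have "polydeg (\<Sum>j\<in>UNIV. if j = k then Suc e else 2)
      (\<lambda>\<xi>. det (\<chi> i j. if j = k then b \<xi> $ i else resolvent_quad \<alpha> \<beta> (A \<xi>) $ j $ i))"
    by (intro polydeg_det) (auto intro: polydeg_quad assms)
  moreover have "(\<Sum>j\<in>UNIV. if j = k then Suc e else 2) = Suc e + 2 * (CARD('n) - 1)"
    by (simp add: sum.remove[of UNIV k] card_Diff_singleton)
  ultimately show ?thesis by (simp add: cramer_numerator_def)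
qed

lemma polydeg_resolvent_step:
  assumes f: "\<And>i. polydeg e (\<lambda>\<xi>. f \<xi> $ i)" and g: "\<And>i. polydeg e (\<lambda>\<xi>. g \<xi> $ i)"
  shows "polydeg (Suc e + 2 * (CARD('n) - 1)) (\<lambda>\<xi>. fst (resolvent_step \<alpha> \<beta> (A \<xi>) (f \<xi>, g \<xi>)) $ k)"
    and "polydeg (Suc e + 2 * (CARD('n) - 1)) (\<lambda>\<xi>. snd (resolvent_step \<alpha> \<beta> (A \<xi>) (f \<xi>, g \<xi>)) $ k)"
proof -
  have mult: "polydeg (Suc e) (\<lambda>\<xi>. (h \<xi> v* (\<alpha> *\<^sub>R mat 1 - A \<xi>)) $ i)"
    if "\<And>i. polydeg e (\<lambda>\<xi>. h \<xi> $ i)" for h i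
  proof -
    have "polydeg (e + 1) (\<lambda>\<xi>. \<Sum>j\<in>UNIV. h \<xi> $ j * (\<alpha> *\<^sub>R mat 1 - A \<xi>) $ j $ i)"
      by (intro polydeg_sum polydeg_mult polydeg_shift that)
    then show ?thesis by (simp add: vector_matrix_mult_def)
  qed
  have cm: "polydeg (Suc e) (\<lambda>\<xi>. \<beta> * h \<xi> $ i)" if "\<And>i. polydeg e (\<lambda>\<xi>. h \<xi> $ i)" for h i
    by (rule polydeg_mono[OF polydeg_cmult[OF that]]) simp
  show "polydeg (Suc e + 2 * (CARD('n) - 1)) (\<lambda>\<xi>. fst (resolvent_step \<alpha> \<beta> (A \<xi>) (f \<xi>, g \<xi>)) $ k)"
    unfolding resolvent_step_def prod.case fst_conv
    by (intro polydeg_cramer) (simp only: vector_add_component vector_scaleR_component real_scaleR_def, 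
       intro polydeg.add mult cm f g)
  show "polydeg (Suc e + 2 * (CARD('n) - 1)) (\<lambda>\<xi>. snd (resolvent_step \<alpha> \<beta> (A \<xi>) (f \<xi>, g \<xi>)) $ k)"
    unfolding resolvent_step_def prod.case snd_conv
    by (intro polydeg_cramer) (simp only: vector_minus_component vector_scaleR_component real_scaleR_def, 
       intro polydeg_diff mult cm f g)
qed

lemma polydeg_moment_numerators:
  assumes r: "\<And>i. polydeg 1 (\<lambda>\<xi>. r \<xi> $ i)" and v: "\<And>i. polydeg 1 (\<lambda>\<xi>. v \<xi> $ i)"
  shows "polydeg (2 * CARD('n) * Suc l) (\<lambda>\<xi>. fst (moment_numerators \<alpha> \<beta> (A \<xi>) (r \<xi>) (v \<xi>) l) $ k) \<and>
    polydeg (2 * CARD('n) * Suc l) (\<lambda>\<xi>. snd (moment_numerators \<alpha> \<beta> (A \<xi>) (r \<xi>) (v \<xi>) l) $ k)"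
proof (induction l arbitrary: k)
  case 0
  have n: "Suc 1 + 2 * (CARD('n) - 1) = 2 * CARD('n) * Suc 0"
    using zero_less_card_finite[where 'a='n] by (cases "CARD('n)") simp_all
  have "polydeg 1 (\<lambda>\<xi>. ((exp \<alpha> * cos \<beta>) *\<^sub>R v \<xi> - r \<xi>) $ i)" 
    "polydeg 1 (\<lambda>\<xi>. ((exp \<alpha> * sin \<beta>) *\<^sub>R v \<xi>) $ i)" for i
    by (simp_all only: vector_minus_component vector_scaleR_component real_scaleR_def)
       (intro polydeg_diff polydeg_cmult r v)+
  from polydeg_resolvent_step[OF this] show ?case
    unfolding moment_numerators.simps n by blast
next
  case (Suc l)
  have n: "Suc (2 * CARD('n) * Suc l + 1) + 2 * (CARD('n) - 1) = 2 * CARD('n) * Suc (Suc l)"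
    using zero_less_card_finite[where 'a='n] by (cases "CARD('n)") (simp_all add: algebra_simps)
  have *: "polydeg (2 * CARD('n) * Suc l + 1)
     (\<lambda>\<xi>. (det (resolvent_quad \<alpha> \<beta> (A \<xi>)) ^ Suc l *\<^sub>R c *\<^sub>R v \<xi> - real (Suc l) *\<^sub>R h \<xi>) $ i)"
    if "\<And>i. polydeg (2 * CARD('n) * Suc l) (\<lambda>\<xi>. h \<xi> $ i)" for c h i
  proof -
    have "polydeg (Suc l * (2 * CARD('n)) + 1) (\<lambda>\<xi>. det (resolvent_quad \<alpha> \<beta> (A \<xi>)) ^ Suc l * (c * v \<xi> $ i))"
      by (intro polydeg_mult polydeg_power polydeg_det_quad polydeg_cmult v)
    then show ?thesis
      by (simp only: vector_minus_component vector_scaleR_component real_scaleR_def)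
         (intro polydeg_diff polydeg_cmult polydeg_mono[OF that]; simp add: mult_ac)
  qed
  show ?case
    unfolding moment_numerators.simps n[symmetric]
    by (intro conjI polydeg_resolvent_step * Suc[THEN conjunct1] Suc[THEN conjunct2])
qed

end

text \<open>Up to the factor \<open>\<eta>\<^sup>2\<close>, the matrix is a polynomial in \<open>1 / \<eta>\<close> with value \<open>mat 1\<close> at
\<open>0\<close>, so that its determinant is not the zero polynomial.\<close>

lemma finite_resonances:
  fixes A :: "real^'n^'n"
  shows "finite {\<eta>. det (resolvent_quad \<alpha> \<beta> (A + \<eta> *\<^sub>R mat 1)) = 0}"
proof -
  define N where "N = \<alpha> *\<^sub>R mat 1 - A"
  define M :: "real \<Rightarrow> real^'n^'n" where
    "M = (\<lambda>\<tau>. (\<tau> *\<^sub>R N - mat 1) ** (\<tau> *\<^sub>R N - mat 1) + (\<tau>\<^sup>2 * \<beta>\<^sup>2) *\<^sub>R mat 1)"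
  have rp: "real_polynomial_function (\<lambda>\<tau>. M \<tau> $ i $ j)" for i j
    unfolding M_def matrix_matrix_mult_def by (simp) (intro real_polynomial_function.intros
       real_polynomial_function_sum real_polynomial_function_diff real_polynomial_function_power
       finite bounded_linear_ident)
  have "real_polynomial_function (\<lambda>\<tau>. det (M \<tau>))"
    unfolding det_def
    by (intro real_polynomial_function_sum real_polynomial_function.intros(2,4)
        real_polynomial_function_prod rp finite_permutations finite)
  from real_polynomial_function_imp_sum[OF this]
  obtain c d where cd: "(\<lambda>\<tau>. det (M \<tau>)) = (\<lambda>\<tau>. \<Sum>i\<le>d. c i * \<tau> ^ i)" by blast
  have c: "det (M \<tau>) = (\<Sum>i\<le>d. c i * \<tau> ^ i)" for \<tau> using fun_cong[OF cd] .
  have "M 0 = mat 1"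
    by (simp add: M_def bounded_bilinear.minus_left[OF bounded_bilinear_matrix_matrix_mult]
       bounded_bilinear.minus_right[OF bounded_bilinear_matrix_matrix_mult])
  then have "(\<Sum>i\<le>d. c i * 0 ^ i) \<noteq> 0" using c[of 0] by simp
  then have "\<exists>i\<le>d. c i \<noteq> 0" by (auto elim: sum.not_neutral_contains_not_neutral)
  then have fin: "finite {\<tau>. det (M \<tau>) = 0}" using polyfun_finite_roots[of c d] c by simp
  have "{\<eta>. det (resolvent_quad \<alpha> \<beta> (A + \<eta> *\<^sub>R mat 1)) = 0} \<subseteq> insert 0 (inverse ` {\<tau>. det (M \<tau>) = 0})"
  proof
    fix \<eta> assume "\<eta> \<in> {\<eta>. det (resolvent_quad \<alpha> \<beta> (A + \<eta> *\<^sub>R mat 1)) = 0}"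
    then have det0: "det (resolvent_quad \<alpha> \<beta> (A + \<eta> *\<^sub>R mat 1)) = 0" by simp
    show "\<eta> \<in> insert 0 (inverse ` {\<tau>. det (M \<tau>) = 0})"
    proof (cases "\<eta> = 0")
      case False
      interpret mm: bounded_bilinear "(**) :: real^'n^'n \<Rightarrow> real^'n^'n \<Rightarrow> real^'n^'n"
        by (rule bounded_bilinear_matrix_matrix_mult)
      define T where "T = inverse \<eta> *\<^sub>R N - mat 1"
      have T: "\<alpha> *\<^sub>R mat 1 - (A + \<eta> *\<^sub>R mat 1) = \<eta> *\<^sub>R T"
        using False by (simp add: T_def N_def scaleR_right_diff_distrib)
      have inv: "\<eta> * (\<eta> * (inverse \<eta> * inverse \<eta>)) = 1" using False by (simp add: field_simps)
      have "resolvent_quad \<alpha> \<beta> (A + \<eta> *\<^sub>R mat 1) = \<eta>\<^sup>2 *\<^sub>R M (inverse \<eta>)"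
        using inv unfolding resolvent_quad_def T M_def T_def[symmetric]
        by (simp add: mm.scaleR_left mm.scaleR_right scaleR_add_right power2_eq_square)
      then have "\<not> invertible (M (inverse \<eta>))"
        using det0 False scalar_invertible[of "\<eta>\<^sup>2" "M (inverse \<eta>)"] by (auto simp: invertible_det_nz)
      then have "inverse \<eta> \<in> {\<tau>. det (M \<tau>) = 0}" by (simp add: invertible_det_nz)
      then show ?thesis by (intro insertI2 image_eqI[of _ _ "inverse \<eta>"]) simp_all
    qed simp
  qed
  then show ?thesis using fin finite_subset by blast
qed

lemma costate_shift:
  fixes A :: "real^'n^'n"
  assumes "costate A v \<rho>"
  shows "costate (A + \<eta> *\<^sub>R mat 1) v (\<lambda>t. exp (\<eta> * (1 - t)) *\<^sub>R \<rho> t)"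
proof -
  interpret vm: bounded_bilinear "(v*) :: real^'n \<Rightarrow> real^'n^'n \<Rightarrow> real^'n"
    by (rule bounded_bilinear_vector_matrix_mult)
  have "((\<lambda>t. exp (\<eta> * (1 - t)) *\<^sub>R \<rho> t) has_vector_derivative
     exp (\<eta> * (1 - t)) *\<^sub>R (- (\<rho> t v* A)) + (exp (\<eta> * (1 - t)) * (- \<eta>)) *\<^sub>R \<rho> t) (at t)" for t
    using assms unfolding costate_def
    by (intro has_vector_derivative_scaleR) (auto intro!: derivative_eq_intros)
  then show ?thesis using assms
    by (simp add: costate_def vm.scaleR_left vm.scaleR_right vm.add_right algebra_simps)
qed

lemma moment_shift_continuous:
  fixes \<rho> :: "real \<Rightarrow> real^'n"
  assumes f: "continuous_on {0..1} f" and \<rho>: "continuous_on {0..1} \<rho>"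
  shows "continuous_on UNIV (\<lambda>\<eta>. moment f (\<lambda>t. exp (\<eta> * (1 - t)) *\<^sub>R \<rho> t))"
proof -
  have "continuous_on (UNIV \<times> cbox 0 1) (\<lambda>(\<eta>, t). f t *\<^sub>R exp (\<eta> * (1 - t)) *\<^sub>R \<rho> t)"
    unfolding split_beta
    by (intro continuous_intros continuous_on_compose2[OF f] continuous_on_compose2[OF \<rho>]) auto
  from integral_continuous_on_param[OF this] show ?thesis by (simp add: moment_def)
qed

section \<open>The VC dimension of the sign system class\<close>

lemma moment_cong: "(\<And>t. t \<in> {0..1} \<Longrightarrow> f t = g t) \<Longrightarrow> moment f \<rho> = moment g \<rho>"
  unfolding moment_def by (intro integral_cong) simp

lemma basis_input_cases:
  assumes "basis_inputs l \<alpha> \<beta> \<omega>"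
  shows "(\<forall>t\<in>{0..1}. \<omega> j t = cos_input (l j) (\<alpha> j) (\<beta> j) t) \<or> (\<forall>t\<in>{0..1}. \<omega> j t = sin_input (l j) (\<alpha> j) (\<beta> j) t)"
  using assms unfolding basis_inputs_def cos_input_def sin_input_def by blast

lemma basis_input_continuous:
  assumes "basis_inputs l \<alpha> \<beta> \<omega>"
  shows "continuous_on {0..1} (\<omega> j)"
  using basis_input_cases[OF assms, of j]
  by (metis continuous_inputs continuous_on_cong[OF refl])

text \<open>The parameters are \<open>A\<close>, the costate at time 0, the output row, \<open>B\<close>, and the contribution of
the initial state to the output.  On actual systems the costate at time 0 is determined by
\<open>A\<close> and the output row, but it is not a polynomial in them.\<close>

type_synonym ('n, 'm) parameters = "(real^'n^'n) \<times> (real^'n) \<times> (real^'n) \<times> (real^'m^'n) \<times> real"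

text \<open>The final output multiplied by the squares of all denominators.  The squares make the factor positive
away from resonances, so that the sign is unchanged.\<close>

lemma cleared_output_polynomial:
  fixes \<omega> :: "'k::finite \<Rightarrow> real \<Rightarrow> real"
  assumes basis: "basis_inputs l \<alpha> \<beta> \<omega>"
  defines "e \<equiv> 2 * CARD('n::finite) * Suc (Max (range l))"
  obtains p :: "real^'k^'m::finite \<Rightarrow> ('n::finite, 'm) parameters \<Rightarrow> real"
  where "\<And>G. polydeg (2 * CARD('k) * e + 1) (p G)"
    and "\<And>A v \<rho> B c G. costate A v \<rho> \<Longrightarrow> p G (A, \<rho> 0, v, B, c) =
      (\<Prod>j\<in>UNIV. (det (resolvent_quad (\<alpha> j) (\<beta> j) A) ^ Suc (l j))\<^sup>2) * (G \<bullet> response \<omega> B \<rho> + c)"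
proof -
  define E where "E = (\<lambda>j \<xi>::('n, 'm) parameters. det (resolvent_quad (\<alpha> j) (\<beta> j) (fst \<xi>)) ^ Suc (l j))"
  define isc where "isc = (\<lambda>j. \<forall>t\<in>{0..1}. \<omega> j t = cos_input (l j) (\<alpha> j) (\<beta> j) t)"
  define num where "num = (\<lambda>j \<xi>::('n, 'm) parameters. (if isc j then fst else snd)
      (moment_numerators (\<alpha> j) (\<beta> j) (fst \<xi>) (fst (snd \<xi>)) (fst (snd (snd \<xi>))) (l j)))"
  define p where "p = (\<lambda>(G::real^'k^'m) \<xi>::('n, 'm) parameters. snd (snd (snd (snd \<xi>))) * (\<Prod>j\<in>UNIV. (E j \<xi>)\<^sup>2) +
     (\<Sum>i\<in>UNIV. \<Sum>j\<in>UNIV. G $ i $ j *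
        ((\<Sum>a\<in>UNIV. fst (snd (snd (snd \<xi>))) $ a $ i * num j \<xi> $ a) * (E j \<xi> * (\<Prod>j'\<in>UNIV - {j}. (E j' \<xi>)\<^sup>2)))))"
  have pA: "polydeg 1 (\<lambda>\<xi>::('n, 'm) parameters. fst \<xi> $ i $ j)" for i j
    by (rule polydeg_linear, rule linearI) auto
  have pr: "polydeg 1 (\<lambda>\<xi>::('n, 'm) parameters. fst (snd \<xi>) $ i)" for i
    by (rule polydeg_linear, rule linearI) auto
  have pv: "polydeg 1 (\<lambda>\<xi>::('n, 'm) parameters. fst (snd (snd \<xi>)) $ i)" for i
    by (rule polydeg_linear, rule linearI) auto
  have pB: "polydeg 1 (\<lambda>\<xi>::('n, 'm) parameters. fst (snd (snd (snd \<xi>))) $ i $ j)" for i j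
    by (rule polydeg_linear, rule linearI) auto
  have pc: "polydeg 1 (\<lambda>\<xi>::('n, 'm) parameters. snd (snd (snd (snd \<xi>))))"
    by (rule polydeg_linear, rule linearI) auto
  have lmax: "2 * CARD('n) * Suc (l j) \<le> e" for j
    unfolding e_def by (intro mult_left_mono) auto
  have pE: "polydeg e (E j)" for j
  proof (rule polydeg_mono)
    show "polydeg (Suc (l j) * (2 * CARD('n))) (E j)"
      unfolding E_def by (intro polydeg_power polydeg_det_quad pA)
  qed (use lmax[of j] in \<open>simp add: mult_ac\<close>)
  have pnum: "polydeg e (\<lambda>\<xi>. num j \<xi> $ a)" for j a
    using polydeg_moment_numerators[OF pA pr pv, where l = "l j" and k = a and \<alpha> = "\<alpha> j" and \<beta> = "\<beta> j"]
    by (auto simp: num_def intro: polydeg_mono[OF _ lmax[of j]])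
  have "polydeg (2 * CARD('k) * e + 1) (p G)" for G
    unfolding p_def
  proof (intro polydeg.add polydeg_sum polydeg_cmult)
    have "polydeg (1 + (\<Sum>j\<in>(UNIV::'k set). 2 * e)) (\<lambda>\<xi>::('n, 'm) parameters. snd (snd (snd (snd \<xi>))) * (\<Prod>j\<in>UNIV. (E j \<xi>)\<^sup>2))"
      by (intro polydeg_mult polydeg_prod polydeg_power pE pc)
    then show "polydeg (2 * CARD('k) * e + 1) (\<lambda>\<xi>::('n, 'm) parameters. snd (snd (snd (snd \<xi>))) * (\<Prod>j\<in>UNIV. (E j \<xi>)\<^sup>2))"
      by (simp add: mult_ac)
    fix i j
    have "polydeg ((1 + e) + (e + (\<Sum>j\<in>UNIV - {j}. 2 * e)))
       (\<lambda>\<xi>. (\<Sum>a\<in>UNIV. fst (snd (snd (snd \<xi>))) $ a $ i * num j \<xi> $ a) * (E j \<xi> * (\<Prod>j'\<in>UNIV - {j}. (E j' \<xi>)\<^sup>2)))"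
      by (intro polydeg_mult polydeg_sum polydeg_prod polydeg_power pE pB pnum)
    moreover have "(1 + e) + (e + (\<Sum>j\<in>UNIV - {j}. 2 * e)) = 2 * CARD('k) * e + 1"
    proof -
      have "(\<Sum>j\<in>(UNIV::'k set). 2 * e) = 2 * e + (\<Sum>j\<in>UNIV - {j}. 2 * e)" by (intro sum.remove) auto
      then show ?thesis by (simp add: mult_ac)
    qed
    ultimately show "polydeg (2 * CARD('k) * e + 1)
       (\<lambda>\<xi>. (\<Sum>a\<in>UNIV. fst (snd (snd (snd \<xi>))) $ a $ i * num j \<xi> $ a) * (E j \<xi> * (\<Prod>j'\<in>UNIV - {j}. (E j' \<xi>)\<^sup>2)))"
      by simp
  qed
  moreover have "p G (A, \<rho> 0, v, B, c) =
      (\<Prod>j\<in>UNIV. (det (resolvent_quad (\<alpha> j) (\<beta> j) A) ^ Suc (l j))\<^sup>2) * (G \<bullet> response \<omega> B \<rho> + c)"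
    if \<rho>: "costate A v \<rho>" for A v \<rho> B c G
  proof -
    let ?\<xi> = "(A, \<rho> 0, v, B, c)"
    let ?E = "\<lambda>j. E j ?\<xi>"
    have num: "num j ?\<xi> = ?E j *\<^sub>R moment (\<omega> j) \<rho>" for j
    proof (cases "isc j")
      case True
      then have "moment (\<omega> j) \<rho> = moment (cos_input (l j) (\<alpha> j) (\<beta> j)) \<rho>"
        by (intro moment_cong) (simp add: isc_def)
      then show ?thesis using True by (simp only: num_def E_def moment_numerators_eq[OF \<rho>] fst_conv snd_conv if_True)
    next
      case False
      then have "moment (\<omega> j) \<rho> = moment (sin_input (l j) (\<alpha> j) (\<beta> j)) \<rho>"
        using basis_input_cases[OF basis, of j] by (intro moment_cong) (auto simp: isc_def)
      then show ?thesis using False by (simp only: num_def E_def moment_numerators_eq[OF \<rho>] fst_conv snd_conv if_False)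
    qed
    have "(\<Sum>a\<in>UNIV. B $ a $ i * num j ?\<xi> $ a) * (?E j * (\<Prod>j'\<in>UNIV - {j}. (?E j')\<^sup>2)) =
        (\<Prod>j\<in>UNIV. (?E j)\<^sup>2) * response \<omega> B \<rho> $ i $ j" for i j
    proof -
      have "(\<Prod>j\<in>UNIV. (?E j)\<^sup>2) = (?E j)\<^sup>2 * (\<Prod>j'\<in>UNIV - {j}. (?E j')\<^sup>2)" by (intro prod.remove) auto
      moreover have "(\<Sum>a\<in>UNIV. B $ a $ i * num j ?\<xi> $ a) = ?E j * response \<omega> B \<rho> $ i $ j"
        by (simp add: num response_def sum_distrib_left mult_ac)
      ultimately show ?thesis by (simp add: power2_eq_square)
    qed
    then have "p G ?\<xi> = c * (\<Prod>j\<in>UNIV. (?E j)\<^sup>2) + 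
        (\<Sum>i\<in>UNIV. \<Sum>j\<in>UNIV. G $ i $ j * ((\<Prod>j\<in>UNIV. (?E j)\<^sup>2) * response \<omega> B \<rho> $ i $ j))"
      by (simp add: p_def)
    also have "\<dots> = (\<Prod>j\<in>UNIV. (?E j)\<^sup>2) * (G \<bullet> response \<omega> B \<rho> + c)"
      by (simp add: inner_vec_def sum_distrib_left sum_distrib_right distrib_left mult_ac)
    finally show ?thesis by (simp add: E_def)
  qed
  ultimately show ?thesis by (intro that)
qed

text \<open>Every labelling of a finite set of controls by a response and an offset is also realised strictly and
without resonances.\<close>

lemma strict_nonresonant_realisation:
  fixes \<omega> :: "'k::finite \<Rightarrow> real \<Rightarrow> real" and D :: "(real^'k^'m::finite) set"
  assumes basis: "basis_inputs l \<alpha> \<beta> \<omega>" and "finite D"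
    and w: "w \<in> responses TYPE('n::finite) \<omega>" and \<sigma>: "\<And>G. G \<in> D \<Longrightarrow> G \<in> \<sigma> \<longleftrightarrow> G \<bullet> w + c > 0"
  shows "\<exists>(A::real^'n^'n) v \<rho> B c. costate A v \<rho> \<and> (\<forall>j. det (resolvent_quad (\<alpha> j) (\<beta> j) A) \<noteq> 0) \<and>
    (\<forall>G\<in>D. if G \<in> \<sigma> then G \<bullet> response \<omega> B \<rho> + c > 0 else G \<bullet> response \<omega> B \<rho> + c < 0)"
proof -
  obtain A :: "real^'n^'n" and v \<rho> B where \<rho>: "costate A v \<rho>" "w = response \<omega> B \<rho>"
    using w unfolding responses_def mem_Collect_eq by (elim exE conjE) (rule that)
  \<comment> \<open>lowering the constant slightly makes all signs strict\<close>
  have "\<forall>\<^sub>F \<delta> in at_right 0. \<forall>G\<in>D. G \<in> \<sigma> \<longrightarrow> G \<bullet> w + c - \<delta> > 0"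
  proof -
    have "\<forall>\<^sub>F \<delta> in at_right 0. G \<in> \<sigma> \<longrightarrow> G \<bullet> w + c - \<delta> > 0" if "G \<in> D" for G
    proof (cases "G \<in> \<sigma>")
      case True
      have "((\<lambda>\<delta>. G \<bullet> w + c - \<delta>) \<longlongrightarrow> G \<bullet> w + c - 0) (at_right 0)" by (intro tendsto_intros)
      from order_tendstoD(1)[OF this, of 0] show ?thesis using True \<sigma>[OF that] by simp
    qed simp
    then show ?thesis using \<open>finite D\<close> by (simp add: eventually_ball_finite_distrib)
  qed
  moreover have "\<forall>\<^sub>F \<delta>::real in at_right 0. \<delta> > 0" by (rule eventually_at_right_less)
  ultimately have "\<forall>\<^sub>F \<delta>::real in at_right 0. \<delta> > 0 \<and> (\<forall>G\<in>D. G \<in> \<sigma> \<longrightarrow> G \<bullet> w + c - \<delta> > 0)"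
    by eventually_elim auto
  from eventually_happens'[OF trivial_limit_at_right_real this]
  obtain \<delta> where \<delta>: "\<delta> > 0" "\<And>G. G \<in> D \<Longrightarrow> G \<in> \<sigma> \<Longrightarrow> G \<bullet> w + c - \<delta> > 0" by blast
  define c' where "c' = c - \<delta>"
  \<comment> \<open>shifting \<open>A\<close> by \<open>\<eta>\<close> multiplies the costate by a scalar exponential\<close>
  define R where "R = (\<lambda>\<eta>. response \<omega> B (\<lambda>t. exp (\<eta> * (1 - t)) *\<^sub>R \<rho> t))"
  have R0: "R 0 = w" by (simp add: R_def \<rho>)
  have "continuous_on UNIV R"
    unfolding R_def response_def
    by (intro continuous_on_vec_lambda continuous_intros moment_shift_continuous 
        basis_input_continuous[OF basis] costate_continuous[OF \<rho>(1)])
  then have contR: "isCont R 0" by (simp add: continuous_on_eq_continuous_at)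
  have sgn: "\<forall>\<^sub>F \<eta> in at 0. \<forall>G\<in>D. if G \<in> \<sigma> then G \<bullet> R \<eta> + c' > 0 else G \<bullet> R \<eta> + c' < 0"
  proof -
    have "\<forall>\<^sub>F \<eta> in at 0. if G \<in> \<sigma> then G \<bullet> R \<eta> + c' > 0 else G \<bullet> R \<eta> + c' < 0" if "G \<in> D" for G
    proof -
      have lim: "((\<lambda>\<eta>. G \<bullet> R \<eta> + c') \<longlongrightarrow> G \<bullet> w + c') (at 0)"
        using contR unfolding isCont_def R0 by (intro tendsto_intros)
      show ?thesis
      proof (cases "G \<in> \<sigma>")
        case True
        then show ?thesis using order_tendstoD(1)[OF lim, of 0] \<delta>(2)[OF that] by (simp add: c'_def)
      next
        case False
        then show ?thesis using order_tendstoD(2)[OF lim, of 0] \<delta>(1) \<sigma>[OF that] by (simp add: c'_def)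
      qed
    qed
    then show ?thesis using \<open>finite D\<close> by (simp add: eventually_ball_finite_distrib)
  qed
  have nonres: "\<forall>\<^sub>F \<eta> in at 0. \<forall>j\<in>UNIV. det (resolvent_quad (\<alpha> j) (\<beta> j) (A + \<eta> *\<^sub>R mat 1)) \<noteq> 0"
  proof -
    have "\<forall>\<^sub>F \<eta> in at 0. det (resolvent_quad (\<alpha> j) (\<beta> j) (A + \<eta> *\<^sub>R mat 1)) \<noteq> 0" for j
    proof -
      let ?Z = "{\<eta>. det (resolvent_quad (\<alpha> j) (\<beta> j) (A + \<eta> *\<^sub>R mat 1)) = 0}"
      have "\<forall>\<^sub>F \<eta> in at 0. \<eta> \<in> - (?Z - {0})"
      proof (rule eventually_at_in_open')
        show "open (- (?Z - {0}))" by (intro open_Compl finite_imp_closed finite_Diff finite_resonances)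
      qed simp
      moreover have "\<forall>\<^sub>F \<eta>::real in at 0. \<eta> \<noteq> 0" by (simp add: eventually_at_filter)
      ultimately show ?thesis by eventually_elim auto
    qed
    then show ?thesis by (intro eventually_ball_finite) auto
  qed
  from eventually_happens'[OF trivial_limit_at eventually_conj[OF sgn nonres]]
  obtain \<eta> where \<eta>: "\<forall>G\<in>D. if G \<in> \<sigma> then G \<bullet> R \<eta> + c' > 0 else G \<bullet> R \<eta> + c' < 0"
    "\<forall>j\<in>UNIV. det (resolvent_quad (\<alpha> j) (\<beta> j) (A + \<eta> *\<^sub>R mat 1)) \<noteq> 0" by blast
  show ?thesis
    using \<eta> costate_shift[OF \<rho>(1), of \<eta>] unfolding R_def
    by (intro exI[of _ "A + \<eta> *\<^sub>R mat 1"] exI[of _ v] exI[of _ "\<lambda>t. exp (\<eta> * (1 - t)) *\<^sub>R \<rho> t"]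
         exI[of _ B] exI[of _ c']) simp
qed

lemma shattered_card_exponential_bound:
  fixes \<omega> :: "'k::finite \<Rightarrow> real \<Rightarrow> real" and D :: "(real^'k^'m::finite) set"
  assumes basis: "basis_inputs l \<alpha> \<beta> \<omega>" and "finite D"
    and sh: "shattered (affine_signs (responses TYPE('n::finite) \<omega>)) D"
  shows "2 ^ card D \<le> (2 * card D * (4 * CARD('n) * CARD('k) * Suc (Max (range l)) + 1) + 1) ^
     (CARD('n) * CARD('n) + 2 * CARD('n) + CARD('n) * CARD('m) + 1)"
proof -
  let ?d = "2 * CARD('k) * (2 * CARD('n) * Suc (Max (range l))) + 1"
  obtain p :: "real^'k^'m \<Rightarrow> ('n, 'm) parameters \<Rightarrow> real" where p: "\<And>G. polydeg ?d (p G)"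
    and p_eq: "\<And>A v \<rho> B c G. costate A v \<rho> \<Longrightarrow> p G (A, \<rho> 0, v, B, c) =
      (\<Prod>j\<in>UNIV. (det (resolvent_quad (\<alpha> j) (\<beta> j) A) ^ Suc (l j))\<^sup>2) * (G \<bullet> response \<omega> B \<rho> + c)"
    by (rule cleared_output_polynomial[OF basis, where 'n='n and 'm='m]) (rule that)
  have "card (Pow D) \<le> (2 * card D * ?d + 1) ^ DIM(('n, 'm) parameters)"
  proof (rule strict_sign_patterns_card[OF \<open>finite D\<close> p])
    fix \<sigma> assume "\<sigma> \<in> Pow D"
    then have "\<sigma> \<subseteq> D" by simp
    from sh obtain h where h: "h \<in> affine_signs (responses TYPE('n) \<omega>)" "\<And>G. G \<in> D \<Longrightarrow> h G = (G \<in> \<sigma>)"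
      unfolding shattered_def by (elim allE[of _ "\<lambda>G. G \<in> \<sigma>"]) blast
    then obtain w c where w: "w \<in> responses TYPE('n) \<omega>" "\<And>G. G \<in> D \<Longrightarrow> G \<in> \<sigma> \<longleftrightarrow> G \<bullet> w + c > 0"
      by (auto simp: affine_signs_def)
    from strict_nonresonant_realisation[OF basis \<open>finite D\<close> w(1), of \<sigma> c] w(2)
    obtain A :: "real^'n^'n" and v \<rho> B c where *: "costate A v \<rho>"
      "\<forall>j. det (resolvent_quad (\<alpha> j) (\<beta> j) A) \<noteq> 0"
      "\<forall>G\<in>D. if G \<in> \<sigma> then G \<bullet> response \<omega> B \<rho> + c > 0 else G \<bullet> response \<omega> B \<rho> + c < 0"
      by auto
    have pos: "(\<Prod>j\<in>UNIV. (det (resolvent_quad (\<alpha> j) (\<beta> j) A) ^ Suc (l j))\<^sup>2) > 0"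
      using *(2) by (intro prod_pos) auto
    have "p G (A, \<rho> 0, v, B, c) > 0" if "G \<in> \<sigma>" for G
      using *(3) that \<open>\<sigma> \<subseteq> D\<close> pos unfolding p_eq[OF *(1)] by (intro mult_pos_pos) auto
    moreover have "p G (A, \<rho> 0, v, B, c) < 0" if "G \<in> D - \<sigma>" for G
      using *(3) that pos unfolding p_eq[OF *(1)] by (intro mult_pos_neg) auto
    ultimately show "\<sigma> \<subseteq> D \<and> (\<exists>x. (\<forall>G\<in>\<sigma>. p G x > 0) \<and> (\<forall>G\<in>D-\<sigma>. p G x < 0))"
      using \<open>\<sigma> \<subseteq> D\<close> by blast
  qed
  moreover have "DIM(('n, 'm) parameters) = CARD('n) * CARD('n) + 2 * CARD('n) + CARD('n) * CARD('m) + 1" by simp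
  moreover have "?d = 4 * CARD('n) * CARD('k) * Suc (Max (range l)) + 1" by (simp add: algebra_simps)
  ultimately show ?thesis using \<open>finite D\<close> by (simp only: card_Pow)
qed

lemma two_powr_ge_double: "t \<ge> 2 \<Longrightarrow> 2 * t \<le> 2 powr (t::real)"
proof -
  assume t: "t \<ge> 2"
  have "ln 2 \<ge> (1/2 :: real)" using ln2_ge_two_thirds by linarith
  then have "1 + (t - 2) * (1/2) \<le> 1 + (t - 2) * ln 2" using t by (intro add_left_mono mult_left_mono) auto
  also have "\<dots> \<le> exp ((t - 2) * ln 2)" by (rule exp_ge_add_one_self)
  finally have "t / 2 \<le> 2 powr (t - 2)" by (simp add: powr_def field_simps)
  then show ?thesis by (simp add: powr_diff)
qed

text \<open>With \<open>y = N / \<nu>\<close> the hypothesis gives \<open>2 powr y \<le> X * y\<close>, which fails for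
\<open>y > 2 * log 2 X\<close> because then \<open>2 powr (y / 2)\<close> exceeds \<open>X\<close> and is at least \<open>y\<close>.\<close>

lemma exponential_vs_polynomial_bound:
  fixes N d \<nu> :: nat and X :: real
  assumes N: "2 ^ N \<le> (2 * N * d + 1) ^ \<nu>" and "\<nu> > 0" and X: "X \<ge> 4" "2 * real d * real \<nu> + 1 \<le> X"
  shows "real N \<le> 2 * real \<nu> * log 2 X"
proof (rule ccontr)
  define y where "y = real N / real \<nu>"
  assume "\<not> ?thesis"
  then have y: "y > 2 * log 2 X" using \<open>\<nu> > 0\<close> by (simp add: y_def field_simps)
  have L: "log 2 X \<ge> 2" using X by (simp add: le_log_iff)
  have "(2::real) ^ N \<le> (2 * real N * real d + 1) ^ \<nu>"
    using N[THEN of_nat_mono, where 'a=real] by (simp add: algebra_simps)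
  also have "2 * real N * real d + 1 = 2 * real d * real \<nu> * y + 1" using \<open>\<nu> > 0\<close> by (simp add: y_def)
  also have "(2::real) ^ N = (2 powr y) ^ \<nu>" using \<open>\<nu> > 0\<close>
    by (simp add: y_def powr_realpow[symmetric] powr_powr)
  finally have "2 powr y \<le> 2 * real d * real \<nu> * y + 1"
    using \<open>\<nu> > 0\<close> L y by (subst (asm) power_mono_iff) auto
  also have "\<dots> \<le> (2 * real d * real \<nu> + 1) * y" using L y by (simp add: algebra_simps)
  also have "\<dots> \<le> X * y" using X L y by (intro mult_right_mono) auto
  also have "\<dots> \<le> X * 2 powr (y / 2)"
    using two_powr_ge_double[of "y / 2"] X L y by (intro mult_left_mono) auto
  also have "\<dots> < 2 powr (y / 2) * 2 powr (y / 2)"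
  proof (intro mult_strict_right_mono)
    have "X = 2 powr (log 2 X)" using X by simp
    also have "\<dots> < 2 powr (y / 2)" using y by simp
    finally show "X < 2 powr (y / 2)" .
  qed simp
  also have "\<dots> = 2 powr y" by (simp flip: powr_add)
  finally show False by simp
qed

text \<open>The actual number \<open>\<nu>\<close> of parameters and degree \<open>d\<close> satisfy \<open>2 d \<nu> + 1 \<le> X\<close>
for the argument \<open>X\<close> of the logarithm, with much room to spare.\<close>

lemma shattered_card_bound:
  fixes \<omega> :: "'k::finite \<Rightarrow> real \<Rightarrow> real" and D :: "(real^'k^'m::finite) set"
  assumes basis: "basis_inputs l \<alpha> \<beta> \<omega>" and "finite D"
    and sh: "shattered (affine_signs (responses TYPE('n::finite) \<omega>)) D"
  defines "n \<equiv> real CARD('n)" and "m \<equiv> real CARD('m)" and "k \<equiv> real CARD('k)" and "L \<equiv> real (Max (range l))"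
  shows "real (card D) \<le> 2 * (2 * m * n ^ 2 + 4 * n + 1) *
     log 2 (8 * exp 1 * (8 * m * n ^ 2 * k * (n + L) + 1) * (2 * n * k + 2 * (1 + 2 * k) ^ CARD('n)))"
    (is "_ \<le> 2 * ?\<nu> * log 2 ?X")
proof -
  define d where "d = 4 * CARD('n) * CARD('k) * Suc (Max (range l)) + 1"
  define \<nu> where "\<nu> = CARD('n) * CARD('n) + 2 * CARD('n) + CARD('n) * CARD('m) + 1"
  have pos: "n \<ge> 1" "m \<ge> 1" "k \<ge> 1" "L \<ge> 0" 
    using zero_less_card_finite[where 'a='n] zero_less_card_finite[where 'a='m] zero_less_card_finite[where 'a='k]
    unfolding n_def m_def k_def L_def by (simp_all del: zero_less_card_finite)
  have e: "exp 1 \<ge> (2::real)" using exp_ge_add_one_self[of 1] by simp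
  define Y where "Y = m * n ^ 2 * (k * n * (n + L))"
  have mn: "n \<le> m * n ^ 2" "n ^ 2 \<le> m * n ^ 2" "1 \<le> m * n ^ 2" "m * n \<le> m * n ^ 2"
  proof -
    have "n \<le> n ^ 2" using pos by (simp add: power2_eq_square)
    moreover show "n ^ 2 \<le> m * n ^ 2" using mult_right_mono[of 1 m "n ^ 2"] pos by simp
    ultimately show "n \<le> m * n ^ 2" by simp
    then show "1 \<le> m * n ^ 2" using pos by linarith
    show "m * n \<le> m * n ^ 2" using \<open>n \<le> n ^ 2\<close> pos by simp
  qed
  have \<nu>_le: "real \<nu> \<le> 5 * (m * n ^ 2)" and \<nu>_le': "real \<nu> \<le> ?\<nu>"
  proof -
    have "real \<nu> = n ^ 2 + 2 * n + m * n + 1"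
      by (simp add: \<nu>_def n_def m_def power2_eq_square)
    then show "real \<nu> \<le> 5 * (m * n ^ 2)" "real \<nu> \<le> ?\<nu>" using mn pos by linarith+
  qed
  have d_le: "real d \<le> 5 * (k * n * (n + L))"
  proof -
    have "real d = 4 * (k * n * (1 + L)) + 1" by (simp add: d_def n_def k_def L_def algebra_simps)
    also have "\<dots> \<le> 4 * (k * n * (n + L)) + 1" using pos by (intro add_right_mono mult_left_mono) auto
    also have "1 \<le> k * n * (n + L)"
      using mult_mono[of 1 "k * n" 1 "n + L"] mult_mono[of 1 k 1 n] pos by simp
    finally show ?thesis by simp
  qed
  have kn: "k * n * (n + L) \<ge> 1" using mult_mono[of 1 "k * n" 1 "n + L"] mult_mono[of 1 k 1 n] pos by simp
  have Y: "Y \<ge> 1" unfolding Y_def using mult_mono[of 1 "m * n ^ 2" 1 "k * n * (n + L)"] mn(3) kn by simp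
  have X: "?X \<ge> 256 * Y"
  proof -
    have kk: "k \<le> k * k" using pos by simp
    have "256 * Y \<le> 256 * (m * n ^ 2 * (k * k * n * (n + L)))"
      unfolding Y_def using pos kk by (intro mult_left_mono mult_right_mono) auto
    also have "\<dots> = 8 * 2 * (8 * m * n ^ 2 * k * (n + L)) * (2 * n * k)" by (simp add: algebra_simps)
    also have "\<dots> \<le> ?X" using pos e by (intro mult_mono) auto
    finally show ?thesis .
  qed
  have "real d * real \<nu> \<le> (5 * (k * n * (n + L))) * (5 * (m * n ^ 2))"
    using d_le \<nu>_le pos by (intro mult_mono) auto
  also have "\<dots> = 25 * Y" by (simp add: Y_def algebra_simps)
  finally have "2 * real d * real \<nu> + 1 \<le> ?X" "?X \<ge> 4" using X Y by linarith+
  moreover have "2 ^ card D \<le> (2 * card D * d + 1) ^ \<nu>"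
    unfolding d_def \<nu>_def by (rule shattered_card_exponential_bound[OF basis \<open>finite D\<close> sh])
  moreover have "\<nu> > 0" by (simp add: \<nu>_def)
  ultimately have "real (card D) \<le> 2 * real \<nu> * log 2 ?X" by (intro exponential_vs_polynomial_bound)
  also have "\<dots> \<le> 2 * ?\<nu> * log 2 ?X"
    using \<nu>_le' \<open>?X \<ge> 4\<close> by (intro mult_right_mono mult_left_mono) (auto simp: zero_le_log_cancel_iff)
  finally show ?thesis .
qed

section \<open>Shattering and the number of labellings\<close>

text \<open>Pajor's form of the Sauer-Shelah lemma: a family of sets shatters at least as many sets as it has
members.  In the induction step the family splits into the traces on \<open>F\<close> and the traces that
arise both with and without \<open>x\<close>.\<close>

lemma card_le_card_shattered:
  assumes "finite F" "T \<subseteq> Pow F"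
  shows "card T \<le> card {S. S \<subseteq> F \<and> (\<forall>U\<subseteq>S. \<exists>t\<in>T. t \<inter> S = U)}"
  using assms
proof (induction F arbitrary: T rule: finite_induct)
  case empty
  then have "T = {} \<or> T = {{}}" by auto
  then show ?case
  proof
    assume T: "T = {{}}"
    then have "{S. S \<subseteq> {} \<and> (\<forall>U\<subseteq>S. \<exists>t\<in>T. t \<inter> S = U)} = {{}}" by auto
    then show ?thesis by (simp add: T)
  qed simp
next
  case (insert x F)
  define sh where "sh = (\<lambda>F T. {S. S \<subseteq> F \<and> (\<forall>U\<subseteq>S. \<exists>t\<in>T. t \<inter> S = U)} :: 'a set set)"
  define T0 where "T0 = {t. t \<subseteq> F \<and> (t \<in> T \<or> insert x t \<in> T)}"
  define T1 where "T1 = {t. t \<subseteq> F \<and> t \<in> T \<and> insert x t \<in> T}"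
  define Ta where "Ta = {t \<in> T. x \<notin> t}"
  define Tb where "Tb = {t. t \<subseteq> F \<and> insert x t \<in> T}"
  have inj_insert: "inj_on (insert x) X" if "\<And>t. t \<in> X \<Longrightarrow> x \<notin> t" for X
  proof (rule inj_onI)
    fix a b assume "a \<in> X" "b \<in> X" "insert x a = insert x b"
    then show "a = b" using that[of a] that[of b] insert_ident[of x a b] by simp
  qed
  have finT: "finite T" using insert.prems insert.hyps finite_subset[of T "Pow (insert x F)"] by simp
  have fin: "finite Ta" "finite Tb" unfolding Ta_def Tb_def using finT insert.hyps by auto
  have "T = Ta \<union> insert x ` Tb"
  proof (intro equalityI subsetI)
    fix t assume t: "t \<in> T"
    show "t \<in> Ta \<union> insert x ` Tb"
    proof (cases "x \<in> t")
      case True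
      then have "t = insert x (t - {x})" "t - {x} \<subseteq> F" using t insert.prems by auto
      then show ?thesis using t unfolding Tb_def by (intro UnI2 image_eqI[of _ _ "t - {x}"]) auto
    qed (use t in \<open>auto simp: Ta_def\<close>)
  qed (auto simp: Ta_def Tb_def)
  moreover have "Ta \<inter> insert x ` Tb = {}" by (auto simp: Ta_def)
  moreover have "inj_on (insert x) Tb" using insert.hyps by (intro inj_insert) (auto simp: Tb_def)
  ultimately have "card T = card Ta + card Tb"
    using fin by (metis card_Un_disjoint card_image finite_imageI)
  also have "\<dots> = card (Ta \<union> Tb) + card (Ta \<inter> Tb)" using fin by (rule card_Un_Int)
  also have "Ta \<union> Tb = T0" using insert.prems insert.hyps by (auto simp: Ta_def Tb_def T0_def)
  also have "Ta \<inter> Tb = T1" using insert.prems insert.hyps by (auto simp: Ta_def Tb_def T1_def)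
  also have "card T0 + card T1 \<le> card (sh F T0) + card (sh F T1)"
    unfolding sh_def by (intro add_mono insert.IH) (auto simp: T0_def T1_def)
  also have "\<dots> = card (sh F T0 \<union> insert x ` sh F T1)"
  proof -
    have "inj_on (insert x) (sh F T1)" using insert.hyps by (intro inj_insert) (auto simp: sh_def)
    moreover have "sh F T0 \<inter> insert x ` sh F T1 = {}" using insert.hyps by (auto simp: sh_def)
    moreover have "finite (sh F T0)" "finite (sh F T1)"
      using insert.hyps by (auto simp: sh_def)
    ultimately show ?thesis by (simp add: card_Un_disjoint card_image)
  qed
  also have "\<dots> \<le> card (sh (insert x F) T)"
  proof (rule card_mono)
    show "finite (sh (insert x F) T)" using insert.hyps by (auto simp: sh_def)
    have "S \<in> sh (insert x F) T" if "S \<in> sh F T0" for S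
    proof -
      have "\<exists>t\<in>T. t \<inter> S = U" if U: "U \<subseteq> S" for U
      proof -
        have *: "\<forall>U\<subseteq>S. \<exists>t\<in>T0. t \<inter> S = U" and "S \<subseteq> F" using \<open>S \<in> sh F T0\<close> by (simp_all add: sh_def)
        obtain t where t: "t \<in> T0" "t \<inter> S = U" using *[rule_format, OF U] by (elim bexE)
        have "x \<notin> S" using \<open>S \<subseteq> F\<close> insert.hyps by blast
        then have "insert x t \<inter> S = U" using t(2) by simp
        then show ?thesis using t unfolding T0_def mem_Collect_eq by (elim conjE disjE) (rule bexI, assumption+)+
      qed
      moreover have "S \<subseteq> insert x F" using that by (auto simp: sh_def)
      ultimately show ?thesis unfolding sh_def mem_Collect_eq by (intro conjI allI impI)
    qed
    moreover have "insert x S \<in> sh (insert x F) T" if "S \<in> sh F T1" for S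
    proof -
      have S: "S \<subseteq> F" "x \<notin> S" using that insert.hyps by (auto simp: sh_def)
      have "\<exists>t\<in>T. t \<inter> insert x S = U" if U: "U \<subseteq> insert x S" for U
      proof -
        have "U - {x} \<subseteq> S" using U by auto
        have *: "\<forall>U\<subseteq>S. \<exists>t\<in>T1. t \<inter> S = U" using \<open>S \<in> sh F T1\<close> by (simp add: sh_def)
        obtain t where t: "t \<in> T1" "t \<inter> S = U - {x}"
          using *[rule_format, OF \<open>U - {x} \<subseteq> S\<close>] by (elim bexE)
        have tt: "t \<in> T" "insert x t \<in> T" "x \<notin> t" using t(1) insert.hyps by (auto simp: T1_def)
        show ?thesis
        proof (cases "x \<in> U")
          case True
          then have "insert x t \<inter> insert x S = U" using t by auto
          then show ?thesis using tt by blast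
        next
          case False
          then have "t \<inter> insert x S = U" using t tt by auto
          then show ?thesis using tt by blast
        qed
      qed
      moreover have "insert x S \<subseteq> insert x F" using S by auto
      ultimately show ?thesis unfolding sh_def mem_Collect_eq by (intro conjI allI impI)
    qed
    ultimately show "sh F T0 \<union> insert x ` sh F T1 \<subseteq> sh (insert x F) T" by auto
  qed
  finally show ?case by (simp add: sh_def)
qed

lemma card_subsets_le:
  assumes "finite F"
  shows "card {S. S \<subseteq> F \<and> card S \<le> d} = (\<Sum>i\<le>d. card F choose i)"
proof -
  have "{S. S \<subseteq> F \<and> card S \<le> d} = (\<Union>i\<in>{..d}. {S. S \<subseteq> F \<and> card S = i})" by auto
  also have "card \<dots> = (\<Sum>i\<le>d. card {S. S \<subseteq> F \<and> card S = i})"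
    using assms by (intro card_UN_disjoint) auto
  finally show ?thesis using assms by (simp add: n_subsets)
qed

lemma card_traces_le:
  assumes "finite F" and d: "\<And>S. finite S \<Longrightarrow> shattered \<C> S \<Longrightarrow> card S \<le> d"
  shows "card ((\<lambda>h. {x \<in> F. h x}) ` \<C>) \<le> (\<Sum>i\<le>d. card F choose i)"
proof -
  let ?T = "(\<lambda>h. {x \<in> F. h x}) ` \<C>"
  have "card ?T \<le> card {S. S \<subseteq> F \<and> (\<forall>U\<subseteq>S. \<exists>t\<in>?T. t \<inter> S = U)}"
    using assms(1) by (intro card_le_card_shattered) auto
  also have "\<dots> \<le> card {S. S \<subseteq> F \<and> card S \<le> d}"
  proof (intro card_mono)
    show "finite {S. S \<subseteq> F \<and> card S \<le> d}" using assms(1) by simp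
    have "card S \<le> d" if S: "S \<subseteq> F" "\<forall>U\<subseteq>S. \<exists>t\<in>?T. t \<inter> S = U" for S
    proof (rule d)
      show "finite S" using S assms(1) finite_subset by blast
      show "shattered \<C> S"
        unfolding shattered_def
      proof
        fix f
        have "{x\<in>S. f x} \<subseteq> S" by auto
        from S(2)[rule_format, OF this]
        obtain h where h: "h \<in> \<C>" "{x \<in> F. h x} \<inter> S = {x\<in>S. f x}" by (elim bexE imageE) simp
        have "h x = f x" if "x \<in> S" for x using eqset_imp_iff[OF h(2), of x] that S(1) by auto
        then show "\<exists>h\<in>\<C>. \<forall>x\<in>S. h x = f x" using h(1) by (intro bexI[of _ h]) simp_all
      qed
    qed
    then show "{S. S \<subseteq> F \<and> (\<forall>U\<subseteq>S. \<exists>t\<in>?T. t \<inter> S = U)} \<subseteq> {S. S \<subseteq> F \<and> card S \<le> d}" by auto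
  qed
  finally show ?thesis using card_subsets_le[OF assms(1)] by simp
qed

lemma sum_binomial_le:
  assumes "1 \<le> d" "d \<le> N"
  shows "real (\<Sum>i\<le>d. N choose i) \<le> (exp 1 * real N / real d) ^ d"
proof -
  define q where "q = real d / real N"
  have q: "0 < q" "q \<le> 1" using assms by (auto simp: q_def)
  have "q ^ d * real (\<Sum>i\<le>d. N choose i) = (\<Sum>i\<le>d. real (N choose i) * q ^ d)"
    by (simp add: sum_distrib_left mult.commute)
  also have "\<dots> \<le> (\<Sum>i\<le>d. real (N choose i) * q ^ i)"
    using q by (intro sum_mono mult_left_mono power_decreasing) auto
  also have "\<dots> \<le> (\<Sum>i\<le>N. real (N choose i) * q ^ i)"
    using q assms by (intro sum_mono2) auto
  also have "\<dots> = (1 + q) ^ N"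
    using binomial_ring[of q 1 N] by (simp add: add.commute)
  also have "\<dots> \<le> exp q ^ N" using q exp_ge_add_one_self[of q] by (intro power_mono) auto
  also have "\<dots> = exp 1 ^ d" using assms by (simp add: q_def flip: exp_of_nat_mult)
  finally have "q ^ d * real (\<Sum>i\<le>d. N choose i) \<le> exp 1 ^ d" .
  then have "real (\<Sum>i\<le>d. N choose i) \<le> exp 1 ^ d / q ^ d" using q by (simp add: field_simps)
  also have "\<dots> = (exp 1 * real N / real d) ^ d" by (simp add: q_def power_divide power_mult_distrib)
  finally show ?thesis .
qed

section \<open>The double-sample argument\<close>

text \<open>\<open>e1 i\<close> and \<open>e2 i\<close> say that a hypothesis errs on the \<open>i\<close>-th point of the first and of the second
sample, and \<open>\<tau>\<close> is the set of exchanged positions.  If the first sample is free of errors after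
the exchange, then \<open>\<tau>\<close> is determined at each of the at least \<open>t\<close> positions with an error.\<close>

lemma card_good_swaps:
  fixes e1 e2 :: "nat \<Rightarrow> bool"
  shows "real (card {\<tau> \<in> Pow {..<s}. (\<forall>i<s. if i \<in> \<tau> then \<not> e2 i else \<not> e1 i) \<and>
      t \<le> (\<Sum>i<s. of_bool (if i \<in> \<tau> then e1 i else e2 i))}) \<le> 2 powr (real s - t)"
    (is "real (card ?T) \<le> _")
proof (cases "?T = {}")
  case True
  show ?thesis unfolding True by simp
next
  case False
  define E where "E = {i. i < s \<and> (e1 i \<or> e2 i)}"
  have E: "E \<subseteq> {..<s}" "finite E" by (auto simp: E_def)
  have eq: "\<tau> \<inter> E = {i\<in>E. e1 i}" if "\<tau> \<in> ?T" for \<tau>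
    using that by (auto simp: E_def split: if_splits)
  obtain \<tau> where \<tau>: "\<tau> \<in> ?T" using False by blast
  then have "t \<le> (\<Sum>i<s. of_bool (if i \<in> \<tau> then e1 i else e2 i))" by simp
  also have "\<dots> = (\<Sum>i<s. of_bool (i \<in> E))"
    using \<tau> by (intro sum.cong refl) (auto simp: E_def split: if_splits)
  also have "\<dots> = real (card E)" using E by (simp add: sum.If_cases of_bool_def Int_absorb1)
  finally have t: "t \<le> real (card E)" .
  have "?T \<subseteq> (\<lambda>\<rho>. \<rho> \<union> {i\<in>E. e1 i}) ` Pow ({..<s} - E)"
  proof
    fix \<tau> assume "\<tau> \<in> ?T"
    then show "\<tau> \<in> (\<lambda>\<rho>. \<rho> \<union> {i\<in>E. e1 i}) ` Pow ({..<s} - E)"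
      using eq[of \<tau>] by (intro image_eqI[of _ _ "\<tau> - E"]) auto
  qed
  then have "card ?T \<le> card (Pow ({..<s} - E))" by (rule surj_card_le[rotated]) simp
  also have "\<dots> = 2 ^ (s - card E)" using E by (simp add: card_Pow card_Diff_subset)
  finally have "real (card ?T) \<le> 2 ^ (s - card E)" using of_nat_mono by fastforce
  also have "\<dots> = 2 powr (real s - real (card E))"
    using card_mono[OF _ E(1)] by (simp add: powr_realpow[symmetric] of_nat_diff)
  also have "\<dots> \<le> 2 powr (real s - t)" using t by simp
  finally show ?thesis .
qed

text \<open>A Chernoff bound: the number of hits \<open>H\<close> is estimated through the expectation of
\<open>2 powr - H\<close>, which factorises over the product measure.\<close>

lemma few_hits_prob:
  fixes I :: "'i set"
  assumes P: "prob_space P" and "finite I" and E: "E \<in> sets P" and p: "measure P E \<ge> \<epsilon>"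
    and I: "\<epsilon> * real (card I) \<ge> 8"
  shows "emeasure (PiM I (\<lambda>_. P)) {y \<in> space (PiM I (\<lambda>_. P)).
      (\<Sum>i\<in>I. of_bool (y i \<in> E)) < \<epsilon> * real (card I) / 2} \<le> ennreal (1 / 2)"
proof -
  interpret P: prob_space P by fact
  interpret PP: product_sigma_finite "\<lambda>_. P" by standard
  define r where "r = \<epsilon> * real (card I) / 2"
  define g where "g = (\<lambda>u. 1 - indicator E u / 2 :: real)"
  let ?M = "PiM I (\<lambda>_. P)"
  let ?B = "{y \<in> space ?M. (\<Sum>i\<in>I. of_bool (y i \<in> E)) < r}"
  have g_meas: "g \<in> borel_measurable P" unfolding g_def using E by measurable
  have meas_i: "(\<lambda>y. y i) \<in> measurable ?M P" if "i \<in> I" for i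
    using measurable_component_singleton[OF that, of "\<lambda>_. P"] by simp
  have B: "?B \<in> sets ?M"
  proof -
    have "(\<lambda>y. \<Sum>i\<in>I. indicator E (y i) :: real) \<in> borel_measurable ?M"
      using E meas_i by (intro borel_measurable_sum measurable_compose[OF meas_i borel_measurable_indicator])
    then have "{y \<in> space ?M. (\<Sum>i\<in>I. indicator E (y i)) < r} \<in> sets ?M" by measurable
    then show ?thesis by (simp add: indicator_def of_bool_def)
  qed
  have g0: "0 \<le> g u" for u by (simp add: g_def indicator_def)
  have "emeasure ?M ?B = (\<integral>\<^sup>+y. indicator ?B y \<partial>?M)" using B by simp
  also have "\<dots> \<le> (\<integral>\<^sup>+y. ennreal (2 powr r) * (\<Prod>i\<in>I. ennreal (g (y i))) \<partial>?M)"
  proof (rule nn_integral_mono)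
    fix y assume "y \<in> space ?M"
    show "indicator ?B y \<le> ennreal (2 powr r) * (\<Prod>i\<in>I. ennreal (g (y i)))"
    proof (cases "y \<in> ?B")
      case True
      have g2: "g u = 2 powr (- of_bool (u \<in> E))" for u by (simp add: g_def powr_minus)
      have "(\<Prod>i\<in>I. g (y i)) = 2 powr (\<Sum>i\<in>I. - of_bool (y i \<in> E))"
        unfolding g2 by (subst powr_sum) (auto simp: \<open>finite I\<close>)
      then have "2 powr r * (\<Prod>i\<in>I. g (y i)) = 2 powr (r - (\<Sum>i\<in>I. of_bool (y i \<in> E)))"
        by (simp add: sum_negf flip: powr_add)
      also have "\<dots> \<ge> 1" using True by (intro ge_one_powr_ge_zero) auto
      finally have "1 \<le> ennreal (2 powr r * (\<Prod>i\<in>I. g (y i)))" by simp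
      then show ?thesis using True g0 by (simp add: prod_ennreal ennreal_mult prod_nonneg)
    qed simp
  qed
  also have "\<dots> = ennreal (2 powr r) * (\<integral>\<^sup>+y. (\<Prod>i\<in>I. ennreal (g (y i))) \<partial>?M)"
    using g_meas by (intro nn_integral_cmult borel_measurable_prod_ennreal measurable_compose[OF meas_i]) auto
  also have "(\<integral>\<^sup>+y. (\<Prod>i\<in>I. ennreal (g (y i))) \<partial>?M) = (\<Prod>i\<in>I. \<integral>\<^sup>+u. ennreal (g u) \<partial>P)"
    using g_meas \<open>finite I\<close> by (intro PP.product_nn_integral_prod) auto
  also have "(\<integral>\<^sup>+u. ennreal (g u) \<partial>P) = ennreal (1 - measure P E / 2)"
  proof -
    have "(\<integral>\<^sup>+u. ennreal (g u) \<partial>P) = ennreal (\<integral>u. g u \<partial>P)"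
      using g0 g_meas by (intro nn_integral_eq_integral P.integrable_const_bound[of _ 1])
        (auto simp: g_def indicator_def)
    also have "(\<integral>u. g u \<partial>P) = 1 - measure P E / 2"
      unfolding g_def using E by (subst Bochner_Integration.integral_diff) (auto simp: P.prob_space P.emeasure_eq_measure)
    finally show ?thesis .
  qed
  also have "ennreal (2 powr r) * (\<Prod>i\<in>I. ennreal (1 - measure P E / 2)) =
      ennreal (2 powr r * (1 - measure P E / 2) ^ card I)"
  proof -
    have "0 \<le> 1 - measure P E / 2" using P.prob_le_1[of E] by linarith
    then show ?thesis by (simp add: ennreal_power ennreal_mult)
  qed
  also have "\<dots> \<le> ennreal (1 / 2)"
  proof (rule ennreal_leI)
    have "(1 - measure P E / 2) ^ card I \<le> exp (- (measure P E / 2)) ^ card I"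
    proof (rule power_mono)
      show "1 - measure P E / 2 \<le> exp (- (measure P E / 2))"
        using exp_ge_add_one_self[of "- (measure P E / 2)"] by simp
      show "0 \<le> 1 - measure P E / 2" using P.prob_le_1[of E] by linarith
    qed
    also have "\<dots> = exp (- (measure P E * card I / 2))" by (simp flip: exp_of_nat_mult)
    also have "\<dots> \<le> exp (- r)" using p by (simp add: r_def mult_right_mono)
    finally have "2 powr r * (1 - measure P E / 2) ^ card I \<le> 2 powr r * exp (- r)" by simp
    also have "\<dots> = exp (- ((1 - ln 2) * r))" by (simp add: powr_def algebra_simps flip: exp_add)
    also have "\<dots> \<le> exp (- 1)"
    proof -
      have "(11/36) * 4 \<le> (1 - ln 2) * r"
        using ln2_le_25_over_36 I by (intro mult_mono) (auto simp: r_def)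
      then show ?thesis by simp
    qed
    also have "\<dots> \<le> 1 / 2" using exp_ge_add_one_self[of 1] by (simp add: exp_minus field_simps)
    finally show "2 powr r * (1 - measure P E / 2) ^ card I \<le> 1 / 2" .
  qed
  finally show ?thesis by (simp add: r_def)
qed

text \<open>The permutation of \<open>{..<2 * s}\<close> that exchanges \<open>i\<close> and \<open>s + i\<close> for all \<open>i \<in> \<tau>\<close>.\<close>

definition swap_index :: "nat \<Rightarrow> nat set \<Rightarrow> nat \<Rightarrow> nat" where
  "swap_index s \<tau> i = (if i < s then (if i \<in> \<tau> then s + i else i) else (if i - s \<in> \<tau> then i - s else i))"

lemma swap_index_invol: "i < 2 * s \<Longrightarrow> \<tau> \<subseteq> {..<s} \<Longrightarrow> swap_index s \<tau> (swap_index s \<tau> i) = i"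
  by (auto simp: swap_index_def)

lemma swap_index_less: "i < 2 * s \<Longrightarrow> \<tau> \<subseteq> {..<s} \<Longrightarrow> swap_index s \<tau> i < 2 * s"
  by (auto simp: swap_index_def)

text \<open>\<open>Q\<close> is a set of samples of size \<open>s\<close> on each of which some concept consistent with \<open>\<phi>\<close> has
error at least \<open>\<epsilon>\<close>.  The event \<open>J\<close> for the double sample is defined through the countable
subclass to make it measurable; by approximation it contains the same event for the whole class.\<close>

lemma double_sample_bound:
  fixes P :: "'x measure" and \<epsilon> :: real and s :: nat
  assumes P: "prob_space P" and C0: "countable \<C>\<^sub>0" "\<C>\<^sub>0 \<subseteq> \<C>"
    and meas: "\<And>h. h \<in> \<C> \<Longrightarrow> {u \<in> space P. h u} \<in> sets P"
    and approx: "\<And>h F. h \<in> \<C> \<Longrightarrow> finite F \<Longrightarrow> \<exists>h\<^sub>0\<in>\<C>\<^sub>0. \<forall>u\<in>F. h\<^sub>0 u = h u"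
    and \<phi>: "\<phi> \<in> \<C>" and d: "\<And>S. finite S \<Longrightarrow> shattered \<C> S \<Longrightarrow> card S \<le> d"
    and Q: "Q \<in> sets (PiM {..<s} (\<lambda>_. P))"
    and H: "\<And>x. x \<in> Q \<Longrightarrow> \<exists>h\<in>\<C>. (\<forall>i<s. h (x i) = \<phi> (x i)) \<and> measure P {u \<in> space P. h u \<noteq> \<phi> u} \<ge> \<epsilon>"
    and s: "\<epsilon> * real s \<ge> 8"
  shows "measure (PiM {..<s} (\<lambda>_. P)) Q \<le> 2 * (real (\<Sum>i\<le>d. 2 * s choose i) * 2 powr (- (\<epsilon> * real s / 2)))"
proof -
  interpret P: prob_space P by fact
  interpret PP: product_sigma_finite "\<lambda>_. P" by standard
  let ?I = "{..<s}" and ?J = "{s..<2 * s}" and ?K = "{..<2 * s}"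
  let ?M = "PiM ?I (\<lambda>_. P)" and ?M' = "PiM ?J (\<lambda>_. P)" and ?MM = "PiM ?K (\<lambda>_. P)"
  interpret MM: prob_space ?MM by (intro prob_space_PiM P)
  interpret M: prob_space ?M by (intro prob_space_PiM P)
  define good where "good = (\<lambda>h z. (\<forall>i<s. h (z i) = \<phi> (z i)) \<and>
     \<epsilon> * real s / 2 \<le> (\<Sum>i\<in>?J. of_bool (h (z i) \<noteq> \<phi> (z i))))"
  define J where "J = {z \<in> space ?MM. \<exists>h\<in>\<C>\<^sub>0. good h z}"
  have dis_sets: "{u \<in> space P. h u \<noteq> \<phi> u} \<in> sets P" if "h \<in> \<C>" for h
  proof -
    have "{u \<in> space P. h u \<noteq> \<phi> u} = ({u \<in> space P. h u} - {u \<in> space P. \<phi> u}) \<union> ({u \<in> space P. \<phi> u} - {u \<in> space P. h u})"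
      by auto
    then show ?thesis using meas[OF that] meas[OF \<phi>] by simp
  qed
  have dis_pred: "Measurable.pred P (\<lambda>u. h u \<noteq> \<phi> u)" if "h \<in> \<C>" for h
    using dis_sets[OF that] by (simp add: pred_def)
  have comp: "Measurable.pred (PiM L (\<lambda>_. P)) (\<lambda>z. h (z i) \<noteq> \<phi> (z i))" if "h \<in> \<C>" "i \<in> L" for h i and L :: "nat set"
    using measurable_compose[OF measurable_component_singleton[OF that(2), of "\<lambda>_. P"] dis_pred[OF that(1)]] by simp
  have count: "(\<lambda>z. \<Sum>i\<in>L'. of_bool (h (z i) \<noteq> \<phi> (z i)) :: real) \<in> borel_measurable (PiM L (\<lambda>_. P))"
    if "h \<in> \<C>" "L' \<subseteq> L" for h and L L' :: "nat set"
    unfolding of_bool_def using that by (intro borel_measurable_sum measurable_If measurable_const comp[unfolded pred_def]) 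
      (auto simp: pred_def[symmetric] intro: comp)
  have J: "J \<in> sets ?MM"
  proof -
    have "{z \<in> space ?MM. good h z} \<in> sets ?MM" if "h \<in> \<C>\<^sub>0" for h
    proof -
      have h: "h \<in> \<C>" using that C0 by auto
      have "Measurable.pred ?MM (\<lambda>z. \<forall>i\<in>?I. \<not> (h (z i) \<noteq> \<phi> (z i)))"
        by (intro pred_intros_finite pred_intros_logic comp h) auto
      moreover have "Measurable.pred ?MM (\<lambda>z. \<epsilon> * real s / 2 \<le> (\<Sum>i\<in>?J. of_bool (h (z i) \<noteq> \<phi> (z i))))"
        unfolding pred_def by (intro borel_measurable_le measurable_const count h) auto
      ultimately have "Measurable.pred ?MM (\<lambda>z. (\<forall>i\<in>?I. \<not> (h (z i) \<noteq> \<phi> (z i))) \<and>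
          \<epsilon> * real s / 2 \<le> (\<Sum>i\<in>?J. of_bool (h (z i) \<noteq> \<phi> (z i))))"
        by (rule pred_intros_logic)
      then have "{z \<in> space ?MM. (\<forall>i\<in>?I. \<not> (h (z i) \<noteq> \<phi> (z i))) \<and>
          \<epsilon> * real s / 2 \<le> (\<Sum>i\<in>?J. of_bool (h (z i) \<noteq> \<phi> (z i)))} \<in> sets ?MM"
        by (simp only: pred_def)
      also have "{z \<in> space ?MM. (\<forall>i\<in>?I. \<not> (h (z i) \<noteq> \<phi> (z i))) \<and>
          \<epsilon> * real s / 2 \<le> (\<Sum>i\<in>?J. of_bool (h (z i) \<noteq> \<phi> (z i)))} = {z \<in> space ?MM. good h z}"
        unfolding good_def by (simp only: not_not Ball_def lessThan_iff)
      finally show ?thesis .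
    qed
    moreover have "J = (\<Union>h\<in>\<C>\<^sub>0. {z \<in> space ?MM. good h z})" by (auto simp: J_def)
    ultimately show ?thesis using C0(1) by (auto intro: sets.countable_UN')
  qed

  \<comment> \<open>for a first sample in \<open>Q\<close>, the second sample completes it to a point of \<open>J\<close> with probability at least \<open>1/2\<close>\<close>
  have half: "ennreal (1 / 2) * indicator Q x \<le> (\<integral>\<^sup>+y. indicator J (merge ?I ?J (x, y)) \<partial>?M')" if x: "x \<in> space ?M" for x
  proof (cases "x \<in> Q")
    case True
    obtain h where h: "h \<in> \<C>" "\<And>i. i < s \<Longrightarrow> h (x i) = \<phi> (x i)" "measure P {u \<in> space P. h u \<noteq> \<phi> u} \<ge> \<epsilon>"
      using H[OF True] by blast
    interpret M': prob_space ?M' by (intro prob_space_PiM P)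
    define Y where "Y = {y \<in> space ?M'. (\<Sum>i\<in>?J. of_bool (y i \<in> {u \<in> space P. h u \<noteq> \<phi> u})) < \<epsilon> * real (card ?J) / 2}"
    have Y_eq: "Y = {y \<in> space ?M'. (\<Sum>i\<in>?J. of_bool (h (y i) \<noteq> \<phi> (y i))) < \<epsilon> * real s / 2}"
    proof -
      have "(\<Sum>i\<in>?J. of_bool (y i \<in> {u \<in> space P. h u \<noteq> \<phi> u}) :: real) = (\<Sum>i\<in>?J. of_bool (h (y i) \<noteq> \<phi> (y i)))"
        if "y \<in> space ?M'" for y
        using that by (intro sum.cong refl) (auto simp: space_PiM PiE_iff)
      then show ?thesis unfolding Y_def by auto
    qed
    have Ysets: "Y \<in> sets ?M'"
      unfolding Y_eq by (intro borel_measurable_less count h measurable_const) auto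
    have "emeasure ?M' Y \<le> ennreal (1/2)"
      unfolding Y_def using h(3) s by (intro few_hits_prob P dis_sets h) auto
    then have "measure ?M' Y \<le> 1 / 2"
      unfolding M'.emeasure_eq_measure by (subst (asm) ennreal_le_iff) simp_all
    then have "ennreal (1 / 2) \<le> emeasure ?M' (space ?M' - Y)"
      unfolding M'.emeasure_eq_measure M'.prob_compl[OF Ysets] by (intro ennreal_leI) simp
    also have "\<dots> = (\<integral>\<^sup>+y. indicator (space ?M' - Y) y \<partial>?M')" using Ysets by simp
    also have "\<dots> \<le> (\<integral>\<^sup>+y. indicator J (merge ?I ?J (x, y)) \<partial>?M')"
    proof (rule nn_integral_mono)
      fix y assume y: "y \<in> space ?M'"
      have "merge ?I ?J (x, y) \<in> J" if "y \<notin> Y"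
      proof -
        let ?z = "merge ?I ?J (x, y)"
        have z: "?z \<in> space ?MM" using x y by (auto simp: space_PiM PiE_iff merge_def extensional_def)
        obtain h\<^sub>0 where h0: "h\<^sub>0 \<in> \<C>\<^sub>0" "\<forall>u\<in>?z ` ?K. h\<^sub>0 u = h u" using approx[OF h(1), of "?z ` ?K"] by auto
        have "good h ?z" using h(2) that y unfolding good_def Y_eq by (simp add: merge_def not_less)
        then have "good h\<^sub>0 ?z" using h0(2) unfolding good_def by simp
        then show ?thesis using z h0(1) by (auto simp: J_def)
      qed
      then show "indicator (space ?M' - Y) y \<le> (indicator J (merge ?I ?J (x, y)) :: ennreal)"
        by (auto simp: indicator_def)
    qed
    finally show ?thesis using True by simp
  qed simp
  have "ennreal (1 / 2) * emeasure ?M Q = (\<integral>\<^sup>+x. ennreal (1 / 2) * indicator Q x \<partial>?M)"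
    using Q by (simp add: nn_integral_cmult)
  also have "\<dots> \<le> (\<integral>\<^sup>+x. \<integral>\<^sup>+y. indicator J (merge ?I ?J (x, y)) \<partial>?M' \<partial>?M)"
    by (intro nn_integral_mono half)
  also have "\<dots> = (\<integral>\<^sup>+z. indicator J z \<partial>PiM (?I \<union> ?J) (\<lambda>_. P))"
    using J by (intro PP.product_nn_integral_fold[symmetric]) (auto simp: ivl_disj_un)
  also have "?I \<union> ?J = ?K" by auto
  also have "(\<integral>\<^sup>+z. indicator J z \<partial>?MM) = emeasure ?MM J" using J by simp
  finally have "ennreal (1 / 2 * measure ?M Q) \<le> ennreal (measure ?MM J)"
    unfolding M.emeasure_eq_measure MM.emeasure_eq_measure by (subst ennreal_mult) simp_all
  then have lower: "measure ?M Q \<le> 2 * measure ?MM J" by (subst (asm) ennreal_le_iff) simp_all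

  define sw where "sw = (\<lambda>\<tau> (z::nat \<Rightarrow> 'x). \<lambda>i\<in>?K. z (swap_index s \<tau> i))"
  have sw_meas: "sw \<tau> \<in> measurable ?MM ?MM" if "\<tau> \<subseteq> ?I" for \<tau>
    unfolding sw_def using swap_index_less[OF _ that]
    by (intro measurable_restrict measurable_component_singleton) auto
  have sw_distr: "distr ?MM ?MM (sw \<tau>) = ?MM" if "\<tau> \<subseteq> ?I" for \<tau>
    unfolding sw_def
  proof (rule distr_PiM_reindex)
    show "inj_on (swap_index s \<tau>) ?K"
      by (rule inj_on_inverseI[of _ "swap_index s \<tau>"]) (simp add: swap_index_invol that)
    show "swap_index s \<tau> \<in> ?K \<rightarrow> ?K" using swap_index_less[OF _ that] by auto
  qed (rule P)
  define B where "B = real (\<Sum>i\<le>d. 2 * s choose i) * 2 powr (real s - \<epsilon> * real s / 2)"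
  \<comment> \<open>a fixed double sample is mapped into \<open>J\<close> by few of the \<open>2 ^ s\<close> swaps\<close>
  have pointwise: "(\<Sum>\<tau>\<in>Pow ?I. indicator J (sw \<tau> z)) \<le> ennreal B" if z: "z \<in> space ?MM" for z
  proof -
    let ?F = "z ` ?K"
    let ?Tr = "(\<lambda>h. {u \<in> ?F. h u}) ` \<C>"
    define e where "e = (\<lambda>A i. (z i \<in> A) \<noteq> \<phi> (z i))"
    define G where "G = (\<lambda>A. {\<tau> \<in> Pow ?I. (\<forall>i<s. if i \<in> \<tau> then \<not> e A (s + i) else \<not> e A i) \<and>
       \<epsilon> * real s / 2 \<le> (\<Sum>i<s. of_bool (if i \<in> \<tau> then e A i else e A (s + i)))})"
    have "{\<tau> \<in> Pow ?I. sw \<tau> z \<in> J} \<subseteq> (\<Union>A\<in>?Tr. G A)"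
    proof
      fix \<tau> assume "\<tau> \<in> {\<tau> \<in> Pow ?I. sw \<tau> z \<in> J}"
      then obtain h where \<tau>: "\<tau> \<subseteq> ?I" and h: "h \<in> \<C>\<^sub>0" "good h (sw \<tau> z)" by (auto simp: J_def)
      let ?A = "{u \<in> ?F. h u}"
      have e: "e ?A i \<longleftrightarrow> h (z i) \<noteq> \<phi> (z i)" if "i < 2 * s" for i using that by (auto simp: e_def)
      have fst: "sw \<tau> z i = z (if i \<in> \<tau> then s + i else i)" if "i < s" for i
        using that by (simp add: sw_def swap_index_def)
      have snd: "sw \<tau> z (s + i) = z (if i \<in> \<tau> then i else s + i)" if "i < s" for i
        using that by (simp add: sw_def swap_index_def)
      have "\<forall>i<s. if i \<in> \<tau> then \<not> e ?A (s + i) else \<not> e ?A i"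
        using h(2) fst unfolding good_def by (auto simp: e split: if_splits)
      moreover have "\<epsilon> * real s / 2 \<le> (\<Sum>i<s. of_bool (if i \<in> \<tau> then e ?A i else e ?A (s + i)))"
      proof -
        have "(\<Sum>i\<in>?J. of_bool (h (sw \<tau> z i) \<noteq> \<phi> (sw \<tau> z i)) :: real) =
            (\<Sum>i<s. of_bool (h (sw \<tau> z (s + i)) \<noteq> \<phi> (sw \<tau> z (s + i))))"
          by (rule sum.reindex_bij_witness[of _ "\<lambda>i. s + i" "\<lambda>i. i - s"]) auto
        also have "\<dots> = (\<Sum>i<s. of_bool (if i \<in> \<tau> then e ?A i else e ?A (s + i)))"
          by (intro sum.cong refl) (simp add: snd e)
        finally show ?thesis using h(2) by (simp add: good_def)
      qed
      ultimately have "\<tau> \<in> G ?A" using \<tau> by (simp add: G_def)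
      then show "\<tau> \<in> (\<Union>A\<in>?Tr. G A)" using h(1) C0(2) by blast
    qed
    moreover have finTr: "finite ?Tr" by (rule finite_subset[of _ "Pow ?F"]) auto
    moreover have finG: "finite (G A)" for A unfolding G_def by simp
    ultimately have "card {\<tau> \<in> Pow ?I. sw \<tau> z \<in> J} \<le> card (\<Union>A\<in>?Tr. G A)"
      by (intro card_mono finite_UN_I)
    also have "\<dots> \<le> (\<Sum>A\<in>?Tr. card (G A))" using finTr by (rule card_UN_le)
    finally have "real (card {\<tau> \<in> Pow ?I. sw \<tau> z \<in> J}) \<le> real (\<Sum>A\<in>?Tr. card (G A))"
      by (rule of_nat_mono)
    also have "\<dots> = (\<Sum>A\<in>?Tr. real (card (G A)))" by (rule of_nat_sum)
    also have "\<dots> \<le> (\<Sum>A\<in>?Tr. 2 powr (real s - \<epsilon> * real s / 2))"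
      unfolding G_def by (intro sum_mono card_good_swaps)
    also have "\<dots> = real (card ?Tr) * 2 powr (real s - \<epsilon> * real s / 2)" by simp
    also have "\<dots> \<le> B"
    proof -
      have "card ?Tr \<le> (\<Sum>i\<le>d. card ?F choose i)" by (intro card_traces_le d) auto
      also have "\<dots> \<le> (\<Sum>i\<le>d. 2 * s choose i)"
        using card_image_le[of ?K z] by (intro sum_mono binomial_right_mono) simp
      finally show ?thesis unfolding B_def by (intro mult_right_mono of_nat_mono) simp_all
    qed
    finally have "real (card {\<tau> \<in> Pow ?I. sw \<tau> z \<in> J}) \<le> B" .
    moreover have "(\<Sum>\<tau>\<in>Pow ?I. indicator J (sw \<tau> z)) = (of_nat (card {\<tau> \<in> Pow ?I. sw \<tau> z \<in> J}) :: ennreal)"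
    proof -
      have "(\<Sum>\<tau>\<in>Pow ?I. indicator J (sw \<tau> z)) = (\<Sum>\<tau>\<in>Pow ?I. if sw \<tau> z \<in> J then 1 else (0::ennreal))"
        by (intro sum.cong refl) (simp only: indicator_def of_bool_def)
      also have "\<dots> = (\<Sum>\<tau>\<in>{\<tau> \<in> Pow ?I. sw \<tau> z \<in> J}. 1)" by (rule sum.inter_filter[symmetric]) simp
      also have "\<dots> = of_nat (card {\<tau> \<in> Pow ?I. sw \<tau> z \<in> J})" by (simp only: sum_constant mult_1_right)
      finally show ?thesis .
    qed
    ultimately show ?thesis by (simp only: ennreal_of_nat_eq_real_of_nat ennreal_leI)
  qed
  have "of_nat (2 ^ s) * emeasure ?MM J = (\<Sum>\<tau>\<in>Pow ?I. emeasure ?MM J)" by (simp add: card_Pow)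
  also have "\<dots> = (\<Sum>\<tau>\<in>Pow ?I. \<integral>\<^sup>+z. indicator J (sw \<tau> z) \<partial>?MM)"
  proof (intro sum.cong refl)
    fix \<tau> assume "\<tau> \<in> Pow ?I"
    then have \<tau>: "\<tau> \<subseteq> ?I" by simp
    have "emeasure ?MM J = (\<integral>\<^sup>+z. indicator J z \<partial>distr ?MM ?MM (sw \<tau>))" using J by (simp add: sw_distr[OF \<tau>])
    also have "\<dots> = (\<integral>\<^sup>+z. indicator J (sw \<tau> z) \<partial>?MM)" using J by (intro nn_integral_distr sw_meas \<tau>) auto
    finally show "emeasure ?MM J = (\<integral>\<^sup>+z. indicator J (sw \<tau> z) \<partial>?MM)" .
  qed
  also have "\<dots> = (\<integral>\<^sup>+z. (\<Sum>\<tau>\<in>Pow ?I. indicator J (sw \<tau> z)) \<partial>?MM)"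
    using J sw_meas by (intro nn_integral_sum[symmetric] measurable_compose[OF sw_meas borel_measurable_indicator]) auto
  also have "\<dots> \<le> (\<integral>\<^sup>+z. ennreal B \<partial>?MM)" by (intro nn_integral_mono pointwise)
  also have "\<dots> = ennreal B" by (simp add: MM.emeasure_space_1)
  finally have "ennreal (2 ^ s * measure ?MM J) \<le> ennreal B"
    unfolding MM.emeasure_eq_measure ennreal_of_nat_eq_real_of_nat by (subst ennreal_mult) simp_all
  moreover have "B \<ge> 0" unfolding B_def by (intro mult_nonneg_nonneg of_nat_0_le_iff powr_ge_zero)
  ultimately have "2 ^ s * measure ?MM J \<le> B" by (subst (asm) ennreal_le_iff)
  then have "measure ?MM J \<le> B / 2 ^ s" by (simp add: field_simps)
  also have "\<dots> = real (\<Sum>i\<le>d. 2 * s choose i) * 2 powr (- (\<epsilon> * real s / 2))"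
  proof -
    have "2 powr (real s - \<epsilon> * real s / 2) = 2 powr (- (\<epsilon> * real s / 2)) * 2 ^ s"
      by (simp flip: powr_realpow powr_add)
    then show ?thesis by (simp add: B_def)
  qed
  finally show ?thesis using lower by linarith
qed

section \<open>Learning half-spaces and the sample complexity\<close>

text \<open>A countable dense set of normal vectors and offsets suffices to realise every labelling of a finite
set by half-spaces of the class.\<close>

lemma affine_signs_countable_approx:
  fixes W :: "'a::euclidean_space set"
  obtains \<C>\<^sub>0 where "countable \<C>\<^sub>0" "\<C>\<^sub>0 \<subseteq> affine_signs W"
    "\<And>h F. h \<in> affine_signs W \<Longrightarrow> finite F \<Longrightarrow> \<exists>h\<^sub>0\<in>\<C>\<^sub>0. \<forall>u\<in>F. h\<^sub>0 u = h u"
proof -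
  define sgn :: "'a \<times> real \<Rightarrow> 'a \<Rightarrow> bool" where "sgn = (\<lambda>t u. u \<bullet> fst t + snd t > 0)"
  obtain T where T: "countable T" "T \<subseteq> W \<times> (UNIV::real set)" "W \<times> UNIV \<subseteq> closure T"
    using separable[of "W \<times> (UNIV::real set)"] by metis
  have approx: "\<exists>h\<^sub>0\<in>sgn ` T. \<forall>u\<in>F. h\<^sub>0 u = h u" if h: "h \<in> affine_signs W" and "finite F" for h F
  proof -
    obtain w c where w: "w \<in> W" and hw: "h = (\<lambda>u. u \<bullet> w + c > 0)" using h by (auto simp: affine_signs_def)
    \<comment> \<open>lowering the constant slightly makes all signs strict, so they persist nearby\<close>
    obtain \<delta> where \<delta>: "\<delta> > 0" "\<And>u. u \<in> F \<Longrightarrow> u \<bullet> w + c > 0 \<Longrightarrow> \<delta> < u \<bullet> w + c"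
    proof -
      define \<delta> where "\<delta> = Min (insert 1 ((\<lambda>u. (u \<bullet> w + c) / 2) ` {u\<in>F. u \<bullet> w + c > 0}))"
      have fin: "finite (insert 1 ((\<lambda>u. (u \<bullet> w + c) / 2) ` {u\<in>F. u \<bullet> w + c > 0}))" using \<open>finite F\<close> by simp
      have "\<delta> > 0" unfolding \<delta>_def using fin by (subst Min_gr_iff) auto
      moreover have "\<delta> < u \<bullet> w + c" if "u \<in> F" "u \<bullet> w + c > 0" for u
      proof -
        have "\<delta> \<le> (u \<bullet> w + c) / 2" unfolding \<delta>_def using fin that by (intro Min_le) auto
        also have "\<dots> < u \<bullet> w + c" using that(2) by (simp add: field_simps)
        finally show ?thesis .
      qed
      ultimately show ?thesis by (rule that)
    qed
    define U where "U = (\<Inter>u\<in>F. if h u then {t. u \<bullet> fst t + snd t > (0::real)} else {t. u \<bullet> fst t + snd t < 0})"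
    have "open {t. u \<bullet> fst t + snd t > (0::real)}" "open {t. u \<bullet> fst t + snd t < (0::real)}" for u :: 'a
      by (intro open_Collect_less continuous_intros)+
    then have "open U" unfolding U_def using \<open>finite F\<close> by (intro open_INT) auto
    moreover have "(w, c - \<delta>) \<in> U" unfolding U_def using \<delta> by (auto simp: hw not_less) fastforce
    moreover have "(w, c - \<delta>) \<in> closure T" using T w by auto
    ultimately have "U \<inter> T \<noteq> {}" by (metis disjoint_iff open_Int_closure_eq_empty)
    then obtain t where t: "t \<in> U" "t \<in> T" by blast
    have "sgn t u = h u" if "u \<in> F" for u
      using INT_D[OF t(1)[unfolded U_def] that] by (cases "h u") (simp_all add: sgn_def)
    then show ?thesis using t(2) by blast
  qed
  have "sgn ` T \<subseteq> affine_signs W"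
  proof
    fix g assume "g \<in> sgn ` T"
    then obtain t where "t \<in> T" "g = (\<lambda>u. u \<bullet> fst t + snd t > 0)" by (auto simp: sgn_def fun_eq_iff)
    moreover have "fst t \<in> W" using T(2) \<open>t \<in> T\<close> by auto
    ultimately show "g \<in> affine_signs W"
      unfolding affine_signs_def mem_Collect_eq by (intro exI[of _ "fst t"] exI[of _ "snd t"] conjI)
  qed
  then show ?thesis using T(1) approx by (intro that[of "sgn ` T"]) simp_all
qed

lemma affine_signs_borel:
  fixes W :: "'a::euclidean_space set"
  assumes "h \<in> affine_signs W"
  shows "{u. h u} \<in> sets borel"
proof -
  obtain w c where "h = (\<lambda>u. u \<bullet> w + c > 0)" using assms by (auto simp: affine_signs_def)
  moreover have "open {u. u \<bullet> w + c > 0}" by (intro open_Collect_less continuous_intros)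
  ultimately show ?thesis by simp
qed

lemma vc_dim_attained:
  assumes "\<C> \<noteq> {}" and K: "\<And>D. finite D \<Longrightarrow> shattered \<C> D \<Longrightarrow> card D \<le> K"
  shows "\<exists>D. finite D \<and> shattered \<C> D \<and> vc_dim \<C> = enat (card D) \<and>
    (\<forall>D'. finite D' \<longrightarrow> shattered \<C> D' \<longrightarrow> card D' \<le> card D)"
proof -
  define S where "S = {D. finite D \<and> shattered \<C> D}"
  have "card D \<le> K" if "D \<in> S" for D
    using that unfolding S_def mem_Collect_eq by (intro K) simp_all
  then have "card ` S \<subseteq> {..K}" by blast
  then have fin: "finite (card ` S)" by (rule finite_subset) simp
  have "{} \<in> S" using assms(1) by (simp add: S_def shattered_def ex_in_conv)
  then have "Max (card ` S) \<in> card ` S" using fin by (intro Max_in) auto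
  then obtain D where D: "D \<in> S" "card D = Max (card ` S)" by auto
  have le: "card D' \<le> card D" if "D' \<in> S" for D' using fin that by (simp add: D(2))
  have "vc_dim \<C> = enat (card D)"
    unfolding vc_dim_def S_def[symmetric]
    using D(1) le by (intro antisym SUP_least SUP_upper) auto
  moreover have "card D' \<le> card D" if "finite D'" "shattered \<C> D'" for D'
    using that by (intro le) (simp add: S_def)
  moreover have "finite D" "shattered \<C> D" using D(1) by (simp_all add: S_def)
  ultimately show ?thesis by (intro exI[of _ D]) simp
qed

lemma two_powr_17_4: "2 powr (17/4) \<le> (20::real)"
proof -
  have "(2 powr (17/4)) ^ 4 = 2 powr (real 17)" by (simp add: powr_powr flip: powr_realpow)
  also have "\<dots> = 2 ^ 17" by (subst powr_realpow) simp_all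
  also have "\<dots> \<le> (20::real) ^ 4" by simp
  finally show ?thesis by (rule power_le_imp_le_base[where n = 3, simplified]) simp
qed

text \<open>The hypothesis on \<open>s\<close> allows for rounding down: it holds for \<open>s = nat \<lfloor>M\<rfloor>\<close>.  The loss of
\<open>\<epsilon> / 4\<close> in the exponent is made up for by \<open>L = log 2 (8 * exp 1 / \<epsilon>)\<close> being at least
\<open>17/4\<close>.\<close>

lemma sufficient_sample_size:
  fixes d s :: nat and \<epsilon> \<delta> M :: real
  assumes "d \<ge> 1" "0 < \<epsilon>" "\<epsilon> < 1" "\<delta> > 0"
    and M: "8 * real d / \<epsilon> * log 2 (8 * exp 1 / \<epsilon>) \<le> M" "4 / \<epsilon> * log 2 (2 / \<delta>) \<le> M"
    and s: "M < real s + 1"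
  shows "\<epsilon> * real s \<ge> 8" "s \<ge> 1"
    "2 * (real (\<Sum>i\<le>d. 2 * s choose i) * 2 powr (- (\<epsilon> * real s / 2))) < \<delta>"
proof -
  define L where "L = log 2 (8 * exp 1 / \<epsilon>)"
  have "exp 1 \<ge> (5/2::real)" using exp_lower_Taylor_quadratic[of 1] by simp
  then have "2 powr (17/4) \<le> 8 * exp (1::real)" using two_powr_17_4 by linarith
  also have "\<dots> \<le> 8 * exp 1 / \<epsilon>" using assms by (simp add: field_simps mult_left_le)
  finally have L: "L \<ge> 17/4" unfolding L_def using assms by (subst le_log_iff) auto
  define v where "v = \<epsilon> * real s / (8 * real d)"
  have sv: "\<epsilon> * real s = 8 * real d * v" using assms by (simp add: v_def)
  have v: "v \<ge> L - 1/8"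
  proof -
    have "8 * real d * L = \<epsilon> * (8 * real d / \<epsilon> * L)" using assms by simp
    also have "\<dots> \<le> \<epsilon> * (real s + 1)" using M(1) s assms unfolding L_def by (intro mult_left_mono) auto
    also have "\<dots> \<le> 8 * real d * v + real d" using assms sv by (simp add: algebra_simps)
    finally have "real d * (8 * L) \<le> real d * (8 * v + 1)" by (simp add: algebra_simps)
    then show ?thesis using assms by simp
  qed
  have v4: "v \<ge> 4" using v L by linarith
  have dv: "1 * 4 \<le> real d * v" using assms v4 by (intro mult_mono) auto
  then show s8: "\<epsilon> * real s \<ge> 8" by (simp add: sv)
  then show s1: "s \<ge> 1" by (cases s) auto
  have "real d \<le> real (2 * s)"
  proof -
    have "real d * 1 \<le> real d * (8 * v)" using v4 by (intro mult_left_mono) simp_all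
    also have "\<dots> = 8 * real d * v" by simp
    also have "\<dots> = \<epsilon> * real s" by (simp add: sv)
    also have "\<dots> \<le> real s" using assms by (simp add: mult_left_le_one_le)
    finally show ?thesis by simp
  qed
  then have "d \<le> 2 * s" by simp
  have "real (\<Sum>i\<le>d. 2 * s choose i) \<le> (exp 1 * real (2 * s) / real d) ^ d"
    using assms(1) \<open>d \<le> 2 * s\<close> by (rule sum_binomial_le)
  also have "exp 1 * real (2 * s) / real d = 2 * (8 * exp 1 / \<epsilon>) * v" using assms by (simp add: v_def field_simps)
  also have "8 * exp 1 / \<epsilon> = 2 powr L" unfolding L_def using assms by (subst powr_log_cancel) auto
  also have "(2 * 2 powr L * v) ^ d \<le> (2 powr (1 + L + v / 2)) ^ d"
  proof (rule power_mono)
    have "v \<le> 2 powr (v / 2)" using two_powr_ge_double[of "v / 2"] v4 by simp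
    then have "2 * 2 powr L * v \<le> 2 * 2 powr L * 2 powr (v / 2)" by (intro mult_left_mono) auto
    also have "\<dots> = 2 powr (1 + L + v / 2)" by (simp add: powr_add)
    finally show "2 * 2 powr L * v \<le> 2 powr (1 + L + v / 2)" .
  qed (use v4 in auto)
  also have "\<dots> = 2 powr (real d * (1 + L + v / 2))" by (simp add: powr_powr mult.commute flip: powr_realpow)
  finally have growth: "real (\<Sum>i\<le>d. 2 * s choose i) \<le> 2 powr (real d * (1 + L + v / 2))" .
  have "log 2 (2 / \<delta>) = \<epsilon> / 4 * (4 / \<epsilon> * log 2 (2 / \<delta>))" using assms by simp
  also have "\<dots> < \<epsilon> / 4 * (real s + 1)" using M(2) s assms by (intro mult_strict_left_mono) auto
  finally have "2 / \<delta> < 2 powr (\<epsilon> / 4 * (real s + 1))" using assms by (subst (asm) log_less_iff) auto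
  then have conf: "2 < \<delta> * 2 powr (\<epsilon> / 4 * (real s + 1))" using assms by (simp add: field_simps)
  have pos: "2 powr (real d * (1 + L + v / 2)) * 2 powr (- (\<epsilon> * real s / 2)) > 0" by simp
  have "2 * (real (\<Sum>i\<le>d. 2 * s choose i) * 2 powr (- (\<epsilon> * real s / 2))) \<le>
     2 * (2 powr (real d * (1 + L + v / 2)) * 2 powr (- (\<epsilon> * real s / 2)))"
    using growth by (intro mult_left_mono mult_right_mono) auto
  also have "\<dots> < (\<delta> * 2 powr (\<epsilon> / 4 * (real s + 1))) * (2 powr (real d * (1 + L + v / 2)) * 2 powr (- (\<epsilon> * real s / 2)))"
    using conf pos by (rule mult_strict_right_mono)
  also have "\<dots> = \<delta> * 2 powr (\<epsilon> / 4 * (real s + 1) + real d * (1 + L + v / 2) - \<epsilon> * real s / 2)"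
  proof -
    have "2 powr (a + b - c) = 2 powr a * (2 powr b * 2 powr (- c))" for a b c :: real
      by (simp add: algebra_simps flip: powr_add)
    then show ?thesis by (simp only: mult.assoc)
  qed
  also have "\<dots> \<le> \<delta> * 2 powr 0"
  proof (intro mult_left_mono powr_mono)
    have "\<epsilon> / 4 * (real s + 1) + real d * (1 + L + v / 2) - \<epsilon> * real s / 2 =
        \<epsilon> / 4 + real d * (1 + L + v / 2) - \<epsilon> * real s / 4" by (simp add: field_simps)
    also have "\<dots> \<le> real d * (1/4) + real d * (1 + (v + 1/8) + v / 2) - 2 * real d * v"
      using assms v sv by (intro diff_mono add_mono mult_left_mono) auto
    also have "\<dots> = real d * (11/8 - v / 2)" by (simp add: algebra_simps)
    also have "\<dots> \<le> 0" using v4 by (intro mult_nonneg_nonpos) auto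
    finally show "\<epsilon> / 4 * (real s + 1) + real d * (1 + L + v / 2) - \<epsilon> * real s / 2 \<le> 0" .
  qed (use assms in auto)
  finally show "2 * (real (\<Sum>i\<le>d. 2 * s choose i) * 2 powr (- (\<epsilon> * real s / 2))) < \<delta>" by simp
qed

lemma sample_complexity_le:
  assumes "s \<ge> 1" "\<And>P \<phi>. prob_measure P \<Longrightarrow> \<phi> \<in> \<C> \<Longrightarrow> measure (PiM {..<s} (\<lambda>_. P)) (bad_samples \<psi> P \<phi> s \<epsilon>) < \<delta>"
  obtains r where "sample_complexity \<C> \<psi> \<epsilon> \<delta> = enat r" "r \<le> s"
proof -
  have "sample_complexity \<C> \<psi> \<epsilon> \<delta> \<le> enat s"
    unfolding sample_complexity_def by (rule Inf_lower) (use assms in blast)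
  then show ?thesis using that by (metis enat_ile enat_ord_simps(1))
qed

lemma bad_samples_prob_less:
  fixes \<C> :: "('x::topological_space \<Rightarrow> bool) set"
  assumes C0: "countable \<C>\<^sub>0" "\<C>\<^sub>0 \<subseteq> \<C>"
    and approx: "\<And>h F. h \<in> \<C> \<Longrightarrow> finite F \<Longrightarrow> \<exists>h\<^sub>0\<in>\<C>\<^sub>0. \<forall>u\<in>F. h\<^sub>0 u = h u"
    and borel: "\<And>h. h \<in> \<C> \<Longrightarrow> {u. h u} \<in> sets borel"
    and d: "\<And>S. finite S \<Longrightarrow> shattered \<C> S \<Longrightarrow> card S \<le> d"
    and \<psi>: "is_identifier \<C> \<psi>" "agrees_with_sample \<C> \<psi>" "measurable_errors \<C> \<psi> \<epsilon>"
    and P: "prob_measure P" and \<phi>: "\<phi> \<in> \<C>" and s: "\<epsilon> * real s \<ge> 8" "s \<ge> 1"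
  shows "measure (PiM {..<s} (\<lambda>_. P)) (bad_samples \<psi> P \<phi> s \<epsilon>)
    \<le> 2 * (real (\<Sum>i\<le>d. 2 * s choose i) * 2 powr (- (\<epsilon> * real s / 2)))"
proof (rule double_sample_bound[OF _ C0 _ approx \<phi> d])
  have P': "prob_space P" "sets P = sets borel" using P by (auto simp: prob_measure_def)
  then have "space P = UNIV" using sets_eq_imp_space_eq[of P borel] by simp
  then show "{u \<in> space P. h u} \<in> sets P" if "h \<in> \<C>" for h using borel[OF that] P' by simp
  show "prob_space P" by fact
  show "bad_samples \<psi> P \<phi> s \<epsilon> \<in> sets (PiM {..<s} (\<lambda>_. P))"
    using \<psi>(3) P \<phi> s(2) unfolding measurable_errors_def by blast
  fix x assume x: "x \<in> bad_samples \<psi> P \<phi> s \<epsilon>"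
  define w where "w = labelled \<phi> (map x [0..<s])"
  have "map x [0..<s] \<noteq> []" using s(2) by simp
  then have w: "w \<in> samples \<C>"
    unfolding samples_def w_def mem_Collect_eq using \<phi> by (intro exI conjI) (rule refl)
  have "\<psi> w \<in> \<C>" using \<psi>(1) w by (simp add: is_identifier_def)
  moreover have "\<psi> w (x i) = \<phi> (x i)" if "i < s" for i
  proof -
    have "(x i, \<phi> (x i)) \<in> set w" using that by (auto simp: w_def labelled_def)
    then show ?thesis using \<psi>(2) w unfolding agrees_with_sample_def by blast
  qed
  moreover have "measure P {u \<in> space P. \<psi> w u \<noteq> \<phi> u} \<ge> \<epsilon>"
    using x by (simp add: bad_samples_def err_def w_def)
  ultimately show "\<exists>h\<in>\<C>. (\<forall>i<s. h (x i) = \<phi> (x i)) \<and> measure P {u \<in> space P. h u \<noteq> \<phi> u} \<ge> \<epsilon>" by blast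
qed (use s in auto)

text \<open>For \<open>\<epsilon> \<ge> 1\<close> no sample is bad, since errors are probabilities, and sample size 1 suffices.\<close>

lemma sample_complexity_bound:
  fixes \<C> :: "('x::topological_space \<Rightarrow> bool) set"
  assumes C0: "countable \<C>\<^sub>0" "\<C>\<^sub>0 \<subseteq> \<C>"
    and approx: "\<And>h F. h \<in> \<C> \<Longrightarrow> finite F \<Longrightarrow> \<exists>h\<^sub>0\<in>\<C>\<^sub>0. \<forall>u\<in>F. h\<^sub>0 u = h u"
    and borel: "\<And>h. h \<in> \<C> \<Longrightarrow> {u. h u} \<in> sets borel"
    and d: "\<And>S. finite S \<Longrightarrow> shattered \<C> S \<Longrightarrow> card S \<le> d" "d \<ge> 1"
    and \<psi>: "is_identifier \<C> \<psi>" "agrees_with_sample \<C> \<psi>" "measurable_errors \<C> \<psi> \<epsilon>"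
    and "\<epsilon> > 0" "\<delta> > 0"
  defines "M \<equiv> max (8 * real d / \<epsilon> * log 2 (8 * exp 1 / \<epsilon>)) (4 / \<epsilon> * log 2 (2 / \<delta>))"
  shows "\<exists>s. sample_complexity \<C> \<psi> \<epsilon> \<delta> = enat s \<and> (\<epsilon> \<le> 1 \<longrightarrow> real s \<le> M) \<and> real s \<le> max 1 M"
proof (cases "\<epsilon> < 1")
  case True
  define s where "s = nat \<lfloor>M\<rfloor>"
  have sM: "M < real s + 1" unfolding s_def by linarith
  note size = sufficient_sample_size[OF \<open>d \<ge> 1\<close> \<open>\<epsilon> > 0\<close> True \<open>\<delta> > 0\<close> _ _ sM]
  have M: "8 * real d / \<epsilon> * log 2 (8 * exp 1 / \<epsilon>) \<le> M" "4 / \<epsilon> * log 2 (2 / \<delta>) \<le> M" by (auto simp: M_def)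
  have "real s \<le> M" using size(2)[OF M] unfolding s_def by linarith
  have "measure (PiM {..<s} (\<lambda>_. P)) (bad_samples \<psi> P \<phi> s \<epsilon>) < \<delta>" if "prob_measure P" "\<phi> \<in> \<C>" for P \<phi>
    by (rule le_less_trans[OF bad_samples_prob_less[OF C0 approx borel d(1) \<psi> that size(1,2)[OF M]] size(3)[OF M]])
  then obtain r where "sample_complexity \<C> \<psi> \<epsilon> \<delta> = enat r" "r \<le> s"
    by (rule sample_complexity_le[OF size(2)[OF M]])
  then show ?thesis using \<open>real s \<le> M\<close> by (intro exI[of _ r]) auto
next
  case False
  have "bad_samples \<psi> P \<phi> 1 \<epsilon> = {}" if "prob_measure P" for P \<phi>
  proof -
    interpret prob_space P using that by (simp add: prob_measure_def)
    have "err \<psi> P \<phi> us \<le> \<epsilon>" for us unfolding err_def using prob_le_1 False by (meson not_less order_trans)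
    then show ?thesis by (simp add: bad_samples_def not_less)
  qed
  then have "measure (PiM {..<1} (\<lambda>_. P)) (bad_samples \<psi> P \<phi> 1 \<epsilon>) < \<delta>" if "prob_measure P" for P \<phi>
    using that \<open>\<delta> > 0\<close> by simp
  then obtain r where r: "sample_complexity \<C> \<psi> \<epsilon> \<delta> = enat r" "r \<le> 1"
    using sample_complexity_le[of 1 \<C> \<psi> \<epsilon> \<delta>] by auto
  moreover have "real r \<le> M" if "\<epsilon> \<le> 1"
  proof -
    have "\<epsilon> = 1" using that False by simp
    have "1 \<le> log 2 (8 * exp 1)" using exp_ge_add_one_self[of "1::real"] by (simp add: le_log_iff)
    then have "1 * 1 \<le> 8 * real d * log 2 (8 * exp 1)" using \<open>d \<ge> 1\<close> by (intro mult_mono) auto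
    also have "\<dots> \<le> M" by (simp add: M_def \<open>\<epsilon> = 1\<close>)
    finally show ?thesis using r(2) by simp
  qed
  ultimately show ?thesis by (intro exI[of _ r]) auto
qed

lemma zero_in_responses: "0 \<in> responses TYPE('n::finite) \<omega>"
proof -
  have "costate (0::real^'n^'n) 1 (\<lambda>_. 1)" by (simp add: costate_def)
  moreover have "0 = response \<omega> 0 (\<lambda>_. 1 :: real^'n)" by (simp add: response_def vec_eq_iff)
  ultimately show ?thesis unfolding responses_def mem_Collect_eq
    by (intro exI conjI)
qed

lemma singleton_shattered:
  assumes "0 \<in> W"
  shows "shattered (affine_signs W) {u}"
  unfolding shattered_def
proof
  fix f
  have "(\<lambda>G. G \<bullet> 0 + (if f u then 1 else - 1) > 0) \<in> affine_signs W"
    unfolding affine_signs_def mem_Collect_eq using assms by (intro exI conjI) (rule refl)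
  then show "\<exists>h\<in>affine_signs W. \<forall>x\<in>{u}. h x = f x" by (rule bexI[rotated]) simp
qed

theorem theorem2p1:
  fixes \<omega> :: "'k::finite \<Rightarrow> real \<Rightarrow> real"
    and l :: "'k \<Rightarrow> nat" and \<alpha> \<beta> :: "'k \<Rightarrow> real"
  assumes "basis_inputs l \<alpha> \<beta> \<omega>"
  shows
    "let \<C> = (scalar_sign_class TYPE('n::finite) \<omega> :: (real^'k^'m::finite \<Rightarrow> bool) set);
         n = CARD('n); m = CARD('m); k = CARD('k); lmax = Max (range l)
     in \<exists>d::nat. vc_dim \<C> = enat d \<and>
          real d \<le> 2 * (2 * real m * real n ^ 2 + 4 * real n + 1) *
            log 2 (8 * exp 1 * (8 * real m * real n ^ 2 * real k * (real n + real lmax) + 1)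
                   * (2 * real n * real k + 2 * (1 + 2 * real k) ^ n)) \<and>
          (\<forall>\<psi> \<epsilon> \<delta>. is_identifier \<C> \<psi> \<and> agrees_with_sample \<C> \<psi> \<and> measurable_errors \<C> \<psi> \<epsilon>
              \<and> \<epsilon> > 0 \<and> \<delta> > 0 \<longrightarrow>
            (let M = max (8 * real d / \<epsilon> * log 2 (8 * exp 1 / \<epsilon>)) (4 / \<epsilon> * log 2 (2 / \<delta>))
             in \<exists>s::nat. sample_complexity \<C> \<psi> \<epsilon> \<delta> = enat s \<and>
                  (\<epsilon> \<le> 1 \<longrightarrow> real s \<le> M) \<and> real s \<le> max 1 M))"
proof -
  define W where "W = (responses TYPE('n) \<omega> :: (real^'k^'m) set)"
  define X where "X = 2 * (2 * real CARD('m) * real CARD('n) ^ 2 + 4 * real CARD('n) + 1) *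
     log 2 (8 * exp 1 * (8 * real CARD('m) * real CARD('n) ^ 2 * real CARD('k) * (real CARD('n) + real (Max (range l))) + 1)
       * (2 * real CARD('n) * real CARD('k) + 2 * (1 + 2 * real CARD('k)) ^ CARD('n)))"
  have class_eq: "scalar_sign_class TYPE('n) \<omega> = affine_signs W"
    unfolding W_def by (rule scalar_sign_class_eq[OF basis_input_continuous[OF assms]])
  have shattered_le: "real (card D) \<le> X" if "finite D" "shattered (affine_signs W) D" for D
    using shattered_card_bound[OF assms that[unfolded W_def]] by (simp only: X_def)
  have one: "shattered (affine_signs W) {0}" unfolding W_def by (intro singleton_shattered zero_in_responses)
  then have "affine_signs W \<noteq> {}" by (auto simp: shattered_def)
  moreover have "card D \<le> nat \<lfloor>X\<rfloor>" if "finite D" "shattered (affine_signs W) D" for D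
    using shattered_le[OF that] by linarith
  ultimately have "\<exists>D. finite D \<and> shattered (affine_signs W) D \<and> vc_dim (affine_signs W) = enat (card D) \<and>
      (\<forall>D'. finite D' \<longrightarrow> shattered (affine_signs W) D' \<longrightarrow> card D' \<le> card D)"
    by (rule vc_dim_attained)
  then obtain D where D: "finite D" "shattered (affine_signs W) D" "vc_dim (affine_signs W) = enat (card D)"
    and max: "\<forall>D'. finite D' \<longrightarrow> shattered (affine_signs W) D' \<longrightarrow> card D' \<le> card D"
    by (elim exE conjE)
  define d where "d = card D"
  have d: "vc_dim (affine_signs W) = enat d"
    "\<And>S. finite S \<Longrightarrow> shattered (affine_signs W) S \<Longrightarrow> card S \<le> d"
    using D(3) max unfolding d_def by simp_all
  have "d \<ge> 1" using d(2)[OF _ one] by simp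
  have "real d \<le> X" using shattered_le[OF D(1,2)] by (simp only: d_def)
  obtain \<C>\<^sub>0 where C0: "countable \<C>\<^sub>0" "\<C>\<^sub>0 \<subseteq> affine_signs W"
    "\<And>h F. h \<in> affine_signs W \<Longrightarrow> finite F \<Longrightarrow> \<exists>h\<^sub>0\<in>\<C>\<^sub>0. \<forall>u\<in>F. h\<^sub>0 u = h u"
    by (rule affine_signs_countable_approx[of W]) blast
  note learn = sample_complexity_bound[OF C0 affine_signs_borel d(2) \<open>d \<ge> 1\<close>]
  show ?thesis
    unfolding Let_def class_eq
  proof (rule exI[of _ d], intro conjI allI impI)
    show "vc_dim (affine_signs W) = enat d" by fact
  next
    show "real d \<le> 2 * (2 * real CARD('m) * real CARD('n) ^ 2 + 4 * real CARD('n) + 1) *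
     log 2 (8 * exp 1 * (8 * real CARD('m) * real CARD('n) ^ 2 * real CARD('k) * (real CARD('n) + real (Max (range l))) + 1)
       * (2 * real CARD('n) * real CARD('k) + 2 * (1 + 2 * real CARD('k)) ^ CARD('n)))"
      using \<open>real d \<le> X\<close> by (simp only: X_def)
  next
    fix \<psi> \<epsilon> \<delta>
    assume *: "is_identifier (affine_signs W) \<psi> \<and> agrees_with_sample (affine_signs W) \<psi> \<and>
      measurable_errors (affine_signs W) \<psi> \<epsilon> \<and> \<epsilon> > 0 \<and> \<delta> > (0::real)"
    show "\<exists>s. sample_complexity (affine_signs W) \<psi> \<epsilon> \<delta> = enat s \<and>
       (\<epsilon> \<le> 1 \<longrightarrow> real s \<le> max (8 * real d / \<epsilon> * log 2 (8 * exp 1 / \<epsilon>)) (4 / \<epsilon> * log 2 (2 / \<delta>))) \<and>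
       real s \<le> max 1 (max (8 * real d / \<epsilon> * log 2 (8 * exp 1 / \<epsilon>)) (4 / \<epsilon> * log 2 (2 / \<delta>)))"
      by (rule learn) (use * in auto)
  qed
qed

end
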